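(* Let $\alpha>0$. A discrete set $\Gamma\subset\mathbb{C}$ is a set of interpolation for $F_\alpha^\infty$ if and only if $\Gamma$ is uniformly discrete and $D^+(\Gamma)<\alpha/\pi$.
   Context: For $\alpha>0$, $F_\alpha^\infty$ is the Banach space of entire functions $f$ with $\|f\|_\infty=\sup_{z\in\mathbb{C}}e^{-\alpha|z|^2/2}|f(z)|<\infty$. A discrete set $\Gamma=\{z_j\}\subset\mathbb{C}$ (distinct points) is a set of interpolation for $F_\alpha^\infty$ if for every bounded sequence $\{a_j\}$ of complex numbers there exists $f\in F_\alpha^\infty$ such that $e^{-\alpha|z_j|^2/2}f(z_j)=a_j$ for all $j$. A set $\Gamma=\{z_j\}\subset\mathbb{C}$ (distinct points) is uniformly discrete if $q=\inf_{j\ne k}|z_j-z_k|>0$. Upper uniform density: fix a compact set $I\subset\mathbb{C}$ of (Lebesgue) measure $1$ whose boundary has measure $0$. For a uniformly discrete set $\Gamma$ and $r>0$, let $n^+(r)$ be the largest number of points of $\Gamma$ to be found in a translate of $rI$. Then $D^+(\Gamma)=\limsup_{r\to\infty} n^+(r)/r^2$. (This value is independent of the choice of $I$, by a result of Landau.) *)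

theory Defs
  imports "HOL-Analysis.Analysis"
begin

definition fock_norm :: "real \<Rightarrow> (complex \<Rightarrow> complex) \<Rightarrow> ereal" where
  "fock_norm \<alpha> f = (SUP z. ereal (exp (- \<alpha> * (cmod z)\<^sup>2 / 2) * cmod (f z)))"

definition fock_space :: "real \<Rightarrow> (complex \<Rightarrow> complex) set" where
  "fock_space \<alpha> = {f. f holomorphic_on UNIV \<and> fock_norm \<alpha> f < \<infinity>}"

text \<open>A bounded sequence indexed like the distinct points of \<open>\<Gamma>\<close> is a function \<open>a\<close> that is
  bounded on \<open>\<Gamma>\<close>; its values off \<open>\<Gamma>\<close> are irrelevant.\<close>

definition interpolation_set :: "real \<Rightarrow> complex set \<Rightarrow> bool" where
  "interpolation_set \<alpha> \<Gamma> \<longleftrightarrow>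
     (\<forall>a :: complex \<Rightarrow> complex. bounded (a ` \<Gamma>) \<longrightarrow>
        (\<exists>f \<in> fock_space \<alpha>. \<forall>z \<in> \<Gamma>.
           complex_of_real (exp (- \<alpha> * (cmod z)\<^sup>2 / 2)) * f z = a z))"

text \<open>The largest number of points of \<open>\<Gamma>\<close> in a translate of \<open>r I\<close>. Meaningful for uniformly
  discrete \<open>\<Gamma>\<close> and bounded \<open>I\<close>: then all the cardinalities are those of finite sets and the
  maximum is over a finite set, see the two lemmas below.\<close>

definition max_count :: "complex set \<Rightarrow> complex set \<Rightarrow> real \<Rightarrow> nat" where
  "max_count I \<Gamma> r = Max (range (\<lambda>w. card (\<Gamma> \<inter> (+) w ` (*\<^sub>R) r ` I)))"

definition upper_uniform_density :: "complex set \<Rightarrow> complex set \<Rightarrow> ereal" where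
  "upper_uniform_density I \<Gamma> = Limsup at_top (\<lambda>r::real. ereal (real (max_count I \<Gamma> r) / r\<^sup>2))"

lemma card_translates_bounded:
  fixes \<Gamma> K :: "complex set"
  assumes "uniform_discrete \<Gamma>" "bounded K"
  shows "\<exists>N. \<forall>w. finite (\<Gamma> \<inter> (+) w ` K) \<and> card (\<Gamma> \<inter> (+) w ` K) \<le> N"
proof -
  obtain e where e: "e > 0" "\<And>x y. x \<in> \<Gamma> \<Longrightarrow> y \<in> \<Gamma> \<Longrightarrow> dist x y < e \<Longrightarrow> x = y"
    using assms(1) unfolding uniform_discrete_def by blast
  have "compact (closure K)"
    using assms(2) by simp
  then obtain C where C: "finite C" "closure K \<subseteq> (\<Union>c\<in>C. ball c (e / 2))"
    using e(1) compact_eq_totally_bounded[of "closure K"] half_gt_zero by blast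
  have "finite (\<Gamma> \<inter> (+) w ` K) \<and> card (\<Gamma> \<inter> (+) w ` K) \<le> card C" for w
  proof -
    have "\<forall>x \<in> \<Gamma> \<inter> (+) w ` K. \<exists>c \<in> C. dist (w + c) x < e / 2"
    proof
      fix x assume "x \<in> \<Gamma> \<inter> (+) w ` K"
      then obtain k where k: "k \<in> K" "x = w + k"
        by blast
      then obtain c where "c \<in> C" "k \<in> ball c (e / 2)"
        using C(2) closure_subset[of K] by blast
      then show "\<exists>c \<in> C. dist (w + c) x < e / 2"
        using k by (auto simp: dist_norm)
    qed
    then obtain g where g: "\<And>x. x \<in> \<Gamma> \<inter> (+) w ` K \<Longrightarrow> g x \<in> C \<and> dist (w + g x) x < e / 2"
      by metis
    have "inj_on g (\<Gamma> \<inter> (+) w ` K)"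
    proof (rule inj_onI)
      fix x y assume xy: "x \<in> \<Gamma> \<inter> (+) w ` K" "y \<in> \<Gamma> \<inter> (+) w ` K" "g x = g y"
      have "dist x y < e"
        using g[OF xy(1)] g[OF xy(2)] xy(3) dist_triangle_half_r[of "w + g x" x e y] by simp
      then show "x = y"
        using e(2) xy by blast
    qed
    moreover have "g ` (\<Gamma> \<inter> (+) w ` K) \<subseteq> C"
      using g by blast
    ultimately show ?thesis
      using C(1) card_inj_on_le inj_on_finite by metis
  qed
  then show ?thesis
    by blast
qed

lemma max_count_well_defined:
  fixes \<Gamma> I :: "complex set"
  assumes "uniform_discrete \<Gamma>" "bounded I"
  shows "finite (\<Gamma> \<inter> (+) w ` (*\<^sub>R) r ` I)"
    and "finite (range (\<lambda>w. card (\<Gamma> \<inter> (+) w ` (*\<^sub>R) r ` I)))"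
proof -
  obtain N where N: "\<And>w. finite (\<Gamma> \<inter> (+) w ` (*\<^sub>R) r ` I) \<and> card (\<Gamma> \<inter> (+) w ` (*\<^sub>R) r ` I) \<le> N"
    using card_translates_bounded[OF assms(1) bounded_scaling[OF assms(2), of r]] by blast
  show "finite (\<Gamma> \<inter> (+) w ` (*\<^sub>R) r ` I)"
    using N by blast
  have "range (\<lambda>w. card (\<Gamma> \<inter> (+) w ` (*\<^sub>R) r ` I)) \<subseteq> {..N}"
    using N by blast
  then show "finite (range (\<lambda>w. card (\<Gamma> \<inter> (+) w ` (*\<^sub>R) r ` I)))"
    using finite_subset by blast
qed

end

theory Submission
  imports Defs "HOL-Complex_Analysis.Complex_Analysis"
begin

text \<open>The translation operators of the space (\<open>fock_shift\<close>) preserve \<open>e\<^bsup>-a|z|\<^sup>2/2\<^esup> |f(z)|\<close> up to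
  moving the argument, so every local statement may be made at the origin.

  \<^bold>\<open>Necessity.\<close> A Baire category argument gives one constant \<open>M\<close> for all data bounded by \<open>1\<close>
  (\<open>interpolates_of_interpolation_set\<close>). If \<open>f\<close> has norm at most \<open>M\<close>, vanishes on \<open>\<Gamma>\<close> except near
  \<open>w\<close> and is not small at \<open>w\<close>, then dividing by Blaschke factors on the disc of radius \<open>R\<close> about \<open>w\<close>
  (Jensen's inequality) gives
  \<open>\<Sum> ln (R / |x - w|) \<le> a R\<^sup>2 / 2 + O(ln R)\<close>, the sum being over the points \<open>x\<close> of \<open>\<Gamma>\<close> in the
  disc; averaged over \<open>w\<close>, this is density at most \<open>a / \<pi>\<close>. The strict inequality
  comes from a perturbation: moving every point of \<open>\<Gamma>\<close> by at most a fixed small \<open>\<delta>\<close>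
  only doubles \<open>M\<close>, so the part of \<open>\<Gamma>\<close> in the disc may be contracted into the disc of radius
  \<open>R - \<delta>\<close>. This replaces \<open>a R\<^sup>2 / 2\<close> by \<open>a (R - \<delta>)\<^sup>2 / 2\<close>, a gain linear in \<open>R\<close>, while all the errors
  are either logarithmic in \<open>R\<close> or a smaller multiple of \<open>R\<close> (\<open>logarithmic_count_at_scale\<close>).
  The function \<open>f\<close> is a peak function of a point of \<open>\<Gamma>\<close> near \<open>w\<close>, or, if there is none, the
  reproducing kernel at \<open>w\<close> corrected on \<open>\<Gamma>\<close>; the maximum principle on an annulus moves the
  lower bound to the immediate neighbourhood of \<open>w\<close>.

  \<^bold>\<open>Sufficiency.\<close> If the density is less than \<open>a / \<pi>\<close>, then all squares of some side \<open>s\<close> contain at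
  most \<open>N\<close> points of \<open>\<Gamma>\<close>, where \<open>a' = \<pi> N / s\<^sup>2 < a\<close>. The theta function provides \<open>E\<close>
  of growth \<open>e\<^bsup>\<pi>|z|\<^sup>2/(2s\<^sup>2)\<^esup>\<close> that vanishes at the centres of all the cells of a square grid
  of side \<open>s\<close>. Splitting \<open>\<Gamma>\<close> into \<open>N\<close> layers with at most one point per cell and moving, in \<open>N\<close> copies of
  \<open>E\<close>, zeros from the centres of cells to the points of \<open>\<Gamma>\<close> within distance \<open>\<rho>\<close> from \<open>x\<close>
  produces for each \<open>x\<close> in \<open>\<Gamma>\<close> a function that is \<open>1\<close> at \<open>x\<close>, vanishes at the other points within
  distance \<open>\<rho>\<close>, and grows like \<open>e\<^bsup>a'|z-x|\<^sup>2/2\<^esup>\<close> with a constant \<open>e\<^bsup>\<epsilon>\<rho>\<^sup>2\<^esup>\<close>, where \<open>\<epsilon>\<close> is as small as desired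
  (\<open>local_interpolant\<close>). The weight of the larger exponent \<open>a\<close> makes these functions decay like a
  Gaussian, so their superpositions solve the interpolation problem up to an error of order
  \<open>e\<^bsup>\<epsilon>\<rho>\<^sup>2 - (a-a')\<rho>\<^sup>2/4\<^esup>\<close>, and iteration removes the error
  (\<open>approximate_interpolation_suffices\<close>).

  The passage between the density, defined through translates of \<open>r I\<close>, and counts in discs or squares
  is a single averaging argument (\<open>counting_by_averaging\<close>).\<close>

section \<open>Counting by averaging over translates\<close>

lemma measure_reflection:
  fixes J :: "complex set"
  assumes "J \<in> lmeasurable"
  shows "(\<lambda>y. x - y) ` J \<in> lmeasurable" "measure lebesgue ((\<lambda>y. x - y) ` J) = measure lebesgue J"
proof -
  have eq: "(\<lambda>y. x - y) ` J = (\<lambda>y. (-1) *\<^sub>R y + x) ` J" by (intro image_cong) auto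
  show "measure lebesgue ((\<lambda>y. x - y) ` J) = measure lebesgue J"
    unfolding eq using measure_lebesgue_affine[of "-1" x J] by simp
  have "(\<lambda>y. x - y) ` J = (\<lambda>z. x + z) ` ((*\<^sub>R) (-1) -` J \<inter> space lebesgue)"
    by (force simp: image_iff intro: rev_image_eqI[of "x - y" for y])
  moreover have "(*\<^sub>R) (-1) -` J \<inter> space lebesgue \<in> sets lebesgue"
    using assms by (intro measurable_sets[OF lebesgue_measurable_scaling]) auto
  ultimately have "(\<lambda>y. x - y) ` J \<in> sets lebesgue"
    by (metis lebesgue_sets_translation)
  moreover have "emeasure lebesgue ((\<lambda>y. x - y) ` J) = emeasure lebesgue J"
    unfolding eq using emeasure_lebesgue_affine[of "-1" x J] by simp
  ultimately show "(\<lambda>y. x - y) ` J \<in> lmeasurable"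
    using assms by (metis fmeasurableI fmeasurableD2 less_top infinity_ennreal_def)
qed

text \<open>Integrate the hypothesis \<open>count\<close> over \<open>w \<in> Y\<close>: a point \<open>x\<close> is counted by \<open>w + J\<close> exactly
  for \<open>w\<close> in the reflected set \<open>x - J\<close>, which lies in \<open>Y\<close> and has the measure of \<open>J\<close>. Several sets with
  weights are admitted because the logarithmic sum in Jensen's inequality becomes a step function.\<close>

lemma counting_by_averaging:
  fixes X Y :: "complex set" and J :: "'i \<Rightarrow> complex set" and c :: "'i \<Rightarrow> real"
  assumes T: "finite T" and X: "finite X" and c: "\<And>j. j \<in> T \<Longrightarrow> c j \<ge> 0"
    and J: "\<And>j. j \<in> T \<Longrightarrow> J j \<in> lmeasurable" and Y: "Y \<in> lmeasurable"
    and diff: "\<And>j x y. j \<in> T \<Longrightarrow> x \<in> X \<Longrightarrow> y \<in> J j \<Longrightarrow> x - y \<in> Y"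
    and count: "\<And>w. (\<Sum>j\<in>T. c j * real (card (X \<inter> (+) w ` J j))) \<le> A"
  shows "real (card X) * (\<Sum>j\<in>T. c j * measure lebesgue (J j)) \<le> A * measure lebesgue Y"
proof -
  define R where "R x j = (\<lambda>y. x - y) ` J j" for x j
  have R: "R x j \<in> lmeasurable" "measure lebesgue (R x j) = measure lebesgue (J j)" if "j \<in> T" for x j
    using measure_reflection[OF J[OF that]] by (auto simp: R_def)
  have mem: "w \<in> R x j \<longleftrightarrow> x \<in> (+) w ` J j" for w x j
    unfolding R_def by (force simp: image_iff algebra_simps)
  have ind: "(\<Sum>x\<in>X. indicator (R x j) w) = real (card (X \<inter> (+) w ` J j))" for j w
    using X by (auto simp: indicator_def mem sum.If_cases Int_def)
  have "(\<Sum>j\<in>T. \<Sum>x\<in>X. c j * measure lebesgue (J j))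
      = (\<Sum>j\<in>T. \<Sum>x\<in>X. c j * (LINT w|lebesgue. indicator (R x j) w))"
    using R by (intro sum.cong refl) (simp add: R)
  also have "\<dots> = (LINT w|lebesgue. (\<Sum>j\<in>T. \<Sum>x\<in>X. c j * indicator (R x j) w))"
  proof -
    have "integrable lebesgue (\<lambda>w. c j * indicator (R x j) w :: real)" if "j \<in> T" for x j
      using R(1)[OF that, of x] unfolding lmeasurable_iff_integrable by simp
    then show ?thesis
      by (subst Bochner_Integration.integral_sum, auto intro!: sum.cong Bochner_Integration.integrable_sum)
  qed
  also have "\<dots> \<le> (LINT w|lebesgue. A * indicator Y w)"
  proof (rule integral_mono)
    show "integrable lebesgue (\<lambda>w. \<Sum>j\<in>T. \<Sum>x\<in>X. c j * indicator (R x j) w :: real)"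
    proof -
      have "integrable lebesgue (\<lambda>w. c j * indicator (R x j) w :: real)" if "j \<in> T" for x j
        using R(1)[OF that, of x] unfolding lmeasurable_iff_integrable by simp
      then show ?thesis
        by (rule Bochner_Integration.integrable_sum[OF Bochner_Integration.integrable_sum])
    qed
    show "integrable lebesgue (\<lambda>w. A * indicator Y w :: real)"
      using Y by (auto simp: fmeasurable_def)
    fix w
    have "(\<Sum>j\<in>T. \<Sum>x\<in>X. c j * indicator (R x j) w) = (\<Sum>j\<in>T. c j * real (card (X \<inter> (+) w ` J j)))"
      by (simp only: sum_distrib_left[symmetric] ind)
    also have "\<dots> \<le> A * indicator Y w"
    proof (cases "w \<in> Y")
      case True
      then show ?thesis using count[of w] by simp
    next
      case False
      have "(\<Sum>j\<in>T. c j * real (card (X \<inter> (+) w ` J j))) = 0"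
      proof (intro sum.neutral ballI)
        fix j assume j: "j \<in> T"
        have "X \<inter> (+) w ` J j = {}"
          using diff[OF j] False by force
        then show "c j * real (card (X \<inter> (+) w ` J j)) = 0" by simp
      qed
      with False show ?thesis by simp
    qed
    finally show "(\<Sum>j\<in>T. \<Sum>x\<in>X. c j * indicator (R x j) w) \<le> A * indicator Y w" .
  qed
  also have "\<dots> = A * measure lebesgue Y"
    using Y by simp
  finally show ?thesis by (simp add: sum_distrib_left mult.assoc mult.commute mult.left_commute)
qed

corollary card_le_by_averaging:
  fixes X Y J :: "complex set"
  assumes "finite X" "J \<in> lmeasurable" "Y \<in> lmeasurable"
    and "\<And>x y. x \<in> X \<Longrightarrow> y \<in> J \<Longrightarrow> x - y \<in> Y"
    and "\<And>w. real (card (X \<inter> (+) w ` J)) \<le> A"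
  shows "real (card X) * measure lebesgue J \<le> A * measure lebesgue Y"
  using counting_by_averaging[of "{()}" X "\<lambda>_. 1" "\<lambda>_. J" Y A] assms by simp

text \<open>The discs of radius \<open>q / 2\<close> about the points are disjoint; in averaged form: a translate of such a disc
  contains at most one point.\<close>

lemma card_disc_le:
  fixes X :: "complex set"
  assumes X: "finite X" "X \<subseteq> cball w \<rho>" and q: "q > 0" "\<rho> \<ge> 0"
    and sep: "\<And>x y. x \<in> X \<Longrightarrow> y \<in> X \<Longrightarrow> dist x y < q \<Longrightarrow> x = y"
  shows "real (card X) \<le> (1 + 2 * \<rho> / q)\<^sup>2"
proof -
  have "real (card X) * measure lebesgue (ball 0 (q/2) :: complex set) \<le> 1 * measure lebesgue (cball w (\<rho> + q/2))"
  proof (rule card_le_by_averaging[OF X(1)])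
    show "x - y \<in> cball w (\<rho> + q/2)" if "x \<in> X" "y \<in> ball 0 (q/2)" for x y
    proof -
      have "dist w (x - y) \<le> dist w x + norm y"
        using norm_triangle_ineq[of "w - x" y] by (simp add: dist_norm algebra_simps)
      then show ?thesis using that X(2) by (auto simp: subset_iff)
    qed
    show "real (card (X \<inter> (+) v ` ball 0 (q/2))) \<le> 1" for v
    proof -
      have "x = y" if "x \<in> X \<inter> (+) v ` ball 0 (q/2)" "y \<in> X \<inter> (+) v ` ball 0 (q/2)" for x y
      proof -
        have "dist v x < q/2" "dist v y < q/2" using that by (auto simp: dist_norm)
        then have "dist x y < q" by (metis dist_commute dist_triangle_half_l)
        then show ?thesis using sep that by auto
      qed
      then have "card (X \<inter> (+) v ` ball 0 (q/2)) \<le> Suc 0"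
        using X(1) by (subst card_le_Suc0_iff_eq) auto
      then show ?thesis by simp
    qed
  qed auto
  then have "real (card X) * (q/2)\<^sup>2 \<le> (\<rho> + q/2)\<^sup>2"
    using q by (simp add: content_ball content_cball unit_ball_vol_2 mult.left_commute)
  then have "real (card X) \<le> (\<rho> + q/2)\<^sup>2 / (q/2)\<^sup>2"
    using q by (simp add: pos_le_divide_eq)
  also have "\<dots> = (1 + 2 * \<rho> / q)\<^sup>2"
    using q by (simp add: field_simps power2_eq_square)
  finally show ?thesis .
qed

lemma finite_Int_bounded_of_sep:
  fixes X :: "complex set"
  assumes "uniform_discrete X" "bounded B"
  shows "finite (X \<inter> B)"
  using card_translates_bounded[OF assms] by (metis add_0 image_ident image_cong)

section \<open>Densities from counts\<close>

lemma image_plus_cball: "(+) w ` cball 0 r = cball (w::complex) r"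
  by simp

text \<open>Regularity of Lebesgue measure, together with compactness, shows that thickening \<open>I\<close> slightly
  increases its measure only slightly.\<close>

lemma outer_approx_compact:
  fixes I :: "complex set"
  assumes I: "compact I" "emeasure lebesgue I = 1" and \<tau>: "\<tau> > 0"
  obtains U \<epsilon> where "open U" "U \<in> lmeasurable" "measure lebesgue U \<le> 1 + \<tau>" "\<epsilon> > 0" "\<And>x y. x \<in> I \<Longrightarrow> cmod y < \<epsilon> \<Longrightarrow> x - y \<in> U"
proof -
  have Im: "I \<in> lmeasurable" using I(1) by (rule lmeasurable_compact)
  have mI: "measure lebesgue I = 1" using I(2) by (simp only: measure_def) simp
  have "I \<in> sets lebesgue" using Im by (rule fmeasurableD)
  then obtain U where U: "open U" "I \<subseteq> U" "U - I \<in> lmeasurable" "emeasure lebesgue (U - I) < ennreal \<tau>"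
    using sets_lebesgue_outer_open \<tau> by blast
  have "U = I \<union> (U - I)" using U(2) by auto
  then have Um: "U \<in> lmeasurable" using Im U(3) fmeasurable.Un by metis
  have "measure lebesgue (U - I) \<le> \<tau>"
    using U(3,4) \<tau> by (metis emeasure_eq_measure2 ennreal_less_iff less_imp_le measure_nonneg fmeasurableD2)
  moreover have "measure lebesgue U \<le> measure lebesgue I + measure lebesgue (U - I)"
    using \<open>U = I \<union> (U - I)\<close> measure_Un_le[of I lebesgue "U - I"] Im U(3) by (metis fmeasurableD)
  ultimately have "measure lebesgue U \<le> 1 + \<tau>" using mI by simp
  moreover obtain \<epsilon> where "\<epsilon> > 0" "(\<Union>x\<in>I. ball x \<epsilon>) \<subseteq> U"
    using compact_subset_open_imp_ball_epsilon_subset[OF I(1) U(1,2)] .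
  moreover have "x - y \<in> U" if "x \<in> I" "cmod y < \<epsilon>" for x y
  proof -
    have "x - y \<in> ball x \<epsilon>" using that by (simp add: dist_norm)
    then show ?thesis using that \<open>(\<Union>x\<in>I. ball x \<epsilon>) \<subseteq> U\<close> by blast
  qed
  ultimately show ?thesis using that U(1) Um by blast
qed

lemma max_count_le:
  assumes ud: "uniform_discrete X" and I: "bounded I"
    and le: "\<And>w. real (card (X \<inter> (+) w ` (*\<^sub>R) r ` I)) \<le> B"
  shows "real (max_count I X r) \<le> B"
proof -
  have "max_count I X r \<in> range (\<lambda>w. card (X \<inter> (+) w ` (*\<^sub>R) r ` I))"
    unfolding max_count_def using max_count_well_defined(2)[OF ud I] by (intro Max_in) auto
  then show ?thesis using le by auto
qed

lemma card_le_max_count: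
  assumes ud: "uniform_discrete X" and I: "bounded I"
  shows "card (X \<inter> (+) w ` (*\<^sub>R) r ` I) \<le> max_count I X r"
  unfolding max_count_def using max_count_well_defined(2)[OF ud I] by (intro Max_ge) auto

text \<open>Averaging over all discs that meet \<open>w + r I\<close>: their centres fill a region of area about \<open>r\<^sup>2\<close>, by
  \<open>outer_approx_compact\<close> after scaling by \<open>1 / r\<close>.\<close>

lemma upper_uniform_density_le_of_count:
  fixes c s :: "'i \<Rightarrow> real"
  assumes ud: "uniform_discrete X" and I: "compact I" "emeasure lebesgue I = 1"
    and T: "finite T" and c: "\<And>j. j \<in> T \<Longrightarrow> c j \<ge> 0" and s: "\<And>j. j \<in> T \<Longrightarrow> s j \<ge> 0"
    and count: "\<And>w. (\<Sum>j\<in>T. c j * real (card (X \<inter> cball w (s j)))) \<le> A"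
    and S: "(\<Sum>j\<in>T. c j * (pi * (s j)\<^sup>2)) > 0" and \<tau>: "\<tau> > 0"
  shows "upper_uniform_density I X \<le> ereal (A * (1 + \<tau>) / (\<Sum>j\<in>T. c j * (pi * (s j)\<^sup>2)))"
proof -
  let ?S = "\<Sum>j\<in>T. c j * (pi * (s j)\<^sup>2)"
  have "0 \<le> (\<Sum>j\<in>T. c j * real (card (X \<inter> cball 0 (s j))))" using c by (intro sum_nonneg) auto
  then have A: "A \<ge> 0" using count[of 0] by linarith
  obtain U \<epsilon> where U: "open U" "U \<in> lmeasurable" "measure lebesgue U \<le> 1 + \<tau>" "\<epsilon> > 0"
    and IU: "\<And>x y. x \<in> I \<Longrightarrow> cmod y < \<epsilon> \<Longrightarrow> x - y \<in> U"
    using outer_approx_compact[OF I \<tau>] by blast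
  \<comment> \<open>A common bound for the radii, so that for \<open>r > R / \<epsilon>\<close> all the discs scale into the \<open>\<epsilon>\<close>-disc.\<close>
  define R where "R = (\<Sum>j\<in>T. s j)"
  have sR: "s j \<le> R" if "j \<in> T" for j unfolding R_def using T s that by (intro member_le_sum) auto
  have R0: "R \<ge> 0" unfolding R_def using s by (intro sum_nonneg)
  have "real (max_count I X r) / r\<^sup>2 \<le> A * (1 + \<tau>) / ?S" if r: "r > R / \<epsilon>" for r
  proof -
    have r0: "r > 0" using r R0 U(4) by (metis divide_nonneg_pos le_less_trans)
    have "real (card (X \<inter> (+) w ` (*\<^sub>R) r ` I)) \<le> A * (1 + \<tau>) / ?S * r\<^sup>2" for w
    proof -
      define Y where "Y = (\<lambda>z. r *\<^sub>R z + w) ` U"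
      have mY: "measure lebesgue Y = r\<^sup>2 * measure lebesgue U"
        unfolding Y_def using measure_lebesgue_affine[of r w U] by simp
      have "Y = (\<lambda>z. w + z) ` ((*\<^sub>R) r ` U)" unfolding Y_def by (auto simp: image_image add.commute)
      moreover have "open ((\<lambda>z. w + z) ` ((*\<^sub>R) r ` U))"
        using U(1) r0 by (intro open_translation open_scaling) auto
      ultimately have "open Y" by simp
      then have "Y \<in> sets lebesgue" by (simp add: borel_open)
      moreover have "emeasure lebesgue Y < \<infinity>"
        unfolding Y_def emeasure_lebesgue_affine using U(2) 
        by (auto simp: ennreal_mult_less_top fmeasurable_def simp del: emeasure_completion)
      ultimately have Y: "Y \<in> lmeasurable" by (intro fmeasurableI)
      have fin: "finite (X \<inter> (+) w ` (*\<^sub>R) r ` I)"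
        using max_count_well_defined(1)[OF ud] I(1) compact_imp_bounded by blast
      have "real (card (X \<inter> (+) w ` (*\<^sub>R) r ` I)) * (\<Sum>j\<in>T. c j * measure lebesgue (cball 0 (s j) :: complex set)) \<le> A * measure lebesgue Y"
      proof (rule counting_by_averaging[OF T fin c lmeasurable_cball Y])
        fix j x y assume j: "j \<in> T" and x: "x \<in> X \<inter> (+) w ` (*\<^sub>R) r ` I" and y: "y \<in> cball (0::complex) (s j)"
        from x obtain i where i: "i \<in> I" "x = w + r *\<^sub>R i" by auto
        have "cmod y < r * \<epsilon>" using y sR[OF j] r U(4) by (simp add: field_simps)
        then have "cmod (y /\<^sub>R r) < \<epsilon>" using r0 by (simp add: field_simps)
        then have "i - y /\<^sub>R r \<in> U" using IU i by blast
        moreover have "x - y = r *\<^sub>R (i - y /\<^sub>R r) + w" using i r0 by (simp add: algebra_simps)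
        ultimately show "x - y \<in> Y" unfolding Y_def by blast
      next
        fix v
        have "(\<Sum>j\<in>T. c j * real (card (X \<inter> (+) w ` (*\<^sub>R) r ` I \<inter> (+) v ` cball 0 (s j)))) \<le> (\<Sum>j\<in>T. c j * real (card (X \<inter> cball v (s j))))"
        proof (intro sum_mono mult_left_mono)
          fix j
          have "finite (X \<inter> cball v (s j))" by (rule finite_Int_bounded_of_sep[OF ud]) simp
          then show "real (card (X \<inter> (+) w ` (*\<^sub>R) r ` I \<inter> (+) v ` cball 0 (s j))) \<le> real (card (X \<inter> cball v (s j)))"
            unfolding image_plus_cball by (intro of_nat_mono card_mono) auto
        qed (rule c)
        then show "(\<Sum>j\<in>T. c j * real (card (X \<inter> (+) w ` (*\<^sub>R) r ` I \<inter> (+) v ` cball 0 (s j)))) \<le> A"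
          using count[of v] by linarith
      qed
      moreover have "(\<Sum>j\<in>T. c j * measure lebesgue (cball 0 (s j) :: complex set)) = ?S"
        using s by (intro sum.cong refl) (simp add: content_cball unit_ball_vol_2)
      moreover have "A * measure lebesgue Y \<le> A * (r\<^sup>2 * (1 + \<tau>))"
        unfolding mY using A U(3) by (intro mult_left_mono) auto
      ultimately have "real (card (X \<inter> (+) w ` (*\<^sub>R) r ` I)) * ?S \<le> A * (1 + \<tau>) * r\<^sup>2"
        by (simp add: mult.assoc mult.commute[of "r\<^sup>2"])
      then show ?thesis using S by (simp add: field_simps)
    qed
    then have "real (max_count I X r) \<le> A * (1 + \<tau>) / ?S * r\<^sup>2"
      using ud I(1) compact_imp_bounded by (intro max_count_le)
    then show ?thesis using r0 by (simp add: field_simps)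
  qed
  then have "eventually (\<lambda>r. ereal (real (max_count I X r) / r\<^sup>2) \<le> ereal (A * (1 + \<tau>) / ?S)) at_top"
    by (intro eventually_mono[OF eventually_gt_at_top[of "R / \<epsilon>"]]) simp
  then show ?thesis unfolding upper_uniform_density_def by (rule Limsup_bounded)
qed

lemma measure_square:
  assumes "r \<ge> 0"
  shows "measure lebesgue (cbox (w :: complex) (w + Complex r r)) = r\<^sup>2"
proof -
  have "measure lborel (cbox w (w + Complex r r)) = (\<Prod>b\<in>Basis. (w + Complex r r) \<bullet> b - w \<bullet> b)"
    by (rule content_cbox') (use assms in \<open>auto simp: Basis_complex_def inner_complex_def box_ne_empty\<close>)
  also have "\<dots> = r\<^sup>2" by (simp add: Basis_complex_def inner_complex_def power2_eq_square)
  finally show ?thesis by simp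
qed

text \<open>Averaging in the other direction: a square of side \<open>s\<close> is tested with translates of \<open>r I\<close> for one fixed
  \<open>r\<close>; their positions lie in a square of side \<open>s + c\<close> with \<open>c\<close> fixed, and \<open>(s + c)\<^sup>2 / s\<^sup>2\<close> tends to \<open>1\<close>.\<close>

lemma subcritical_squares:
  fixes X I :: "complex set"
  assumes a: "a > 0" and I: "compact I" "emeasure lebesgue I = 1" and ud: "uniform_discrete X"
    and dens: "upper_uniform_density I X < ereal (a / pi)"
  obtains s N where "s \<ge> 4" "real N * (pi / s\<^sup>2) < a" "\<forall>w. card (X \<inter> cbox w (w + Complex s s)) \<le> N"
proof -
  obtain b' where b': "upper_uniform_density I X < ereal b'" "ereal b' < ereal (a / pi)"
    using ereal_dense2[OF dens] by auto
  define b where "b = max b' (a / pi / 2)"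
  have half: "x / 2 < x \<and> 0 < x / 2" if "x > 0" for x :: real using that by simp
  have "a / pi / 2 < a / pi" "0 < a / pi / 2" using half[of "a / pi"] a by simp_all
  then have b: "b > 0" "b < a / pi" "upper_uniform_density I X < ereal b"
    using b' by (auto simp only: b_def less_max_iff_disj max_less_iff_conj less_ereal.simps)
      (auto simp: b_def intro: less_le_trans)
  have "eventually (\<lambda>r. ereal (real (max_count I X r) / r\<^sup>2) < ereal b) at_top"
    using b(3) unfolding upper_uniform_density_def by (rule Limsup_lessD)
  then have "eventually (\<lambda>r. ereal (real (max_count I X r) / r\<^sup>2) < ereal b \<and> r > 0) at_top"
    using eventually_gt_at_top[of 0] by (rule eventually_conj)
  then obtain r where r: "real (max_count I X r) / r\<^sup>2 < b" "r > 0"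
    by (auto simp: eventually_at_top_linorder)
  have bI: "bounded I" using I(1) by (rule compact_imp_bounded)
  then obtain d where d: "d > 0" "\<And>x. x \<in> I \<Longrightarrow> cmod x \<le> d" unfolding bounded_pos by auto
  define c where "c = 2 * r * d"
  have c: "c > 0" using r d by (simp add: c_def)
  have count: "real (card (X \<inter> cbox w (w + Complex s s))) \<le> b * (s + c)\<^sup>2" if s: "s > 0" for w s
  proof -
    define J where "J = (*\<^sub>R) r ` I"
    define w0 where "w0 = w - Complex (r * d) (r * d)"
    define Y where "Y = cbox w0 (w0 + Complex (s + c) (s + c))"
    have J: "J \<in> lmeasurable" unfolding J_def using I(1) by (intro lmeasurable_compact compact_scaling)
    have "measure lebesgue I = 1" using I(2) by (simp only: measure_def) simp
    then have mJ: "measure lebesgue J = r\<^sup>2"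
      using measure_lebesgue_affine[of r 0 I] by (simp add: J_def)
    have fin: "finite (X \<inter> cbox w (w + Complex s s))" by (rule finite_Int_bounded_of_sep[OF ud]) simp
    have "real (card (X \<inter> cbox w (w + Complex s s))) * measure lebesgue J \<le> real (max_count I X r) * measure lebesgue Y"
    proof (rule card_le_by_averaging[OF fin J])
      show "Y \<in> lmeasurable" unfolding Y_def by simp
      fix x y assume x: "x \<in> X \<inter> cbox w (w + Complex s s)" and y: "y \<in> J"
      from y obtain i where i: "i \<in> I" "y = r *\<^sub>R i" by (auto simp: J_def)
      have "\<bar>Re y\<bar> \<le> r * d" "\<bar>Im y\<bar> \<le> r * d"
        using i d(2)[OF i(1)] r abs_Re_le_cmod[of i] abs_Im_le_cmod[of i] by (auto simp: abs_mult)
      then show "x - y \<in> Y" using x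
        unfolding Y_def w0_def c_def by (auto simp: in_cbox_complex_iff abs_le_iff algebra_simps)
    next
      fix v
      have "card (X \<inter> cbox w (w + Complex s s) \<inter> (+) v ` J) \<le> card (X \<inter> (+) v ` J)"
        using max_count_well_defined(1)[OF ud bI] by (intro card_mono) (auto simp: J_def)
      also have "\<dots> \<le> max_count I X r" unfolding J_def by (rule card_le_max_count[OF ud bI])
      finally show "real (card (X \<inter> cbox w (w + Complex s s) \<inter> (+) v ` J)) \<le> real (max_count I X r)" by simp
    qed
    also have "measure lebesgue Y = (s + c)\<^sup>2" unfolding Y_def using s c by (intro measure_square) simp
    finally have "real (card (X \<inter> cbox w (w + Complex s s))) * r\<^sup>2 \<le> real (max_count I X r) * (s + c)\<^sup>2" by (simp only: mJ)
    also have "\<dots> \<le> (b * r\<^sup>2) * (s + c)\<^sup>2"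
    proof (rule mult_right_mono)
      show "real (max_count I X r) \<le> b * r\<^sup>2" using r by (simp add: pos_divide_less_eq)
    qed simp
    finally have "real (card (X \<inter> cbox w (w + Complex s s))) * r\<^sup>2 \<le> (b * (s + c)\<^sup>2) * r\<^sup>2" by (simp add: mult_ac)
    then show ?thesis using r by simp
  qed
  define u where "u = sqrt (a / pi)"
  have u: "sqrt b < u" "u > 0" "u\<^sup>2 = a / pi" using b a by (auto simp: u_def)
  \<comment> \<open>Chosen so that \<open>sqrt b * (s + c) < sqrt (a / pi) * s\<close>; the lower bound \<open>4\<close> keeps unit discs about
    lattice points of mesh \<open>s\<close> well apart.\<close>
  define s where "s = max 4 (sqrt b * c / (u - sqrt b) + 1)"
  have s: "s \<ge> 4" "s > sqrt b * c / (u - sqrt b)" by (auto simp: s_def)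
  have "sqrt b * c < s * (u - sqrt b)" using s(2) u(1) by (simp add: pos_divide_less_eq)
  then have "sqrt b * (s + c) < u * s" by (simp add: algebra_simps)
  then have "(sqrt b * (s + c))\<^sup>2 < (u * s)\<^sup>2" using b c s by (intro power_strict_mono) auto
  then have bs: "b * (s + c)\<^sup>2 < a / pi * s\<^sup>2" using b u(3) by (simp add: power_mult_distrib)
  define N where "N = nat \<lfloor>b * (s + c)\<^sup>2\<rfloor>"
  have "real N \<le> b * (s + c)\<^sup>2" using b by (simp add: N_def)
  then have "real N < a / pi * s\<^sup>2" using bs by linarith
  then have "real N * (pi / s\<^sup>2) < a / pi * s\<^sup>2 * (pi / s\<^sup>2)" using s by (intro mult_strict_right_mono) auto
  also have "\<dots> = a" using s by simp
  finally have "real N * (pi / s\<^sup>2) < a" .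
  moreover have "\<forall>w. card (X \<inter> cbox w (w + Complex s s)) \<le> N"
  proof
    fix w
    have "real (card (X \<inter> cbox w (w + Complex s s))) \<le> b * (s + c)\<^sup>2" using s by (intro count) simp
    then show "card (X \<inter> cbox w (w + Complex s s)) \<le> N" unfolding N_def by (simp add: le_nat_floor)
  qed
  ultimately show ?thesis using that s(1) by blast
qed

section \<open>Entire functions with a Gaussian weight\<close>

definition weighted :: "real \<Rightarrow> (complex \<Rightarrow> complex) \<Rightarrow> complex \<Rightarrow> complex" where
  "weighted a f z = complex_of_real (exp (- a * (cmod z)\<^sup>2 / 2)) * f z"

definition fock_ball :: "real \<Rightarrow> real \<Rightarrow> (complex \<Rightarrow> complex) set" where
  "fock_ball a M = {f. f holomorphic_on UNIV \<and> (\<forall>z. cmod (weighted a f z) \<le> M)}"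

text \<open>The Weyl translation by \<open>c\<close>. Its weighted value at \<open>z\<close> is the weighted value of \<open>f\<close> at \<open>z + c\<close> times
  the unimodular \<open>phase\<close>.\<close>

definition fock_shift :: "real \<Rightarrow> complex \<Rightarrow> (complex \<Rightarrow> complex) \<Rightarrow> complex \<Rightarrow> complex" where
  "fock_shift a c f z = f (z + c) * exp (- of_real a * cnj c * z - of_real (a * (cmod c)\<^sup>2 / 2))"

definition phase :: "real \<Rightarrow> complex \<Rightarrow> complex \<Rightarrow> complex" where
  "phase a c z = cis (- a * Im (cnj c * z))"

lemma cmod_weighted: "cmod (weighted a f z) = exp (- a * (cmod z)\<^sup>2 / 2) * cmod (f z)"
  by (simp add: weighted_def norm_mult)

lemma cmod_eq_weighted: "cmod (f z) = cmod (weighted a f z) * exp (a * (cmod z)\<^sup>2 / 2)"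
proof -
  have "exp (- a * (cmod z)\<^sup>2 / 2) * exp (a * (cmod z)\<^sup>2 / 2) = 1"
    unfolding exp_add[symmetric] by simp
  then show ?thesis unfolding cmod_weighted by (metis mult.commute mult.left_commute mult_1)
qed

lemma cmod_le_of_weighted_le:
  assumes "cmod (weighted a f z) \<le> M"
  shows "cmod (f z) \<le> M * exp (a * (cmod z)\<^sup>2 / 2)"
  unfolding cmod_eq_weighted[of f z a] by (intro mult_right_mono assms) auto

lemma fock_ballD:
  assumes "f \<in> fock_ball a M"
  shows "f holomorphic_on UNIV" "cmod (weighted a f z) \<le> M" "M \<ge> 0"
proof -
  show *: "f holomorphic_on UNIV" "cmod (weighted a f z) \<le> M" using assms by (auto simp: fock_ball_def)
  then show "M \<ge> 0" using norm_ge_zero[of "weighted a f z"] by linarith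
qed

lemma fock_ballI:
  assumes "f holomorphic_on UNIV" "\<And>z. cmod (weighted a f z) \<le> M"
  shows "f \<in> fock_ball a M"
  using assms by (auto simp: fock_ball_def)

lemma fock_ball_mono: "f \<in> fock_ball a M \<Longrightarrow> M \<le> M' \<Longrightarrow> f \<in> fock_ball a M'"
  by (simp add: fock_ball_def) (meson order_trans)

lemma fock_space_eq: "fock_space a = (\<Union>M. fock_ball a M)"
proof safe
  fix f assume f: "f \<in> fock_space a"
  then have fin: "fock_norm a f < \<infinity>" by (simp add: fock_space_def)
  have le: "ereal (cmod (weighted a f z)) \<le> fock_norm a f" for z
    unfolding fock_norm_def cmod_weighted by (rule SUP_upper) simp
  have "\<bar>fock_norm a f\<bar> \<noteq> \<infinity>" using fin le[of 0] by (cases "fock_norm a f") auto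
  then obtain M where "fock_norm a f = ereal M" by (metis ereal_real')
  then have "f \<in> fock_ball a M" using f le by (auto simp: fock_ball_def fock_space_def)
  then show "f \<in> (\<Union>M. fock_ball a M)" by auto
next
  fix f M assume f: "f \<in> fock_ball a M"
  have "fock_norm a f \<le> ereal M"
    unfolding fock_norm_def by (rule SUP_least) (use f in \<open>auto simp: fock_ball_def cmod_weighted\<close>)
  then show "f \<in> fock_space a" using f by (auto simp: fock_space_def fock_ball_def)
qed

lemma weighted_scale: "weighted a (\<lambda>z. c * f z) w = c * weighted a f w"
  and weighted_diff: "weighted a (\<lambda>z. f z - g z) w = weighted a f w - weighted a g w"
  and weighted_eq_0_iff: "weighted a f w = 0 \<longleftrightarrow> f w = 0"
  by (auto simp: weighted_def algebra_simps)

lemma fock_ball_scale: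
  assumes "f \<in> fock_ball a M" shows "(\<lambda>z. c * f z) \<in> fock_ball a (cmod c * M)"
  using assms by (auto simp: fock_ball_def weighted_scale norm_mult mult_left_mono intro!: holomorphic_intros)

lemma fock_ball_diff:
  assumes "f \<in> fock_ball a M" "g \<in> fock_ball a M'"
  shows "(\<lambda>z. f z - g z) \<in> fock_ball a (M + M')"
proof (rule fock_ballI)
  show "(\<lambda>z. f z - g z) holomorphic_on UNIV" using assms by (intro holomorphic_intros) (auto dest: fock_ballD)
  show "cmod (weighted a (\<lambda>z. f z - g z) z) \<le> M + M'" for z
    unfolding weighted_diff using norm_triangle_ineq4[of "weighted a f z" "weighted a g z"]
      fock_ballD(2)[OF assms(1), of z] fock_ballD(2)[OF assms(2), of z] by linarith
qed

lemma holomorphic_fock_shift [holomorphic_intros]: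
  assumes "f holomorphic_on UNIV" shows "fock_shift a c f holomorphic_on S"
proof -
  have "(f \<circ> (\<lambda>z. z + c)) holomorphic_on UNIV"
    by (intro holomorphic_on_compose holomorphic_intros holomorphic_on_subset[OF assms]) auto
  then have "(\<lambda>z. f (z + c)) holomorphic_on UNIV" by (simp add: o_def)
  then show ?thesis unfolding fock_shift_def
    by (intro holomorphic_intros holomorphic_on_subset[of _ UNIV S]) auto
qed

lemma weighted_fock_shift: "weighted a (fock_shift a c f) z = phase a c z * weighted a f (z + c)"
proof -
  have *: "(cmod (z + c))\<^sup>2 = (cmod z)\<^sup>2 + (cmod c)\<^sup>2 + 2 * Re (cnj c * z)"
    unfolding cmod_power2 by (simp add: power2_eq_square algebra_simps)
  have "exp (complex_of_real (- a * (cmod z)\<^sup>2 / 2)) * exp (- of_real a * cnj c * z - of_real (a * (cmod c)\<^sup>2 / 2))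
      = exp (\<i> * of_real (- a * Im (cnj c * z))) * exp (complex_of_real (- a * (cmod (z + c))\<^sup>2 / 2))"
    unfolding exp_add[symmetric]
  proof (rule arg_cong[where f = exp])
    define w where "w = cnj c * z"
    show "complex_of_real (- a * (cmod z)\<^sup>2 / 2) + (- of_real a * cnj c * z - of_real (a * (cmod c)\<^sup>2 / 2))
      = \<i> * of_real (- a * Im (cnj c * z)) + complex_of_real (- a * (cmod (z + c))\<^sup>2 / 2)"
      unfolding * mult.assoc w_def[symmetric] by (simp add: complex_eq_iff field_simps)
  qed
  from arg_cong[OF this, of "\<lambda>u. u * f (z + c)"] show ?thesis
    unfolding weighted_def fock_shift_def phase_def cis_conv_exp exp_of_real[symmetric]
    by (simp only: mult.assoc mult.commute[of "f (z + c)"])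
qed

lemma norm_phase [simp]: "cmod (phase a c z) = 1"
  by (simp add: phase_def)

lemma phase_0 [simp]: "phase a c 0 = 1" by (simp add: phase_def)

lemma fock_shift_in_fock_ball:
  assumes "f \<in> fock_ball a M" shows "fock_shift a c f \<in> fock_ball a M"
  using assms by (intro fock_ballI) (auto simp: weighted_fock_shift norm_mult dest: fock_ballD intro!: holomorphic_intros)

lemma entire_factor_zero:
  assumes f: "f holomorphic_on UNIV" and "f a = 0"
  obtains g where "g holomorphic_on UNIV" "\<And>z. f z = (z - a) * g z"
proof
  show "(\<lambda>z. if z = a then deriv f a else (f z - f a)/(z-a)) holomorphic_on UNIV"
    by (rule pole_lemma_open[OF f open_UNIV])
  show "f z = (z - a) * (if z = a then deriv f a else (f z - f a)/(z-a))" for z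
    using assms(2) by auto
qed

lemma entire_factor_zeros:
  assumes "finite Z" "f holomorphic_on UNIV" "\<And>\<zeta>. \<zeta> \<in> Z \<Longrightarrow> f \<zeta> = 0"
  shows "\<exists>g. g holomorphic_on UNIV \<and> (\<forall>z. f z = (\<Prod>\<zeta>\<in>Z. z - \<zeta>) * g z)"
  using assms
proof (induction Z arbitrary: f rule: finite_induct)
  case (insert a Z)
  obtain g where g: "g holomorphic_on UNIV" "\<And>z. f z = (z - a) * g z"
    using entire_factor_zero[of f a] insert.prems by auto
  have "g \<zeta> = 0" if "\<zeta> \<in> Z" for \<zeta> using g(2)[of \<zeta>] insert that by auto
  then obtain h where h: "h holomorphic_on UNIV" "\<And>z. g z = (\<Prod>\<zeta>\<in>Z. z - \<zeta>) * h z"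
    using insert.IH[OF g(1)] by blast
  then show ?case using g insert.hyps by (intro exI[of _ h]) (simp add: mult.assoc)
qed auto

lemma max_modulus_disc:
  assumes f: "f holomorphic_on UNIV" and r: "r > 0" and B: "\<And>z. cmod z = r \<Longrightarrow> cmod (f z) \<le> B"
    and z: "cmod z \<le> r"
  shows "cmod (f z) \<le> B"
proof (rule maximum_modulus_frontier[of f "cball 0 r"])
  show "continuous_on (closure (cball 0 r)) f"
    by (rule continuous_on_subset[OF holomorphic_on_imp_continuous_on[OF f]]) simp
  show "f holomorphic_on interior (cball 0 r)" by (rule holomorphic_on_subset[OF f]) simp
qed (use B z r in \<open>auto simp: dist_norm\<close>)

text \<open>Jensen's inequality without integrals: each zero \<open>\<zeta>\<close> is replaced by its reflection in the circle, which
  preserves the modulus on the circle and multiplies the modulus at the centre by \<open>r / |\<zeta>|\<close>; then the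
  maximum principle applies.\<close>

lemma blaschke_bound:
  assumes "finite Z" "f holomorphic_on UNIV" "r > 0" "\<And>\<zeta>. \<zeta> \<in> Z \<Longrightarrow> f \<zeta> = 0 \<and> cmod \<zeta> < r"
    and "\<And>z. cmod z = r \<Longrightarrow> cmod (f z) \<le> B"
  shows "cmod (f 0) * (\<Prod>\<zeta>\<in>Z. r / cmod \<zeta>) \<le> B"
  using assms
proof (induction Z arbitrary: f rule: finite_induct)
  case empty
  then show ?case using max_modulus_disc[of f r B 0] by auto
next
  case (insert a Z)
  obtain g where g: "g holomorphic_on UNIV" "\<And>z. f z = (z - a) * g z"
    using entire_factor_zero[of f a] insert.prems by auto
  define h where "h z = g z * (of_real (r\<^sup>2) - cnj a * z) / of_real r" for z
  have bd: "cmod (h z) = cmod (f z)" if "cmod z = r" for z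
  proof -
    have "of_real (r\<^sup>2) = z * cnj z" using that complex_norm_square[of z] by simp
    then have "of_real (r\<^sup>2) - cnj a * z = z * cnj (z - a)" by (simp add: algebra_simps)
    then show ?thesis using that \<open>r > 0\<close>
      by (simp add: h_def g(2) norm_mult norm_divide del: complex_cnj_diff)
  qed
  have "cmod (h 0) * (\<Prod>\<zeta>\<in>Z. r / cmod \<zeta>) \<le> B"
  proof (rule insert.IH)
    show "h holomorphic_on UNIV" unfolding h_def using g(1) \<open>r > 0\<close> by (intro holomorphic_intros) auto
    show "h \<zeta> = 0 \<and> cmod \<zeta> < r" if "\<zeta> \<in> Z" for \<zeta>
      using g(2)[of \<zeta>] insert that by (auto simp: h_def)
  qed (use insert.prems bd in auto)
  moreover have "cmod (f 0) * (r / cmod a) \<le> cmod (h 0)"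
    using \<open>r > 0\<close> by (simp add: h_def g(2) norm_mult norm_divide power2_eq_square)
  then have "cmod (f 0) * (r / cmod a) * (\<Prod>\<zeta>\<in>Z. r / cmod \<zeta>) \<le> cmod (h 0) * (\<Prod>\<zeta>\<in>Z. r / cmod \<zeta>)"
    using \<open>r > 0\<close> by (intro mult_right_mono prod_nonneg) auto
  ultimately show ?case using insert.hyps by (simp add: mult.assoc)
qed

text \<open>The weight is constant on circles about the centre of translation, so a weighted bound on one circle
  suffices. For empty \<open>Z\<close> this is the maximum principle for weighted moduli.\<close>

lemma weighted_blaschke_bound:
  assumes Z: "finite Z" and f: "f holomorphic_on UNIV" and r: "r > 0"
    and zero: "\<And>\<zeta>. \<zeta> \<in> Z \<Longrightarrow> f \<zeta> = 0 \<and> cmod (\<zeta> - w) < r"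
    and B: "\<And>z. cmod (z - w) = r \<Longrightarrow> cmod (weighted a f z) \<le> B"
  shows "cmod (weighted a f w) * (\<Prod>\<zeta>\<in>Z. r / cmod (\<zeta> - w)) \<le> B * exp (a * r\<^sup>2 / 2)"
proof -
  define g where "g = fock_shift a w f"
  define Z' where "Z' = (\<lambda>\<zeta>. \<zeta> - w) ` Z"
  have "cmod (g 0) * (\<Prod>\<zeta>\<in>Z'. r / cmod \<zeta>) \<le> B * exp (a * r\<^sup>2 / 2)"
  proof (rule blaschke_bound)
    show "finite Z'" using Z by (simp add: Z'_def)
    show "g holomorphic_on UNIV" unfolding g_def using f by (intro holomorphic_intros)
    show "g \<zeta> = 0 \<and> cmod \<zeta> < r" if "\<zeta> \<in> Z'" for \<zeta>
      using zero that by (auto simp: Z'_def g_def fock_shift_def)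
    show "cmod (g z) \<le> B * exp (a * r\<^sup>2 / 2)" if "cmod z = r" for z
      using cmod_le_of_weighted_le[of a g z B] B[of "z + w"] that
      by (simp add: g_def weighted_fock_shift norm_mult)
  qed (use r in auto)
  moreover have "cmod (g 0) = cmod (weighted a f w)"
    using weighted_fock_shift[of a w f 0] by (simp add: g_def weighted_def)
  moreover have "(\<Prod>\<zeta>\<in>Z'. r / cmod \<zeta>) = (\<Prod>\<zeta>\<in>Z. r / cmod (\<zeta> - w))"
    unfolding Z'_def by (subst prod.reindex) (auto simp: inj_on_def)
  ultimately show ?thesis by simp
qed

lemma entire_infsum:
  fixes f :: "'i \<Rightarrow> complex \<Rightarrow> complex"
  assumes f: "\<And>i. i \<in> A \<Longrightarrow> f i holomorphic_on UNIV"
    and b: "\<And>R. \<exists>b. b summable_on A \<and> (\<forall>i\<in>A. \<forall>z. cmod z \<le> R \<longrightarrow> cmod (f i z) \<le> b i)"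
  shows "(\<lambda>z. \<Sum>\<^sub>\<infinity>i\<in>A. f i z) holomorphic_on UNIV"
proof -
  have "(\<lambda>z. \<Sum>\<^sub>\<infinity>i\<in>A. f i z) holomorphic_on ball 0 R" for R
  proof -
    obtain b where b': "b summable_on A" "\<And>i z. i \<in> A \<Longrightarrow> cmod z \<le> R \<Longrightarrow> cmod (f i z) \<le> b i"
      using b[of R] by blast
    have ul: "uniform_limit (cball 0 R) (\<lambda>X z. \<Sum>i\<in>X. f i z) (\<lambda>z. \<Sum>\<^sub>\<infinity>i\<in>A. f i z) (finite_subsets_at_top A)"
      by (rule Weierstrass_m_test_general[OF _ b'(1)]) (use b'(2) in auto)
    have ev: "eventually (\<lambda>X. continuous_on (cball 0 R) (\<lambda>z. \<Sum>i\<in>X. f i z) \<and> (\<lambda>z. \<Sum>i\<in>X. f i z) holomorphic_on ball 0 R) (finite_subsets_at_top A)"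
    proof (rule eventually_finite_subsets_at_top_weakI)
      fix X assume "finite X" "X \<subseteq> A"
      then have hol: "(\<lambda>z. \<Sum>i\<in>X. f i z) holomorphic_on UNIV" using f by (intro holomorphic_intros) auto
      show "continuous_on (cball 0 R) (\<lambda>z. \<Sum>i\<in>X. f i z) \<and> (\<lambda>z. \<Sum>i\<in>X. f i z) holomorphic_on ball 0 R"
        using holomorphic_on_subset[OF hol, of "ball 0 R"]
          continuous_on_subset[OF holomorphic_on_imp_continuous_on[OF hol], of "cball 0 R"] by simp
    qed
    show ?thesis by (rule holomorphic_uniform_limit[OF ev ul]) auto
  qed
  then have "(\<lambda>z. \<Sum>\<^sub>\<infinity>i\<in>A. f i z) holomorphic_on (\<Union>R. ball 0 R)"
    by (intro holomorphic_on_UN_open) auto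
  moreover have "(\<Union>R. ball (0::complex) R) = UNIV"
  proof (intro equalityI subsetI)
    show "z \<in> (\<Union>R. ball (0::complex) R)" for z by (rule UN_I[of "cmod z + 1"]) auto
  qed auto
  ultimately show ?thesis by simp
qed

section \<open>Uniform interpolation constants\<close>

definition interpolates :: "real \<Rightarrow> real \<Rightarrow> complex set \<Rightarrow> bool" where
  "interpolates a M X \<longleftrightarrow>
    (\<forall>v. (\<forall>x\<in>X. cmod (v x) \<le> 1) \<longrightarrow> (\<exists>f\<in>fock_ball a M. \<forall>x\<in>X. weighted a f x = v x))"

lemma interpolates_unitD:
  assumes "interpolates a M X" "\<forall>x\<in>X. cmod (v x) \<le> 1"
  shows "\<exists>f\<in>fock_ball a M. \<forall>x\<in>X. weighted a f x = v x"
  using assms by (simp add: interpolates_def)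

lemma interpolates_peak:
  assumes "interpolates a M X" "x \<in> X"
  obtains f where "f \<in> fock_ball a M" "weighted a f x = 1" "\<forall>y\<in>X - {x}. f y = 0"
proof -
  have "\<exists>f\<in>fock_ball a M. \<forall>y\<in>X. weighted a f y = (if y = x then 1 else 0)"
    by (rule interpolates_unitD[OF assms(1)]) simp
  then obtain f where f: "f \<in> fock_ball a M" "\<forall>y\<in>X. weighted a f y = (if y = x then 1 else 0)" ..
  have "f y = 0" if "y \<in> X - {x}" for y
    using f(2) that weighted_eq_0_iff[of a f y] by auto
  with f assms(2) show ?thesis by (intro that[of f]) auto
qed

text \<open>Interpolate the data up to an error at most \<open>1/2\<close>, then twice the error up to an error at most \<open>1/2\<close>, and
  so on; the sum of the resulting functions with weights \<open>2\<^bsup>-n\<^esup>\<close> interpolates exactly.\<close>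

lemma approximate_interpolation_suffices:
  assumes a: "a > 0" and M: "M \<ge> 0"
    and step: "\<And>v. (\<And>x. x \<in> X \<Longrightarrow> cmod (v x) \<le> 1) \<Longrightarrow>
        \<exists>f\<in>fock_ball a M. \<forall>x\<in>X. cmod (v x - weighted a f x) \<le> 1 / 2"
  shows "interpolates a (2 * M) X"
  unfolding interpolates_def
proof (intro allI impI)
  fix v :: "complex \<Rightarrow> complex" assume v: "\<forall>x\<in>X. cmod (v x) \<le> 1"
  obtain T where T: "T u \<in> fock_ball a M \<and> (\<forall>x\<in>X. cmod (u x - weighted a (T u) x) \<le> 1/2)"
    if "\<And>x. x \<in> X \<Longrightarrow> cmod (u x) \<le> 1" for u
    using step by metis
  define s where "s n = ((\<lambda>u x. 2 * (u x - weighted a (T u) x)) ^^ n) v" for n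
  have s_Suc: "s (Suc n) x = 2 * (s n x - weighted a (T (s n)) x)" for n x
    by (simp add: s_def)
  have s_le: "cmod (s n x) \<le> 1" if "x \<in> X" for n x
    using that
  proof (induction n arbitrary: x)
    case 0 then show ?case using v by (simp add: s_def)
  next
    case (Suc n)
    have "cmod (s n x - weighted a (T (s n)) x) \<le> 1/2" using T[of "s n"] Suc by blast
    then show ?case unfolding s_Suc norm_mult by simp
  qed
  have Ts: "T (s n) \<in> fock_ball a M" for n using T s_le by blast
  define g where "g n z = (1/2) ^ n * T (s n) z" for n z
  have g_le: "cmod (g n z) \<le> (1/2) ^ n * (M * exp (a * R\<^sup>2 / 2))" if "cmod z \<le> R" for n z R
  proof -
    have "cmod (T (s n) z) \<le> M * exp (a * (cmod z)\<^sup>2 / 2)"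
      using fock_ballD(2)[OF Ts] by (rule cmod_le_of_weighted_le)
    also have "\<dots> \<le> M * exp (a * R\<^sup>2 / 2)"
      using that a M by (intro mult_left_mono) (auto intro!: mult_left_mono power_mono)
    finally show ?thesis by (simp add: g_def norm_mult norm_power)
  qed
  have summ: "(\<lambda>n. (1/2) ^ n * C :: real) summable_on UNIV" for C
    by (intro summable_on_cmult_left norm_summable_imp_summable_on) (simp add: norm_power)
  define F where "F z = (\<Sum>\<^sub>\<infinity>n. g n z)" for z
  have F_hol: "F holomorphic_on UNIV"
    unfolding F_def
  proof (rule entire_infsum)
    show "g n holomorphic_on UNIV" for n
      unfolding g_def using fock_ballD(1)[OF Ts] by (intro holomorphic_intros)
    show "\<exists>b. b summable_on UNIV \<and> (\<forall>i\<in>UNIV. \<forall>z. cmod z \<le> R \<longrightarrow> cmod (g i z) \<le> b i)" for R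
      using g_le summ by blast
  qed
  have "(\<lambda>n. g n z) summable_on UNIV" for z
    by (rule abs_summable_summable, rule summable_on_comparison_test[OF summ])
       (use g_le in auto)
  then have sums: "(\<lambda>n. g n z) sums F z" for z
    unfolding F_def by (intro has_sum_imp_sums has_sum_infsum)
  have wsums: "(\<lambda>n. (1/2) ^ n * weighted a (T (s n)) z) sums weighted a F z" for z
    using sums_mult[OF sums[of z], of "complex_of_real (exp (- a * (cmod z)\<^sup>2 / 2))"]
    by (simp add: weighted_def g_def mult.left_commute)
  have "F \<in> fock_ball a (2 * M)"
  proof (rule fock_ballI[OF F_hol])
    fix z
    have "(\<lambda>n. (1/2) ^ n * M) sums (2 * M)"
      using sums_mult2[OF geometric_sums[of "1/2::real"], of M] by simp
    then show "cmod (weighted a F z) \<le> 2 * M"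
      using norm_suminf_le[of "\<lambda>n. (1/2) ^ n * weighted a (T (s n)) z" "\<lambda>n. (1/2) ^ n * M"]
        wsums[of z] fock_ballD(2)[OF Ts]
      by (auto simp: sums_iff norm_mult norm_power)
  qed
  moreover have "weighted a F x = v x" if "x \<in> X" for x
  proof -
    have "(\<lambda>n. (1/2) ^ n * s n x) \<longlonglongrightarrow> 0"
    proof (rule Lim_null_comparison)
      show "eventually (\<lambda>n. cmod ((1/2) ^ n * s n x) \<le> (1/2) ^ n) sequentially"
        using s_le[OF that] by (auto simp: norm_mult norm_power intro!: always_eventually mult_left_le)
      show "(\<lambda>n. (1/2::real) ^ n) \<longlonglongrightarrow> 0" by (rule LIMSEQ_realpow_zero) auto
    qed
    then have "(\<lambda>n. (1/2) ^ n * s n x - (1/2) ^ Suc n * s (Suc n) x) sums ((1/2) ^ 0 * s 0 x - 0)"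
      by (rule telescope_sums')
    moreover have "(1/2) ^ n * s n x - (1/2) ^ Suc n * s (Suc n) x = (1/2) ^ n * weighted a (T (s n)) x" for n
      by (simp add: s_Suc algebra_simps)
    ultimately show ?thesis
      using wsums[of x] sums_unique2 by (fastforce simp: s_def)
  qed
  ultimately show "\<exists>f\<in>fock_ball a (2 * M). \<forall>x\<in>X. weighted a f x = v x" by (intro bexI[of _ F] ballI)
qed

lemma interpolates_subset:
  assumes "interpolates a M X" "Y \<subseteq> X" shows "interpolates a M Y"
  unfolding interpolates_def
proof (intro allI impI)
  fix v :: "complex \<Rightarrow> complex" assume "\<forall>x\<in>Y. cmod (v x) \<le> 1"
  then have "\<forall>x\<in>X. cmod (if x \<in> Y then v x else 0) \<le> 1" by simp
  then obtain f where "f \<in> fock_ball a M" "\<forall>x\<in>X. weighted a f x = (if x \<in> Y then v x else 0)"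
    using interpolates_unitD[OF assms(1), of "\<lambda>x. if x \<in> Y then v x else 0"] by auto
  then show "\<exists>f\<in>fock_ball a M. \<forall>x\<in>Y. weighted a f x = v x"
    using assms(2) by (intro bexI[of _ f]) auto
qed

lemma interpolatesD:
  assumes "interpolates a M X" "B \<ge> 0" "\<And>x. x \<in> X \<Longrightarrow> cmod (v x) \<le> B"
  obtains f where "f \<in> fock_ball a (B * M)" "\<And>x. x \<in> X \<Longrightarrow> weighted a f x = v x"
proof (cases "B = 0")
  case True
  have "(\<lambda>_. 0) \<in> fock_ball a (B * M)" using True by (auto simp: fock_ball_def weighted_def)
  then show ?thesis using that[of "\<lambda>_. 0"] assms(3) True by (auto simp: weighted_def)
next
  case False
  with assms(2) have B: "B > 0" by simp
  have "\<forall>x\<in>X. cmod (v x / of_real B) \<le> 1" using assms(3) B by (auto simp: norm_divide)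
  then obtain f where f: "f \<in> fock_ball a M" "\<forall>x\<in>X. weighted a f x = v x / of_real B"
    using interpolates_unitD[OF assms(1), of "\<lambda>x. v x / of_real B"] by auto
  show ?thesis
  proof (rule that[of "\<lambda>z. of_real B * f z"])
    show "(\<lambda>z. of_real B * f z) \<in> fock_ball a (B * M)"
      using fock_ball_scale[OF f(1), of "of_real B"] B by simp
  qed (use f B in \<open>auto simp: weighted_scale\<close>)
qed

lemma interpolation_set_of_interpolates:
  assumes "interpolates a M X" shows "interpolation_set a X"
  unfolding interpolation_set_def
proof (intro allI impI)
  fix v :: "complex \<Rightarrow> complex" assume "bounded (v ` X)"
  then obtain B where "B > 0" "\<And>x. x \<in> X \<Longrightarrow> cmod (v x) \<le> B" unfolding bounded_pos by auto
  then obtain f where f: "f \<in> fock_ball a (B * M)" "\<And>x. x \<in> X \<Longrightarrow> weighted a f x = v x"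
    using interpolatesD[OF assms, of B v] by (metis less_imp_le)
  from f(1) have "f \<in> fock_space a" unfolding fock_space_eq by (rule UN_I[OF UNIV_I])
  with f(2) show "\<exists>f\<in>fock_space a. \<forall>z\<in>X. complex_of_real (exp (- a * (cmod z)\<^sup>2 / 2)) * f z = v z"
    by (intro bexI[of _ f]) (auto simp: weighted_def)
qed

text \<open>The surjectivity half of the open mapping theorem. The bounded data form a complete metric space, the
  union of the sets \<open>E n\<close> of data attained with norm at most \<open>n\<close>. By Baire's theorem the closure of some
  \<open>E n\<close> contains a ball, and differences of approximants of its elements interpolate data
  bounded by \<open>1\<close> up to an error \<open>1/2\<close>.\<close>

lemma interpolates_of_interpolation_set:
  assumes a: "a > 0" and X: "interpolation_set a X"
  shows "\<exists>M\<ge>1. interpolates a M X"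
proof (cases "X = {}")
  case True
  have "(\<lambda>_. 0) \<in> fock_ball a 1" by (auto simp: fock_ball_def weighted_def)
  then have "interpolates a 1 X" using True by (auto simp: interpolates_def)
  then show ?thesis by auto
next
  case False
  let ?S = "Met_TC.fspace X :: (complex \<Rightarrow> complex) set" and ?d = "Met_TC.fdist X :: (complex \<Rightarrow> complex) \<Rightarrow> _"
  interpret F: Metric_space ?S ?d by (rule Met_TC.Metric_space_funspace)
  have S: "v \<in> ?S \<longleftrightarrow> v \<in> extensional X \<and> bounded (v ` X)" for v :: "complex \<Rightarrow> complex"
    by (auto simp: Met_TC.fspace_def)
  have dist_le: "cmod (u x - v x) \<le> ?d u v" if "u \<in> ?S" "v \<in> ?S" "x \<in> X" for u v x
    using cSUP_upper[OF that(3) Met_TC.bdd_above_dist[OF that(1,2) False]] that False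
    by (simp add: Met_TC.fdist_def dist_norm)
  define E where "E n = {v \<in> ?S. \<exists>f\<in>fock_ball a (real n). \<forall>x\<in>X. weighted a f x = v x}" for n
  have complete: "F.mcomplete"
  proof -
    have "Met_TC.mcomplete (TYPE(complex))" using complete_UNIV by blast
    then have "mcomplete_of (funspace X (Met_TC.Self :: complex metric))"
      by (rule Met_TC.mcomplete_funspace)
    then show ?thesis
      by (simp add: mcomplete_of_def)
  qed
  have cover: "?S \<subseteq> (\<Union>n. F.mtopology closure_of (E n))"
  proof
    fix v assume v: "v \<in> ?S"
    then obtain f where f: "f \<in> fock_space a" "\<forall>z\<in>X. weighted a f z = v z"
      using X S[of v] unfolding interpolation_set_def weighted_def by blast
    then obtain M where "f \<in> fock_ball a M" unfolding fock_space_eq by blast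
    then have "f \<in> fock_ball a (real (nat \<lceil>M\<rceil>))"
      by (rule fock_ball_mono) linarith
    then have "v \<in> E (nat \<lceil>M\<rceil>)" using v f by (auto simp: E_def)
    moreover have "E n \<subseteq> F.mtopology closure_of (E n)" for n
      by (rule closure_of_subset) (auto simp: E_def)
    ultimately show "v \<in> (\<Union>n. F.mtopology closure_of (E n))" by blast
  qed
  have "\<exists>n. F.mtopology interior_of (F.mtopology closure_of (E n)) \<noteq> {}"
  proof (rule ccontr)
    assume "\<not> ?thesis"
    then have "F.mtopology interior_of (\<Union>(range (\<lambda>n. F.mtopology closure_of (E n)))) = {}"
      by (intro F.metric_Baire_category_alt complete) auto
    moreover have "\<Union>(range (\<lambda>n. F.mtopology closure_of (E n))) = ?S"
      using cover closure_of_subset_topspace[of F.mtopology] by force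
    ultimately have "?S = {}" using interior_of_topspace[of F.mtopology] by simp
    moreover have "restrict (\<lambda>_. 0) X \<in> ?S" by (auto simp: S intro!: boundedI[of _ 0])
    ultimately show False by blast
  qed
  then obtain n b where b: "b \<in> F.mtopology interior_of (F.mtopology closure_of (E n))" by blast
  then have "openin F.mtopology (F.mtopology interior_of (F.mtopology closure_of (E n)))" by simp
  then obtain \<epsilon> where \<epsilon>: "\<epsilon> > 0" "F.mball b \<epsilon> \<subseteq> F.mtopology interior_of (F.mtopology closure_of (E n))"
    using b F.openin_mtopology by meson
  have ball: "F.mball b \<epsilon> \<subseteq> F.mtopology closure_of (E n)"
    by (rule order_trans[OF \<epsilon>(2) interior_of_subset])
  have bS: "b \<in> ?S" using subsetD[OF interior_of_subset_topspace b] by simp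
  have appr: "\<exists>f\<in>fock_ball a (real n). \<forall>x\<in>X. cmod (u x - weighted a f x) \<le> \<epsilon> / 8"
    if u: "u \<in> ?S" "?d b u < \<epsilon>" for u
  proof -
    have "u \<in> F.mtopology closure_of (E n)" using ball u bS by (auto simp: F.in_mball)
    then obtain w where w: "w \<in> E n" "w \<in> F.mball u (\<epsilon> / 8)"
      using \<epsilon>(1) unfolding F.metric_closure_of by (auto dest: spec[of _ "\<epsilon> / 8"])
    then obtain f where f: "f \<in> fock_ball a (real n)" "\<forall>x\<in>X. weighted a f x = w x" and "w \<in> ?S"
      by (auto simp: E_def)
    moreover have "cmod (u x - w x) \<le> \<epsilon> / 8" if "x \<in> X" for x
      using dist_le[OF u(1) \<open>w \<in> ?S\<close> that] w(2) by (auto simp: F.in_mball)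
    ultimately show ?thesis by (intro bexI[of _ f]) auto
  qed
  have "?d b b < \<epsilon>" using \<epsilon> bS by simp
  then obtain f1 where f1: "f1 \<in> fock_ball a (real n)" "\<And>x. x \<in> X \<Longrightarrow> cmod (b x - weighted a f1 x) \<le> \<epsilon> / 8"
    using appr[OF bS] by blast
  define M where "M = 2 / \<epsilon> * (real n + real n) + 1"
  have "interpolates a (2 * M) X"
  proof (rule approximate_interpolation_suffices[OF a])
    show "M \<ge> 0" using \<epsilon> by (simp add: M_def)
    fix v :: "complex \<Rightarrow> complex" assume v: "\<And>x. x \<in> X \<Longrightarrow> cmod (v x) \<le> 1"
    define u where "u = restrict (\<lambda>x. b x + of_real (\<epsilon> / 2) * v x) X"
    have "bounded ((\<lambda>x. of_real (\<epsilon> / 2) * v x) ` X)"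
      using v \<epsilon>(1) by (intro boundedI[of _ "\<epsilon> / 2"]) (auto simp: norm_mult)
    then have "bounded ((\<lambda>x. b x + of_real (\<epsilon> / 2) * v x) ` X)"
      using bS S by (intro bounded_plus_comp) auto
    then have uS: "u \<in> ?S" by (auto simp: S u_def)
    have "?d b u \<le> \<epsilon> / 2"
      using v \<epsilon>(1) by (subst Met_TC.funspace_mdist_le[OF bS uS False]) (auto simp: dist_norm u_def norm_mult)
    then have "?d b u < \<epsilon>" using \<epsilon>(1) by linarith
    then obtain f2 where f2: "f2 \<in> fock_ball a (real n)" "\<And>x. x \<in> X \<Longrightarrow> cmod (u x - weighted a f2 x) \<le> \<epsilon> / 8"
      using appr[OF uS] by blast
    define f where "f z = of_real (2 / \<epsilon>) * (f2 z - f1 z)" for z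
    have "f \<in> fock_ball a (cmod (of_real (2 / \<epsilon>)) * (real n + real n))"
      unfolding f_def by (intro fock_ball_scale fock_ball_diff f1 f2)
    moreover have "cmod (of_real (2 / \<epsilon>)) = 2 / \<epsilon>" using \<epsilon>(1) by (simp only: norm_of_real) simp
    ultimately have "f \<in> fock_ball a M" by (elim fock_ball_mono) (simp only: M_def)
    moreover have "cmod (v x - weighted a f x) \<le> 1/2" if x: "x \<in> X" for x
    proof -
      have wf: "weighted a f x = of_real (2 / \<epsilon>) * (weighted a f2 x - weighted a f1 x)"
        unfolding f_def weighted_scale weighted_diff ..
      have vf: "v x - weighted a f x = of_real (2 / \<epsilon>) * ((u x - weighted a f2 x) - (b x - weighted a f1 x))"
        using \<epsilon>(1) x unfolding wf by (simp add: u_def field_simps)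
      have "cmod (v x - weighted a f x) = 2 / \<epsilon> * cmod ((u x - weighted a f2 x) - (b x - weighted a f1 x))"
        unfolding vf norm_mult norm_of_real using \<epsilon>(1) by simp
      also have "\<dots> \<le> 2 / \<epsilon> * (\<epsilon> / 8 + \<epsilon> / 8)"
        using \<epsilon>(1) f1(2)[OF x] f2(2)[OF x] norm_triangle_ineq4[of "u x - weighted a f2 x" "b x - weighted a f1 x"]
        by (intro mult_left_mono) auto
      also have "\<dots> = 1/2" using \<epsilon>(1) by simp
      finally show ?thesis .
    qed
    ultimately show "\<exists>f\<in>fock_ball a M. \<forall>x\<in>X. cmod (v x - weighted a f x) \<le> 1/2" by blast
  qed
  moreover have "2 * M \<ge> 1" using \<epsilon>(1) by (simp add: M_def)
  ultimately show ?thesis by blast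
qed

section \<open>Perturbed sets and lower bounds at every point\<close>

definition lip_const :: "real \<Rightarrow> real" where "lip_const a = exp (a / 2) * (2 + a / 2)"

lemma fock_ball_local_bound:
  assumes a: "a > 0" and f: "f \<in> fock_ball a M" and z: "cmod z \<le> r"
  shows "cmod (f z) \<le> M * exp (a * r\<^sup>2 / 2)"
proof -
  have "cmod (f z) \<le> M * exp (a * (cmod z)\<^sup>2 / 2)"
    using fock_ballD(2)[OF f] by (rule cmod_le_of_weighted_le)
  also have "\<dots> \<le> M * exp (a * r\<^sup>2 / 2)"
    using a z fock_ballD(3)[OF f] by (auto intro!: mult_left_mono power_mono)
  finally show ?thesis .
qed

text \<open>Schwarz's lemma for \<open>f - f 0\<close> on the unit disc; the weight differs from \<open>1\<close> by at most \<open>a |z|\<^sup>2 / 2\<close>.\<close>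

lemma weighted_lipschitz:
  assumes a: "a > 0" and f: "f \<in> fock_ball a M" and z: "cmod z \<le> 1"
  shows "cmod (weighted a f z - f 0) \<le> lip_const a * M * cmod z"
proof -
  define B where "B = M * exp (a / 2)"
  have B: "cmod (f z) \<le> B" if "cmod z \<le> 1" for z
    using fock_ball_local_bound[OF a f that] by (simp add: B_def)
  have B0: "B \<ge> 0" by (rule order_trans[OF norm_ge_zero B[of 0]]) simp
  have "(\<lambda>z. f z - f 0) holomorphic_on UNIV" using fock_ballD(1)[OF f] by (intro holomorphic_intros)
  then obtain g where g: "g holomorphic_on UNIV" "\<And>z. f z - f 0 = (z - 0) * g z"
    by (rule entire_factor_zero[of "\<lambda>z. f z - f 0" 0]) auto
  have "cmod (g z) \<le> 2 * B" if "cmod z \<le> 1" for z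
  proof (rule max_modulus_disc[OF g(1) zero_less_one _ that])
    fix u assume u: "cmod u = 1"
    have "cmod (g u) = cmod (f u - f 0)" unfolding g(2) by (simp add: norm_mult u)
    also have "\<dots> \<le> B + B"
      using norm_triangle_ineq4[of "f u" "f 0"] B[of u] B[of 0] u by simp
    finally show "cmod (g u) \<le> 2 * B" by simp
  qed
  then have "cmod z * cmod (g z) \<le> cmod z * (2 * B)" using z by (intro mult_left_mono) auto
  then have 1: "cmod (f z - f 0) \<le> 2 * B * cmod z" unfolding g(2) by (simp add: norm_mult mult.commute)
  define e where "e = exp (- a * (cmod z)\<^sup>2 / 2)"
  have "1 - e \<le> a * (cmod z)\<^sup>2 / 2" using exp_ge_add_one_self[of "- a * (cmod z)\<^sup>2 / 2"] by (simp add: e_def)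
  also have "\<dots> \<le> a / 2 * cmod z"
    using a z by (simp add: power2_eq_square mult_left_le)
  finally have e: "1 - e \<le> a / 2 * cmod z" .
  have e1: "e \<le> 1" using a by (simp add: e_def)
  have "cmod ((of_real e - 1) * f z) = (1 - e) * cmod (f z)"
  proof -
    have "complex_of_real e - 1 = of_real (e - 1)" by simp
    then have "cmod (of_real e - 1) = 1 - e" using e1 by (simp only: norm_of_real)
    then show ?thesis by (simp add: norm_mult)
  qed
  also have "\<dots> \<le> (a / 2 * cmod z) * B"
    using e e1 B[OF z] B0 a by (intro mult_mono) auto
  finally have 2: "cmod ((of_real e - 1) * f z) \<le> (a / 2 * cmod z) * B" .
  have "weighted a f z - f 0 = (of_real e - 1) * f z + (f z - f 0)"
    by (simp add: weighted_def e_def algebra_simps)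
  then have "cmod (weighted a f z - f 0) \<le> (a / 2 * cmod z) * B + 2 * B * cmod z"
    using 1 2 norm_triangle_ineq[of "(of_real e - 1) * f z" "f z - f 0"] by (simp only:)
  also have "\<dots> = lip_const a * M * cmod z"
    by (simp add: lip_const_def B_def algebra_simps)
  finally show ?thesis .
qed

text \<open>A function interpolating data on \<open>X\<close> takes nearly the same weighted values at the moved points,
  apart from a phase that is built into the data. The error is at most \<open>1/2\<close>, and
  \<open>approximate_interpolation_suffices\<close> removes it.\<close>

lemma interpolates_perturbation:
  assumes a: "a > 0" and M: "M \<ge> 0" and X: "interpolates a M X"
    and p: "\<And>x. x \<in> X \<Longrightarrow> cmod (p x - x) \<le> \<delta>" and \<delta>: "\<delta> \<le> 1" "lip_const a * M * \<delta> \<le> 1 / 2"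
  shows "interpolates a (2 * M) (p ` X)"
proof (rule approximate_interpolation_suffices[OF a M])
  fix v :: "complex \<Rightarrow> complex" assume v: "\<And>x. x \<in> p ` X \<Longrightarrow> cmod (v x) \<le> 1"
  have L: "lip_const a \<ge> 0" using a by (simp add: lip_const_def)
  obtain f where f: "f \<in> fock_ball a M" "\<forall>x\<in>X. weighted a f x = phase a x (p x - x) * v (p x)"
    using interpolates_unitD[OF X, of "\<lambda>x. phase a x (p x - x) * v (p x)"] v by (auto simp: norm_mult)
  have "cmod (v (p x) - weighted a f (p x)) \<le> 1/2" if x: "x \<in> X" for x
  proof -
    define g where "g = fock_shift a x f"
    have g: "g \<in> fock_ball a M" unfolding g_def by (rule fock_shift_in_fock_ball[OF f(1)])
    have g0: "g 0 = phase a x (p x - x) * v (p x)"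
      using weighted_fock_shift[of a x f 0] f(2) x by (simp add: g_def weighted_def)
    have gz: "weighted a g (p x - x) = phase a x (p x - x) * weighted a f (p x)"
      unfolding g_def weighted_fock_shift by simp
    have "cmod (v (p x) - weighted a f (p x)) = cmod (phase a x (p x - x) * (weighted a f (p x) - v (p x)))"
      by (simp add: norm_mult norm_minus_commute)
    also have "\<dots> = cmod (weighted a g (p x - x) - g 0)"
      by (simp add: g0 gz algebra_simps)
    also have "\<dots> \<le> lip_const a * M * cmod (p x - x)"
      using p[OF x] \<delta> by (intro weighted_lipschitz a g) auto
    also have "\<dots> \<le> lip_const a * M * \<delta>"
      using p[OF x] L M by (intro mult_left_mono) auto
    finally show ?thesis using \<delta> by simp
  qed
  then show "\<exists>f\<in>fock_ball a M. \<forall>x\<in>p ` X. cmod (v x - weighted a f x) \<le> 1/2"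
    using f(1) by (intro bexI[of _ f]) auto
qed

text \<open>A function of norm at most \<open>M\<close> with weighted value \<open>1\<close> at \<open>x\<close> cannot vanish too close to \<open>x\<close>: apply
  \<open>weighted_blaschke_bound\<close> on the unit disc.\<close>

lemma interpolates_separated:
  assumes a: "a > 0" and M: "M \<ge> 1" and X: "interpolates a M X" and xy: "x \<in> X" "y \<in> X" "x \<noteq> y"
  shows "dist x y \<ge> exp (- a / 2) / M"
proof (cases "dist x y < 1")
  case False
  have "exp (- a / 2) / M \<le> 1 / 1" using a M by (intro frac_le) auto
  then show ?thesis using False by simp
next
  case True
  obtain f where f: "f \<in> fock_ball a M" "weighted a f x = 1" and fX: "\<forall>y\<in>X - {x}. f y = 0"
    by (rule interpolates_peak[OF X xy(1)])
  have fy: "f y = 0" using fX xy by auto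
  have d: "cmod (y - x) > 0" using xy by simp
  have "cmod (weighted a f x) * (\<Prod>\<zeta>\<in>{y}. 1 / cmod (\<zeta> - x)) \<le> M * exp (a * 1\<^sup>2 / 2)"
    by (rule weighted_blaschke_bound) (use f fy True in \<open>auto dest: fock_ballD simp: dist_norm norm_minus_commute\<close>)
  then have "1 \<le> M * exp (a / 2) * cmod (y - x)" using f(2) xy d by (simp add: field_simps)
  then have "1 * exp (- a / 2) \<le> M * exp (a / 2) * cmod (y - x) * exp (- a / 2)" by (intro mult_right_mono) auto
  also have "\<dots> = M * cmod (y - x)" by (simp add: exp_minus)
  finally show ?thesis using M by (simp add: dist_norm norm_minus_commute field_simps)
qed

text \<open>If \<open>F\<close> has a point within distance \<open>C\<close> of \<open>w\<close>, its peak function serves. Otherwise the reproducing kernel at \<open>w\<close>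
  has weighted modulus at most \<open>e\<^bsup>-aC\<^sup>2/2\<^esup>\<close> on \<open>F\<close>, and subtracting a function that interpolates it there changes
  the value \<open>1\<close> at \<open>w\<close> by at most \<open>1/2\<close>.\<close>

lemma large_function_near_every_point:
  assumes a: "a > 0" and M: "M \<ge> 1" and F: "interpolates a M F" and C: "C > 0" "M * exp (- a * C\<^sup>2 / 2) \<le> 1 / 2"
  shows "\<exists>c f. cmod (c - w) \<le> C \<and> f \<in> fock_ball a (M + 1) \<and> cmod (weighted a f c) \<ge> 1/2 \<and> (\<forall>x\<in>F - {c}. f x = 0)"
proof (cases "\<exists>c\<in>F. cmod (c - w) \<le> C")
  case True
  then obtain c where c: "c \<in> F" "cmod (c - w) \<le> C" by blast
  obtain f where f: "f \<in> fock_ball a M" "weighted a f c = 1" "\<forall>y\<in>F - {c}. f y = 0"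
    by (rule interpolates_peak[OF F c(1)])
  have "f \<in> fock_ball a (M + 1)" using f(1) by (rule fock_ball_mono) simp
  then show ?thesis using f(2,3) c by (intro exI[of _ c] exI[of _ f]) auto
next
  case False
  define k where "k = fock_shift a (- w) (\<lambda>_. 1)"
  have k_val: "cmod (weighted a k z) = exp (- a * (cmod (z - w))\<^sup>2 / 2)" for z
    by (simp add: k_def weighted_fock_shift norm_mult cmod_weighted)
  have k: "k \<in> fock_ball a 1"
    using a by (intro fock_ballI) (auto simp: k_val, auto simp: k_def intro!: holomorphic_intros)
  have kF: "cmod (weighted a k x) \<le> exp (- a * C\<^sup>2 / 2)" if "x \<in> F" for x
    unfolding k_val using that False C a by (auto intro!: power_mono)
  obtain g where g: "g \<in> fock_ball a (exp (- a * C\<^sup>2 / 2) * M)" "\<And>x. x \<in> F \<Longrightarrow> weighted a g x = weighted a k x"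
    using interpolatesD[OF F _ kF, of "\<lambda>x. x"] by auto
  have g': "g \<in> fock_ball a (1/2)" using g(1) by (rule fock_ball_mono) (use C in \<open>simp add: mult.commute\<close>)
  define f where "f z = k z - g z" for z
  have "f \<in> fock_ball a (1 + 1/2)" unfolding f_def by (intro fock_ball_diff k g')
  then have "f \<in> fock_ball a (M + 1)" by (rule fock_ball_mono) (use M in simp)
  moreover have "f x = 0" if "x \<in> F" for x
    using g(2)[OF that] by (simp add: f_def weighted_def)
  moreover have "cmod (weighted a f w) \<ge> 1/2"
    using fock_ballD(2)[OF g', of w] k_val[of w] norm_triangle_ineq2[of "weighted a k w" "weighted a g w"]
    unfolding f_def weighted_diff by simp
  ultimately show ?thesis using C by (intro exI[of _ w] exI[of _ f]) auto
qed

text \<open>If \<open>f\<close> were tiny on the disc of radius \<open>\<eta>\<close> about \<open>w\<close>, then the maximum principle for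
  \<open>f(z) / (z - w)\<^sup>n\<close> on the annulus between the radii \<open>\<eta>\<close> and \<open>2 C\<close> would make \<open>f\<close> small at \<open>c\<close>, provided
  \<open>n\<close> is so large that the outer circle contributes at most \<open>1/4\<close>. The point of the statement is that \<open>m\<close>
  depends only on \<open>a\<close>, \<open>M\<close>, \<open>C\<close>, \<open>\<eta>\<close>.\<close>

lemma large_value_propagates:
  assumes a: "a > 0" and M: "M > 0" and \<eta>: "\<eta> > 0" and C: "C > 0"
  shows "\<exists>m>0. \<forall>f w c. f \<in> fock_ball a M \<longrightarrow> cmod (c - w) \<le> C \<longrightarrow> cmod (weighted a f c) \<ge> 1/2 \<longrightarrow>
           (\<exists>w'. cmod (w' - w) \<le> \<eta> \<and> cmod (weighted a f w') \<ge> m)"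
proof -
  define B where "B = M * exp (a * (2 * C)\<^sup>2 / 2)"
  obtain n :: nat where n: "4 * B < 2 ^ n" using real_arch_pow[of 2 "4 * B"] by auto
  define E where "E = exp (a * \<eta>\<^sup>2 / 2)"
  have E: "E > 0" by (simp add: E_def)
  define m where "m = min (1/2) (\<eta> ^ n / (4 * C ^ n * E))"
  have m: "m > 0" using \<eta> C E by (simp add: m_def)
  moreover have "\<exists>w'. cmod (w' - w) \<le> \<eta> \<and> cmod (weighted a f w') \<ge> m"
    if f: "f \<in> fock_ball a M" and c: "cmod (c - w) \<le> C" "cmod (weighted a f c) \<ge> 1/2" for f w c
  proof (rule ccontr)
    assume neg: "\<not> ?thesis"
    define g where "g = fock_shift a w f"
    define u where "u = c - w"
    have g: "g \<in> fock_ball a M" unfolding g_def by (rule fock_shift_in_fock_ball[OF f])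
    have g_hol: "g holomorphic_on UNIV" by (rule fock_ballD(1)[OF g])
    have \<eta>u: "\<eta> < cmod u"
      using neg c(2) by (auto simp: u_def m_def not_le)
    have uC: "cmod u \<le> C" using c(1) by (simp add: u_def)
    have "1/2 \<le> cmod (weighted a g u)"
      using c(2) by (simp add: g_def u_def weighted_fock_shift norm_mult)
    also have "\<dots> \<le> cmod (g u)"
      unfolding cmod_weighted using a by (intro mult_left_le_one_le) auto
    finally have gu: "1/2 \<le> cmod (g u)" .
    define S where "S = cball (0::complex) (2 * C) - ball 0 \<eta>"
    have S0: "z \<noteq> 0" if "z \<in> S" for z using that \<eta> by (auto simp: S_def)
    have clS: "closed S" unfolding S_def by (intro closed_Diff) auto
    have hol: "(\<lambda>z. g z / z ^ n) holomorphic_on S"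
      using S0 by (intro holomorphic_intros holomorphic_on_subset[OF g_hol]) auto
    have "cmod (g u / u ^ n) \<le> 1 / (4 * C ^ n)"
    proof (rule maximum_modulus_frontier[of "\<lambda>z. g z / z ^ n" S])
      show "(\<lambda>z. g z / z ^ n) holomorphic_on interior S"
        by (rule holomorphic_on_subset[OF hol interior_subset])
      show "continuous_on (closure S) (\<lambda>z. g z / z ^ n)"
        using holomorphic_on_imp_continuous_on[OF hol] clS by simp
      show "bounded S" unfolding S_def by (intro bounded_diff) auto
      show "u \<in> S" using \<eta>u uC C by (auto simp: S_def)
      fix z assume z: "z \<in> frontier S"
      have "open (ball (0::complex) (2 * C) - cball 0 \<eta>)" by auto
      then have "ball 0 (2 * C) - cball 0 \<eta> \<subseteq> interior S"
        by (intro interior_maximal) (auto simp: S_def)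
      then have "cmod z = \<eta> \<or> cmod z = 2 * C"
        using z clS by (force simp: frontier_def S_def)
      then show "cmod (g z / z ^ n) \<le> 1 / (4 * C ^ n)"
      proof
        assume z: "cmod z = \<eta>"
        have "cmod (weighted a g z) \<le> m"
          using neg z by (auto simp: g_def weighted_fock_shift norm_mult dest!: spec[of _ "z + w"])
        then have "cmod (g z) \<le> m * E"
          using cmod_le_of_weighted_le[of a g z m] z by (simp add: E_def)
        also have "\<dots> \<le> \<eta> ^ n / (4 * C ^ n * E) * E" using E by (intro mult_right_mono) (auto simp: m_def)
        finally have "cmod (g z) \<le> \<eta> ^ n / (4 * C ^ n)" using E by simp
        then show ?thesis using z \<eta> C by (simp add: norm_divide norm_power field_simps)
      next
        assume z: "cmod z = 2 * C"
        have "cmod (g z) \<le> B"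
          using fock_ball_local_bound[OF a g, of z "2 * C"] z by (simp add: B_def)
        then have "cmod (g z) \<le> 2 ^ n / 4" using n by simp
        then show ?thesis using z C by (simp add: norm_divide norm_power power_mult_distrib field_simps)
      qed
    qed
    then have "cmod (g u) / cmod u ^ n \<le> 1 / (4 * C ^ n)" by (simp add: norm_divide norm_power)
    moreover have "cmod u ^ n > 0" by (intro zero_less_power order.strict_trans[OF \<eta> \<eta>u])
    ultimately have "cmod (g u) \<le> cmod u ^ n / (4 * C ^ n)" by (subst (asm) pos_divide_le_eq) auto
    also have "\<dots> \<le> C ^ n / (4 * C ^ n)" using uC C by (intro divide_right_mono power_mono) auto
    also have "\<dots> = 1/4" using C by simp
    finally show False using gu by simp
  qed
  ultimately show ?thesis by blast
qed

text \<open>A lower step-function approximation of \<open>max 0 (ln (n / t))\<close>, written as a sum of indicators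
  of \<open>t \<le> j\<close> so that \<open>counting_by_averaging\<close> applies with discs.\<close>

lemma step_log_le:
  assumes "t > 0"
  shows "(\<Sum>j=1..<Suc n. ln (real (j + 1) / real j) * of_bool (t \<le> real j)) \<le> max 0 (ln (real (Suc n) / t))"
proof (induction n)
  case (Suc n)
  let ?S = "\<lambda>n. \<Sum>j=1..<Suc n. ln (real (j + 1) / real j) * of_bool (t \<le> real j)"
  have eq: "?S (Suc n) = ?S n + ln (real (Suc n + 1) / real (Suc n)) * of_bool (t \<le> real (Suc n))"
    by (subst sum.atLeastLessThan_Suc) auto
  show ?case
  proof (cases "t \<le> real (Suc n)")
    case True
    then have "ln (real (Suc n) / t) \<ge> 0" using assms by simp
    then have "?S n \<le> ln (real (Suc n) / t)" using Suc by simp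
    moreover have "ln (real (Suc n + 1) / real (Suc n)) + ln (real (Suc n) / t) = ln (real (Suc (Suc n)) / t)"
      using assms by (simp add: ln_div)
    ultimately show ?thesis using True unfolding eq by simp
  next
    case False
    then have "ln (real (Suc n) / t) \<le> 0" using assms by (simp add: ln_le_zero_iff)
    then have "?S n \<le> 0" using Suc by simp
    then show ?thesis using False unfolding eq by simp
  qed
qed simp

section \<open>Necessity of the density condition\<close>

text \<open>Jensen's inequality on the disc of radius \<open>R = n h\<close> about \<open>w\<close>, after contraction of the points by the
  factor \<open>(R - 8 h) / R\<close>. Each point moves by at most \<open>8 h\<close>, so the perturbed set is still interpolating. The
  centre \<open>w'\<close> of the estimate is within \<open>h / 2\<close> of \<open>w\<close>; replacing \<open>|x - w|\<close> by
  \<open>|x - w| + h\<close> absorbs this shift. The exceptional zero \<open>c\<close> costs at most \<open>ln n\<close>.\<close>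

lemma logarithmic_count_at_scale:
  fixes h :: real and n :: nat
  assumes a: "a > 0" and M: "M \<ge> 1" and X: "interpolates a M X" and ud: "uniform_discrete X"
    and h: "h > 0" "8 * h \<le> 1" "lip_const a * M * (8 * h) \<le> 1/2" and n: "n \<ge> 16"
    and m: "m > 0" and large: "\<And>F w. interpolates a (2 * M) F \<Longrightarrow>
      \<exists>f w' c. f \<in> fock_ball a (2 * M + 1) \<and> cmod (w' - w) \<le> h / 2 \<and> cmod (weighted a f w') \<ge> m \<and> (\<forall>x\<in>F - {c}. f x = 0)"
  shows "(\<Sum>j=1..<n. ln (real (j + 1) / real j) * real (card (X \<inter> cball w ((real j - 1) * h))))
    \<le> ln ((2 * M + 1) / m) + a * ((real n - 8) * h)\<^sup>2 / 2 + ln (real n)"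
proof -
  define R where "R = real n * h"
  define r where "r = (real n - 8) * h"
  define q where "q = r / R"
  have R: "R > 0" using h n by (simp add: R_def)
  have r: "r > 0" using h n by (simp add: r_def)
  have qR: "q * R = r" using R by (simp add: q_def)
  have Rr: "R - r = 8 * h" by (simp add: R_def r_def algebra_simps)
  have q: "q \<ge> 1/2" "q \<le> 1" "q > 0"
    using h n R r by (auto simp: q_def R_def r_def field_simps)
  define F where "F = X \<inter> cball w R"
  have F: "finite F" unfolding F_def by (rule finite_Int_bounded_of_sep[OF ud]) simp
  define p where "p x = w + of_real q * (x - w)" for x
  have inj_p: "inj p" using q by (auto simp: p_def inj_on_def)
  have "cmod (p x - x) \<le> 8 * h" if "x \<in> F" for x
  proof -
    have "p x - x = of_real (q - 1) * (x - w)" by (simp add: p_def algebra_simps)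
    then have "cmod (p x - x) = (1 - q) * cmod (x - w)" using q by (simp only: norm_mult norm_of_real) simp
    also have "\<dots> \<le> (1 - q) * R" using that q by (intro mult_left_mono) (auto simp: F_def dist_norm norm_minus_commute)
    also have "\<dots> = 8 * h" using qR Rr by (simp add: algebra_simps)
    finally show ?thesis .
  qed
  then have "interpolates a (2 * M) (p ` F)"
    using interpolates_subset[OF X, of F] M h
    by (intro interpolates_perturbation[where \<delta> = "8 * h"] a) (auto simp: F_def)
  then obtain f w' c where f: "f \<in> fock_ball a (2 * M + 1)" and w': "cmod (w' - w) \<le> h / 2"
    and fw': "cmod (weighted a f w') \<ge> m" and f0: "\<forall>x\<in>p ` F - {c}. f x = 0"
    using large by blast
  define Z where "Z = {z \<in> p ` F - {c}. cmod (z - w') < r}"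
  have Z: "finite Z" using F by (simp add: Z_def)
  have "f w' \<noteq> 0" using fw' m weighted_eq_0_iff[of a f w'] by auto
  then have pos: "cmod (z - w') > 0" if "z \<in> Z" for z using that f0 by (auto simp: Z_def)
  have "cmod (weighted a f w') * (\<Prod>z\<in>Z. r / cmod (z - w')) \<le> (2 * M + 1) * exp (a * r\<^sup>2 / 2)"
    by (rule weighted_blaschke_bound[OF Z fock_ballD(1)[OF f] r]) (use f0 fock_ballD(2)[OF f] in \<open>auto simp: Z_def\<close>)
  moreover have Ppos: "(\<Prod>z\<in>Z. r / cmod (z - w')) > 0" using pos r by (intro prod_pos) auto
  then have "m * (\<Prod>z\<in>Z. r / cmod (z - w')) \<le> cmod (weighted a f w') * (\<Prod>z\<in>Z. r / cmod (z - w'))"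
    using fw' by (intro mult_right_mono) auto
  ultimately have "(\<Prod>z\<in>Z. r / cmod (z - w')) \<le> (2 * M + 1) / m * exp (a * r\<^sup>2 / 2)"
    using m by (simp add: field_simps)
  then have "ln (\<Prod>z\<in>Z. r / cmod (z - w')) \<le> ln ((2 * M + 1) / m * exp (a * r\<^sup>2 / 2))"
    using Ppos by (intro ln_mono) auto
  also have "\<dots> = ln ((2 * M + 1) / m) + a * r\<^sup>2 / 2" using M m by (subst ln_mult) auto
  also have "ln (\<Prod>z\<in>Z. r / cmod (z - w')) = (\<Sum>z\<in>Z. ln (r / cmod (z - w')))"
    using Z pos r by (intro ln_prod) force+
  finally have sumZ: "(\<Sum>z\<in>Z. ln (r / cmod (z - w'))) \<le> ln ((2 * M + 1) / m) + a * r\<^sup>2 / 2" .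
  \<comment> \<open>In units of \<open>h\<close>: \<open>t x \<le> j\<close> means that \<open>x\<close> lies in the disc of radius \<open>(j - 1) h\<close>.\<close>
  define t where "t x = (cmod (x - w) + h) / h" for x
  define L where "L x = (\<Sum>j=1..<n. ln (real (j + 1) / real j) * of_bool (t x \<le> real j))" for x
  have t1: "t x \<ge> 1" for x using h by (simp add: t_def)
  have L: "L x \<le> max 0 (ln (real n / t x))" for x
    using step_log_le[of "t x" "n - 1"] t1[of x] n by (simp add: L_def)
  have Lx: "L x \<le> (if p x \<in> Z then ln (r / cmod (p x - w')) else 0) + (if p x = c then ln (real n) else 0)"
    if x: "x \<in> F" for x
  proof (cases "t x < real n")
    case False
    then have "real n / t x \<le> 1" "real n / t x > 0" using t1[of x] n by (auto simp: divide_le_eq)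
    then have "ln (real n / t x) \<le> 0" by simp
    then have "L x \<le> 0" using L[of x] by simp
    moreover have "ln (r / cmod (p x - w')) \<ge> 0" if "p x \<in> Z"
      using that pos[OF that] by (simp add: Z_def)
    moreover have "ln (real n) \<ge> 0" using n by simp
    ultimately show ?thesis by auto
  next
    case True
    have Lt: "L x \<le> ln (real n / t x)" using L[of x] True t1[of x] by simp
    have "cmod (x - w) + h < R" using True h by (simp add: t_def R_def field_simps)
    have "cmod (p x - w') \<le> cmod (p x - w) + cmod (w' - w)"
      by (metis norm_triangle_ineq4 diff_diff_eq2 diff_add_cancel add_diff_cancel_right' diff_diff_add)
    also have "\<dots> \<le> q * cmod (x - w) + h / 2" using w' q by (simp add: p_def norm_mult)
    also have "\<dots> \<le> q * (cmod (x - w) + h)" using q h by (simp add: algebra_simps)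
    finally have le: "cmod (p x - w') \<le> q * (cmod (x - w) + h)" .
    also have "\<dots> < q * R" using \<open>cmod (x - w) + h < R\<close> q by simp
    finally have lt: "cmod (p x - w') < r" using qR by simp
    show ?thesis
    proof (cases "p x = c")
      case True
      have "ln (real n / t x) \<le> ln (real n)" using t1[of x] n by (intro ln_mono) (auto simp: field_simps)
      then show ?thesis using Lt True by (auto simp: Z_def)
    next
      case False
      then have pZ: "p x \<in> Z" using lt x by (auto simp: Z_def)
      have "real n / t x = R / (cmod (x - w) + h)" by (simp add: t_def R_def)
      also have "\<dots> = r / (q * (cmod (x - w) + h))" using q by (simp add: qR[symmetric])
      also have "\<dots> \<le> r / cmod (p x - w')"
        using le pos[OF pZ] r q h by (intro divide_left_mono mult_pos_pos add_nonneg_pos) auto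
      finally have "ln (real n / t x) \<le> ln (r / cmod (p x - w'))"
        using t1[of x] n by (intro ln_mono) auto
      then show ?thesis using Lt pZ False by simp
    qed
  qed
  have "(\<Sum>j=1..<n. ln (real (j + 1) / real j) * real (card (X \<inter> cball w ((real j - 1) * h)))) = (\<Sum>x\<in>F. L x)"
  proof -
    have "real (card (X \<inter> cball w ((real j - 1) * h))) = (\<Sum>x\<in>F. of_bool (t x \<le> real j))" if j: "j \<in> {1..<n}" for j
    proof -
      have "(real j - 1) * h \<le> R" unfolding R_def using j h by (intro mult_right_mono) auto
      then have "X \<inter> cball w ((real j - 1) * h) = {x\<in>F. t x \<le> real j}"
        using h by (auto simp: F_def t_def dist_norm norm_minus_commute field_simps)
      then show ?thesis using F by (simp add: of_bool_def sum.If_cases Int_def)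
    qed
    then have "(\<Sum>j=1..<n. ln (real (j + 1) / real j) * real (card (X \<inter> cball w ((real j - 1) * h))))
        = (\<Sum>j=1..<n. \<Sum>x\<in>F. ln (real (j + 1) / real j) * of_bool (t x \<le> real j))"
      by (intro sum.cong refl) (simp only: sum_distrib_left)
    also have "\<dots> = (\<Sum>x\<in>F. L x)" unfolding L_def by (rule sum.swap)
    finally show ?thesis .
  qed
  also have "\<dots> \<le> (\<Sum>x\<in>F. (if p x \<in> Z then ln (r / cmod (p x - w')) else 0) + (if p x = c then ln (real n) else 0))"
    using Lx by (rule sum_mono)
  also have "\<dots> = (\<Sum>x\<in>F. if p x \<in> Z then ln (r / cmod (p x - w')) else 0) + (\<Sum>x\<in>F. if p x = c then ln (real n) else 0)"
    by (rule sum.distrib)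
  also have "(\<Sum>x\<in>F. if p x \<in> Z then ln (r / cmod (p x - w')) else 0) = (\<Sum>z\<in>p ` F. if z \<in> Z then ln (r / cmod (z - w')) else 0)"
    by (subst sum.reindex) (auto intro: inj_on_subset[OF inj_p])
  also have "\<dots> = (\<Sum>z\<in>Z. ln (r / cmod (z - w')))"
    using F by (subst sum.If_cases) (auto simp: Z_def intro!: sum.cong)
  also have "(\<Sum>x\<in>F. if p x = c then ln (real n) else 0) \<le> ln (real n)"
  proof -
    have "card (F \<inter> {x. p x = c}) \<le> 1"
      using F inj_p by (subst One_nat_def, subst card_le_Suc0_iff_eq) (auto dest: injD)
    then have "real (card (F \<inter> {x. p x = c})) * ln (real n) \<le> 1 * ln (real n)" using n by (intro mult_right_mono) auto
    then show ?thesis using F by (simp add: sum.If_cases)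
  qed
  finally show ?thesis using sumZ by (simp add: r_def)
qed

lemma sum_step_log_ge:
  assumes "n \<ge> 1"
  shows "(\<Sum>j=1..<n. ln (real (j + 1) / real j) * (real j - 1)\<^sup>2) \<ge> (real n)\<^sup>2 / 2 - 4 * real n"
  using assms
proof (induction n rule: dec_induct)
  case (step n)
  then have n: "real n \<ge> 1" by simp
  have "ln (real (n + 1) / real n) \<ge> 1 / (real n + 1)"
    using ln_le_minus_one[of "real n / real (n + 1)"] n by (simp add: ln_div field_simps)
  then have "ln (real (n + 1) / real n) * (real n - 1)\<^sup>2 \<ge> 1 / (real n + 1) * (real n - 1)\<^sup>2"
    by (intro mult_right_mono) auto
  moreover have "1 / (real n + 1) * (real n - 1)\<^sup>2 \<ge> real n - 3"
    using n by (simp add: field_simps power2_eq_square)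
  moreover have "(\<Sum>j=1..<Suc n. ln (real (j + 1) / real j) * (real j - 1)\<^sup>2)
    = (\<Sum>j=1..<n. ln (real (j + 1) / real j) * (real j - 1)\<^sup>2) + ln (real (n + 1) / real n) * (real n - 1)\<^sup>2"
    using step by (subst sum.atLeastLessThan_Suc) auto
  moreover have "(real (Suc n))\<^sup>2 / 2 - 4 * real (Suc n) \<le> (real n)\<^sup>2 / 2 - 4 * real n + (real n - 3)"
    by (simp add: power2_eq_square field_simps)
  ultimately show ?case using step.IH by linarith
qed simp

text \<open>With \<open>e = a h\<^sup>2\<close>, the contraction lowers the right-hand side of Jensen's inequality to
  \<open>e n\<^sup>2 / 2 - 8 e n + O(ln n)\<close>, whereas the mean of the step function is at least
  \<open>e n\<^sup>2 / 2 - 4 e n\<close> in the same normalization. For large \<open>n\<close> the gain exceeds the loss.\<close>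

lemma interpolates_imp_subcritical_log_count:
  assumes a: "a > 0" and M: "M \<ge> 1" and X: "interpolates a M X" and ud: "uniform_discrete X"
  obtains n h A where "h > 0"
    "\<forall>w. (\<Sum>j=1..<n. ln (real (j + 1) / real j) * real (card (X \<inter> cball w ((real j - 1) * h)))) \<le> A"
    "A < a / pi * (\<Sum>j=1..<n. ln (real (j + 1) / real j) * (pi * ((real j - 1) * h)\<^sup>2))"
proof -
  define K where "K = lip_const a * M"
  have K: "K > 0" using a M by (auto simp: K_def lip_const_def intro!: mult_pos_pos add_pos_pos)
  \<comment> \<open>The admissible displacement of the points is \<open>8 h\<close>.\<close>
  define h where "h = min 1 (1 / (2 * K)) / 8"
  have h: "h > 0" "8 * h \<le> 1" "lip_const a * M * (8 * h) \<le> 1/2"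
  proof -
    have "K * (8 * h) \<le> K * (1 / (2 * K))" using K by (intro mult_left_mono) (auto simp: h_def)
    also have "\<dots> = 1/2" using K by simp
    finally show "lip_const a * M * (8 * h) \<le> 1/2" unfolding K_def .
  qed (use K in \<open>auto simp: h_def\<close>)
  have "((\<lambda>k. exp (- a / 2) ^ k) \<longlonglongrightarrow> 0)" using a by (intro LIMSEQ_realpow_zero) auto
  then have "eventually (\<lambda>k. exp (- a / 2) ^ k < 1 / (4 * M)) sequentially"
    using M by (intro order_tendstoD) auto
  then obtain k0 where k0: "\<And>k. k \<ge> k0 \<Longrightarrow> exp (- a / 2) ^ k < 1 / (4 * M)" by (auto simp: eventually_sequentially)
  define C where "C = real (Suc k0)"
  have C: "C > 0" by (simp add: C_def)
  have C2: "2 * M * exp (- a * C\<^sup>2 / 2) \<le> 1/2"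
  proof -
    have "exp (- a / 2) ^ ((Suc k0)\<^sup>2) < 1 / (4 * M)" by (rule k0) (simp add: power2_eq_square)
    moreover have "exp (- a / 2) ^ ((Suc k0)\<^sup>2) = exp (- a * C\<^sup>2 / 2)"
      unfolding C_def exp_of_nat_mult[symmetric] by (simp add: algebra_simps)
    ultimately show ?thesis using M by (simp add: field_simps)
  qed
  have "2 * M + 1 > 0" "h / 2 > 0" using M h by auto
  from large_value_propagates[OF a this C]
  obtain m where m: "m > 0" and spread: "\<And>f w c. f \<in> fock_ball a (2 * M + 1) \<Longrightarrow> cmod (c - w) \<le> C \<Longrightarrow>
      cmod (weighted a f c) \<ge> 1/2 \<Longrightarrow> \<exists>w'. cmod (w' - w) \<le> h / 2 \<and> cmod (weighted a f w') \<ge> m"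
    by blast
  have large: "\<exists>f w' c. f \<in> fock_ball a (2 * M + 1) \<and> cmod (w' - w) \<le> h / 2 \<and> cmod (weighted a f w') \<ge> m \<and> (\<forall>x\<in>F - {c}. f x = 0)"
    if F: "interpolates a (2 * M) F" for F w
  proof -
    have "2 * M \<ge> 1" using M by simp
    from large_function_near_every_point[OF a this F C C2, of w]
    obtain c f where "cmod (c - w) \<le> C" "f \<in> fock_ball a (2 * M + 1)" "cmod (weighted a f c) \<ge> 1/2" "\<forall>x\<in>F - {c}. f x = 0"
      by blast
    with spread[of f c w] show ?thesis by blast
  qed
  define D where "D = ln ((2 * M + 1) / m)"
  define e where "e = a * h\<^sup>2"
  have e: "e > 0" using a h by (simp add: e_def)
  have "eventually (\<lambda>n. ln (real n) / real n < e) sequentially"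
    using lim_ln_over_n e by (intro order_tendstoD) auto
  moreover have "eventually (\<lambda>n::nat. real n > (D + 32 * e) / e) sequentially"
    using filterlim_real_sequentially unfolding filterlim_at_top_dense by blast
  ultimately have "eventually (\<lambda>n. ln (real n) / real n < e \<and> real n > (D + 32 * e) / e \<and> n \<ge> 16) sequentially"
    by (intro eventually_conj eventually_ge_at_top)
  then obtain n :: nat where n: "ln (real n) / real n < e" "real n > (D + 32 * e) / e" "n \<ge> 16"
    by (auto simp: eventually_sequentially)
  define A where "A = D + a * ((real n - 8) * h)\<^sup>2 / 2 + ln (real n)"
  have "A = D + e * (real n - 8)\<^sup>2 / 2 + ln (real n)" by (simp add: A_def e_def power_mult_distrib)
  also have "\<dots> = D + 32 * e + ln (real n) + (e * (real n)\<^sup>2 / 2 - 8 * e * real n)"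
    by (simp add: power2_eq_square field_simps)
  also have "\<dots> < e * ((real n)\<^sup>2 / 2 - 4 * real n)"
  proof -
    have "ln (real n) < e * real n" using n by (simp add: field_simps)
    moreover have "D + 32 * e < e * real n" using n e by (simp add: field_simps)
    ultimately have "D + 32 * e + ln (real n) < 2 * (e * real n)" by linarith
    moreover have "e * real n > 0" using e n by simp
    ultimately show ?thesis by (simp add: algebra_simps)
  qed
  also have "\<dots> \<le> e * (\<Sum>j=1..<n. ln (real (j + 1) / real j) * (real j - 1)\<^sup>2)"
    using e n sum_step_log_ge[of n] by (intro mult_left_mono) auto
  also have "\<dots> = a / pi * (\<Sum>j=1..<n. ln (real (j + 1) / real j) * (pi * ((real j - 1) * h)\<^sup>2))"
    unfolding sum_distrib_left by (intro sum.cong refl) (simp add: e_def power_mult_distrib)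
  finally have "A < a / pi * (\<Sum>j=1..<n. ln (real (j + 1) / real j) * (pi * ((real j - 1) * h)\<^sup>2))" .
  then show ?thesis
    using logarithmic_count_at_scale[OF a M X ud h n(3) m large]
    by (intro that[of h n A]) (auto simp: A_def D_def h)
qed

theorem interpolation_set_necessary:
  assumes a: "a > 0" and I: "compact I" "emeasure lebesgue I = 1" and X: "interpolation_set a X"
  shows "uniform_discrete X" "upper_uniform_density I X < ereal (a / pi)"
proof -
  obtain M where M: "M \<ge> 1" "interpolates a M X"
    using interpolates_of_interpolation_set[OF a X] by blast
  show ud: "uniform_discrete X"
    unfolding uniform_discrete_def
    using interpolates_separated[OF a M] M(1) by (intro exI[of _ "exp (- a / 2) / M"]) force
  obtain n h A where h: "h > 0"
    and count: "\<forall>w. (\<Sum>j=1..<n. ln (real (j + 1) / real j) * real (card (X \<inter> cball w ((real j - 1) * h)))) \<le> A"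
    and A: "A < a / pi * (\<Sum>j=1..<n. ln (real (j + 1) / real j) * (pi * ((real j - 1) * h)\<^sup>2))" (is "_ < _ * ?S")
    by (rule interpolates_imp_subcritical_log_count[OF a M ud])
  have c: "ln (real (j + 1) / real j) \<ge> 0" if "j \<in> {1..<n}" for j using that by simp
  have "0 \<le> (\<Sum>j=1..<n. ln (real (j + 1) / real j) * real (card (X \<inter> cball 0 ((real j - 1) * h))))"
    using c by (intro sum_nonneg mult_nonneg_nonneg) auto
  then have A0: "A \<ge> 0" using count[rule_format, of 0] by linarith
  have S: "?S > 0" proof -
    have "0 < a / pi * ?S" using A A0 by linarith
    then show ?thesis using a by (subst (asm) zero_less_mult_iff) (auto simp: zero_less_divide_iff divide_less_0_iff)
  qed
  \<comment> \<open>Any \<open>\<tau> > 0\<close> with \<open>A * (1 + \<tau>) < a / pi * ?S\<close> would do.\<close>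
  define \<tau> where "\<tau> = (a / pi * ?S - A) / (2 * (A + 1))"
  have \<tau>: "\<tau> > 0" using A A0 by (simp add: \<tau>_def)
  have "A * \<tau> \<le> (A + 1) * \<tau>" using \<tau> by (intro mult_right_mono) auto
  also have "\<dots> = (a / pi * ?S - A) / 2" 
  proof -
    have "(A + 1) * (x / (2 * (A + 1))) = x / 2" for x using A0 by (simp add: divide_simps)
    then show ?thesis unfolding \<tau>_def .
  qed
  also have "\<dots> < a / pi * ?S - A"
  proof -
    have "x / 2 < x" if "x > 0" for x :: real using that by simp
    moreover have "a / pi * ?S - A > 0" using A by (simp only: diff_gt_0_iff_gt)
    ultimately show ?thesis .
  qed
  finally have "A * (1 + \<tau>) / ?S < a / pi" using S by (subst pos_divide_less_eq) (auto simp: algebra_simps)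
  then have "ereal (A * (1 + \<tau>) / ?S) < ereal (a / pi)" by simp
  moreover have "upper_uniform_density I X \<le> ereal (A * (1 + \<tau>) / ?S)"
    by (rule upper_uniform_density_le_of_count[OF ud I _ _ _ count[rule_format] S \<tau>]) (use c h in auto)
  ultimately show "upper_uniform_density I X < ereal (a / pi)"
    by (rule le_less_trans[rotated])
qed

section \<open>A theta function with lattice zeros\<close>

text \<open>The terms of the Jacobi theta function for the lattice of Gaussian integers (nome \<open>e\<^bsup>-\<pi>\<^esup>\<close>).\<close>

definition theta_term :: "int \<Rightarrow> complex \<Rightarrow> complex" where
  "theta_term n z = exp (- of_real pi * of_int n ^ 2 + 2 * of_real pi * \<i> * of_int n * z)"

definition theta :: "complex \<Rightarrow> complex" where
  "theta z = (\<Sum>\<^sub>\<infinity>n. theta_term n z)"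

lemma summable_on_geometric_int:
  assumes "0 \<le> q" "q < 1"
  shows "(\<lambda>n::int. q ^ nat \<bar>n\<bar> :: real) summable_on UNIV"
proof -
  have geo: "(\<lambda>n::nat. q ^ (n + k)) summable_on UNIV" for k
    using assms by (intro norm_summable_imp_summable_on) (simp add: power_add norm_mult norm_power summable_mult2)
  have "(\<lambda>n::int. q ^ nat \<bar>n\<bar>) summable_on range int"
    using geo[of 0] by (subst summable_on_reindex) (auto simp: o_def)
  moreover have "(\<lambda>n::int. q ^ nat \<bar>n\<bar>) summable_on range (\<lambda>n. - int (Suc n))"
    using geo[of 1] by (subst summable_on_reindex) (auto simp: o_def inj_on_def nat_add_distrib)
  moreover have "range int \<inter> range (\<lambda>n. - int (Suc n)) = {}" by auto
  ultimately have "(\<lambda>n::int. q ^ nat \<bar>n\<bar>) summable_on (range int \<union> range (\<lambda>n. - int (Suc n)))"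
    by (rule summable_on_Un_disjoint)
  moreover have "range int \<union> range (\<lambda>n. - int (Suc n)) = UNIV"
  proof -
    have "z \<in> range int \<union> range (\<lambda>n. - int (Suc n))" for z by (cases z) auto
    then show ?thesis by blast
  qed
  ultimately show ?thesis by simp
qed

lemma cmod_theta_term: "cmod (theta_term n z) = exp (- pi * (of_int n)\<^sup>2 - 2 * pi * of_int n * Im z)"
  by (simp add: theta_term_def norm_exp_eq_Re power2_eq_square)

lemma cmod_theta_term_le:
  assumes "cmod z \<le> R"
  shows "cmod (theta_term n z) \<le> exp (pi * (R + 1/2)\<^sup>2) * exp (- pi) ^ nat \<bar>n\<bar>"
proof -
  have "- (of_int n * Im z) \<le> \<bar>of_int n\<bar> * \<bar>Im z\<bar>" by (metis abs_ge_minus_self abs_mult)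
  also have "\<dots> \<le> \<bar>of_int n\<bar> * R"
    using assms abs_Im_le_cmod[of z] by (intro mult_left_mono) auto
  finally have 1: "- 2 * (of_int n * Im z) \<le> 2 * (\<bar>of_int n\<bar> * R)" by linarith
  have "0 \<le> (\<bar>of_int n\<bar> - (R + 1/2))\<^sup>2" by simp
  then have "- (of_int n)\<^sup>2 - 2 * (of_int n * Im z) \<le> (R + 1/2)\<^sup>2 - \<bar>of_int n\<bar>"
    using 1 by (simp add: power2_diff algebra_simps)
  then have "pi * (- (of_int n)\<^sup>2 - 2 * (of_int n * Im z)) \<le> pi * ((R + 1/2)\<^sup>2 - \<bar>of_int n\<bar>)"
    by (intro mult_left_mono) auto
  then have "cmod (theta_term n z) \<le> exp (pi * (R + 1/2)\<^sup>2 + real (nat \<bar>n\<bar>) * (- pi))"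
    by (simp add: cmod_theta_term algebra_simps)
  then show ?thesis by (simp only: exp_add exp_of_nat_mult)
qed

lemma theta_dominated: "(\<lambda>n::int. C * exp (- pi) ^ nat \<bar>n\<bar> :: real) summable_on UNIV"
  by (intro summable_on_cmult_right summable_on_geometric_int) auto

lemma theta_summable: "(\<lambda>n. theta_term n z) summable_on UNIV"
  by (rule abs_summable_summable, rule summable_on_comparison_test[OF theta_dominated])
     (use cmod_theta_term_le[of z "cmod z"] in auto)

lemma theta_holomorphic: "theta holomorphic_on UNIV"
proof -
  have "(\<lambda>z. \<Sum>\<^sub>\<infinity>n. theta_term n z) holomorphic_on UNIV"
  proof (rule entire_infsum)
    show "theta_term n holomorphic_on UNIV" for n
      unfolding theta_term_def by (intro holomorphic_intros)
    show "\<exists>b. b summable_on UNIV \<and> (\<forall>i\<in>UNIV. \<forall>z. cmod z \<le> R \<longrightarrow> cmod (theta_term i z) \<le> b i)" for R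
      by (intro exI[of _ "\<lambda>n. exp (pi * (R + 1/2)\<^sup>2) * exp (- pi) ^ nat \<bar>n\<bar>"] conjI theta_dominated ballI allI impI cmod_theta_term_le)
  qed
  then show ?thesis by (simp add: theta_def[abs_def])
qed

lemma exp_2pi_int: "exp (2 * of_real pi * \<i> * of_int n) = 1"
  using exp_integer_2pi[of "of_int n"] by (simp add: mult_ac)

lemma theta_plus_1: "theta (z + 1) = theta z"
proof -
  have "theta_term n (z + 1) = theta_term n z" for n
  proof -
    have "theta_term n (z + 1) = theta_term n z * exp (2 * of_real pi * \<i> * of_int n)"
      unfolding theta_term_def exp_add[symmetric] by (simp add: algebra_simps)
    then show ?thesis by (simp add: exp_2pi_int)
  qed
  then show ?thesis by (simp add: theta_def)
qed

lemma theta_reindex: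
  assumes "bij g" shows "(\<Sum>\<^sub>\<infinity>n. theta_term (g n) z) = theta z"
  unfolding theta_def using infsum_reindex_bij_betw[OF assms, of "\<lambda>n. theta_term n z"] .

lemma theta_plus_ii: "theta (z + \<i>) = exp (of_real pi - 2 * of_real pi * \<i> * z) * theta z"
proof -
  have "theta_term n (z + \<i>) = exp (of_real pi - 2 * of_real pi * \<i> * z) * theta_term (n + 1) z" for n
    unfolding theta_term_def exp_add[symmetric]
    by (rule arg_cong[where f = exp]) (simp add: power2_eq_square algebra_simps)
  then have "theta (z + \<i>) = (\<Sum>\<^sub>\<infinity>n. exp (of_real pi - 2 * of_real pi * \<i> * z) * theta_term (n + 1) z)"
    by (simp add: theta_def)
  also have "\<dots> = exp (of_real pi - 2 * of_real pi * \<i> * z) * (\<Sum>\<^sub>\<infinity>n. theta_term (n + 1) z)"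
    by (rule infsum_cmult_right')
  also have "(\<Sum>\<^sub>\<infinity>n. theta_term (n + 1) z) = theta z"
    by (rule theta_reindex) (rule bij_betw_byWitness[of _ "\<lambda>n. n - 1"], auto)
  finally show ?thesis .
qed

text \<open>The terms with indices \<open>n\<close> and \<open>-1 - n\<close> cancel.\<close>

lemma theta_zero: "theta ((1 + \<i>) / 2) = 0"
proof -
  have "theta_term (- 1 - n) ((1 + \<i>) / 2) = (-1) * theta_term n ((1 + \<i>) / 2)" for n
  proof -
    have "theta_term (- 1 - n) ((1 + \<i>) / 2)
        = theta_term n ((1 + \<i>) / 2) * exp (2 * of_real pi * \<i> * of_int (- n)) * exp (- (of_real pi * \<i>))"
      unfolding theta_term_def exp_add[symmetric]
      by (rule arg_cong[where f = exp]) (simp add: power2_eq_square field_simps)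
    also have "exp (- (of_real pi * \<i>)) = -1" by (simp add: exp_minus)
    finally show ?thesis unfolding exp_2pi_int by simp
  qed
  then have "(\<Sum>\<^sub>\<infinity>n. theta_term (- 1 - n) ((1 + \<i>) / 2)) = (\<Sum>\<^sub>\<infinity>n. (-1) * theta_term n ((1 + \<i>) / 2))" by simp
  also have "\<dots> = - theta ((1 + \<i>) / 2)" unfolding infsum_cmult_right' theta_def by simp
  also have "(\<Sum>\<^sub>\<infinity>n. theta_term (- 1 - n) ((1 + \<i>) / 2)) = theta ((1 + \<i>) / 2)"
    by (rule theta_reindex) (rule bij_betw_byWitness[of _ "\<lambda>n. - 1 - n"], auto)
  finally show ?thesis by simp
qed

lemma theta_0_nonzero: "theta 0 \<noteq> 0"
proof -
  define e where "e n = exp (- pi * (of_int n)\<^sup>2)" for n :: int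
  have t: "theta_term n 0 = of_real (e n)" for n
    by (simp add: theta_term_def e_def exp_of_real[symmetric])
  have summ: "e summable_on UNIV"
    using theta_summable[of 0] summable_on_Re[of "\<lambda>n. theta_term n 0"] by (simp add: t)
  have "sum e {0} \<le> (\<Sum>\<^sub>\<infinity>n. e n)"
    by (rule finite_sum_le_infsum[OF summ]) (auto simp: e_def)
  then have "(\<Sum>\<^sub>\<infinity>n. e n) \<noteq> 0" by (auto simp: e_def)
  moreover have "Re (theta 0) = (\<Sum>\<^sub>\<infinity>n. e n)"
    unfolding theta_def using infsum_Re[OF theta_summable[of 0]] by (simp add: t)
  ultimately show ?thesis by auto
qed

text \<open>The factor \<open>e\<^bsup>\<pi>z\<^sup>2/2\<^esup>\<close> turns the growth \<open>e\<^bsup>\<pi> (Im z)\<^sup>2\<^esup>\<close> of the theta function into the isotropic growth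
  \<open>e\<^bsup>\<pi>|z|\<^sup>2/2\<^esup>\<close>, as for the Weierstrass sigma function of the lattice.\<close>

definition sigma_like :: "complex \<Rightarrow> complex" where
  "sigma_like z = exp (of_real pi * z\<^sup>2 / 2) * theta z"

lemma cmod_weighted_sigma_like:
  "cmod (weighted pi sigma_like z) = exp (- pi * (Im z)\<^sup>2) * cmod (theta z)"
proof -
  have "Re (of_real pi * z\<^sup>2 / 2) = pi * ((Re z)\<^sup>2 - (Im z)\<^sup>2) / 2"
    by (simp add: power2_eq_square)
  then show ?thesis
    unfolding cmod_weighted sigma_like_def norm_mult norm_exp_eq_Re mult.assoc[symmetric] exp_add[symmetric]
    by (simp add: cmod_power2 field_simps)
qed

lemma lattice_periodic:
  fixes W :: "complex \<Rightarrow> real"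
  assumes "\<And>z. W (z + 1) = W z" "\<And>z. W (z + \<i>) = W z"
  shows "W (z + of_int m + of_int n * \<i>) = W z"
proof -
  have *: "W (z + of_int k * c) = W z" if c: "\<And>z. W (z + c) = W z" for z c and k :: int
  proof (induction k rule: int_induct[where k = 0])
    case (step1 i)
    then show ?case using c[of "z + of_int i * c"] by (simp add: algebra_simps)
  next
    case (step2 i)
    then show ?case using c[of "z + of_int (i - 1) * c"] by (simp add: algebra_simps)
  qed simp
  show ?thesis using *[OF assms(2)] *[OF assms(1), of z m] by simp
qed

lemma sigma_like_periodic:
  "cmod (weighted pi sigma_like (z + of_int m + of_int n * \<i>)) = cmod (weighted pi sigma_like z)"
proof (rule lattice_periodic)
  show "cmod (weighted pi sigma_like (z + 1)) = cmod (weighted pi sigma_like z)" for z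
    by (simp add: cmod_weighted_sigma_like theta_plus_1)
  show "cmod (weighted pi sigma_like (z + \<i>)) = cmod (weighted pi sigma_like z)" for z
    unfolding cmod_weighted_sigma_like theta_plus_ii norm_mult norm_exp_eq_Re mult.assoc[symmetric] exp_add[symmetric]
    by (simp add: power2_eq_square algebra_simps)
qed

lemma sigma_like_holomorphic: "sigma_like holomorphic_on UNIV"
  unfolding sigma_like_def[abs_def] by (intro holomorphic_intros theta_holomorphic) simp

text \<open>By the quasi-periodicity of the theta function the weighted modulus is doubly periodic, hence bounded by its
  maximum on a compact set.\<close>

lemma sigma_like_bounded: "\<exists>C. sigma_like \<in> fock_ball pi C"
proof -
  have cont: "continuous_on UNIV (\<lambda>z. cmod (weighted pi sigma_like z))"
    unfolding cmod_weighted_sigma_like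
    by (intro continuous_intros holomorphic_on_imp_continuous_on[OF theta_holomorphic])
  have "compact ((\<lambda>z. cmod (weighted pi sigma_like z)) ` cball 0 2)"
    by (rule compact_continuous_image[OF continuous_on_subset[OF cont subset_UNIV] compact_cball])
  then have "bounded ((\<lambda>z. cmod (weighted pi sigma_like z)) ` cball 0 2)" by (rule compact_imp_bounded)
  then obtain C where "\<forall>x\<in>(\<lambda>z. cmod (weighted pi sigma_like z)) ` cball 0 2. norm x \<le> C"
    unfolding bounded_iff ..
  then have C: "cmod (weighted pi sigma_like z) \<le> C" if "cmod z \<le> 2" for z using that by simp
  have "cmod (weighted pi sigma_like z) \<le> C" for z
  proof -
    define w where "w = Complex (frac (Re z)) (frac (Im z))"
    have "z = w + of_int \<lfloor>Re z\<rfloor> + of_int \<lfloor>Im z\<rfloor> * \<i>"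
      by (simp add: complex_eq_iff w_def frac_def)
    then have "cmod (weighted pi sigma_like z) = cmod (weighted pi sigma_like w)"
      using sigma_like_periodic by metis
    moreover have "cmod w \<le> \<bar>Re w\<bar> + \<bar>Im w\<bar>" by (rule cmod_le)
    then have "cmod w \<le> 2" using frac_lt_1[of "Re z"] frac_lt_1[of "Im z"] by (simp add: w_def)
    ultimately show ?thesis using C by simp
  qed
  then show ?thesis by (intro exI[of _ C] fock_ballI sigma_like_holomorphic)
qed

lemma sigma_like_zero: "sigma_like (Complex (of_int m + 1/2) (of_int n + 1/2)) = 0"
proof -
  have "Complex (of_int m + 1/2) (of_int n + 1/2) = (1 + \<i>) / 2 + of_int m + of_int n * \<i>"
    by (simp add: complex_eq_iff)
  moreover have "sigma_like ((1 + \<i>) / 2) = 0" by (simp add: sigma_like_def theta_zero)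
  ultimately show ?thesis
    using sigma_like_periodic[of "(1 + \<i>) / 2" m n] weighted_eq_0_iff by (metis norm_eq_zero)
qed

lemma sigma_like_0_nonzero: "sigma_like 0 \<noteq> 0"
  by (simp add: sigma_like_def theta_0_nonzero)

section \<open>Interpolation on large discs\<close>

text \<open>Factors with \<open>d x < K\<close> are bounded individually; the others are at most \<open>e\<^bsup>s/K\<^esup>\<close>. If there are \<open>O(\<rho>\<^sup>2)\<close>
  factors, the exponent is an arbitrarily small multiple of \<open>\<rho>\<^sup>2\<close> for large \<open>K\<close>.\<close>

lemma prod_one_plus_inverse_le:
  fixes d :: "'i \<Rightarrow> real"
  assumes F: "finite F" and d: "\<And>x. x \<in> F \<Longrightarrow> d x \<ge> q" and q: "q > 0" and s: "s > 0" and K: "K > 0"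
  shows "(\<Prod>x\<in>F. 1 + s / d x) \<le> (1 + s / q) ^ card {x\<in>F. d x < K} * exp (real (card F) * (s / K))"
proof -
  let ?N = "{x\<in>F. d x < K}" and ?R = "{x\<in>F. \<not> d x < K}"
  have dpos: "d x > 0" if "x \<in> F" for x using d[OF that] q by simp
  have pos1: "0 \<le> 1 + s / d x" if "x \<in> F" for x
    using dpos[OF that] s by (intro add_nonneg_nonneg) auto
  have "F = ?N \<union> ?R" by auto
  then have "(\<Prod>x\<in>F. 1 + s / d x) = (\<Prod>x\<in>?N \<union> ?R. 1 + s / d x)" by simp
  also have "\<dots> = (\<Prod>x\<in>?N. 1 + s / d x) * (\<Prod>x\<in>?R. 1 + s / d x)"
    using F by (intro prod.union_disjoint) auto
  also have "\<dots> \<le> (1 + s / q) ^ card ?N * exp (real (card F) * (s / K))"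
  proof (intro mult_mono prod_nonneg ballI)
    have "(\<Prod>x\<in>?N. 1 + s / d x) \<le> (\<Prod>x\<in>?N. 1 + s / q)"
    proof (intro prod_mono conjI)
      fix x assume "x \<in> ?N"
      then have x: "x \<in> F" by simp
      then show "0 \<le> 1 + s / d x" using dpos[OF x] s by simp
      show "1 + s / d x \<le> 1 + s / q" using d[OF x] q s by (simp add: frac_le)
    qed
    then show "(\<Prod>x\<in>?N. 1 + s / d x) \<le> (1 + s / q) ^ card ?N" by simp
    have "(\<Prod>x\<in>?R. 1 + s / d x) \<le> (\<Prod>x\<in>?R. exp (s / K))"
    proof (intro prod_mono conjI)
      fix x assume x: "x \<in> ?R"
      then show "0 \<le> 1 + s / d x" using dpos[of x] s by simp
      have "s / d x \<le> s / K" using x s K by (intro divide_left_mono mult_pos_pos) auto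
      then show "1 + s / d x \<le> exp (s / K)" using exp_ge_add_one_self[of "s / K"] by linarith
    qed
    also have "\<dots> = exp (real (card ?R) * (s / K))" by (simp only: prod_constant exp_of_nat_mult)
    also have "\<dots> \<le> exp (real (card F) * (s / K))"
      using F s K by (auto intro!: mult_right_mono card_mono divide_right_mono)
    finally show "(\<Prod>x\<in>?R. 1 + s / d x) \<le> exp (real (card F) * (s / K))" .
    show "0 \<le> (1 + s / q) ^ card ?N" using s q by (intro zero_le_power add_nonneg_nonneg) auto
  qed (use pos1 in auto)
  finally show ?thesis .
qed

lemma norm_ratio_le:
  fixes z x y :: complex
  assumes "cmod (x - y) \<le> s" "z \<noteq> y"
  shows "cmod (z - x) / cmod (z - y) \<le> 1 + s / cmod (z - y)"
proof -
  have "cmod (z - x) \<le> cmod (z - y) + cmod (x - y)" using norm_triangle_ineq4[of "z - y" "x - y"] by simp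
  then have "cmod (z - x) \<le> cmod (z - y) + s" using assms by linarith
  then have "cmod (z - x) / cmod (z - y) \<le> (cmod (z - y) + s) / cmod (z - y)" by (intro divide_right_mono) auto
  then show ?thesis using assms by (simp add: add_divide_distrib)
qed

text \<open>Each zero \<open>l x\<close> of \<open>E\<close> is moved to \<open>x\<close> by the factor \<open>(z - x) / (z - l x)\<close>, of modulus at most
  \<open>1 + s / |z - l x|\<close>; at \<open>0\<close> its inverse is at most \<open>1 + s / |x|\<close>, which bounds the normalizing
  constant. Points within distance \<open>1\<close> of some \<open>l x\<close> are reached by the maximum principle from
  the circle of radius \<open>2\<close>, which avoids all the unit discs about the zeros because \<open>s \<ge> 4\<close>.\<close>

lemma relocate_zeros:
  fixes E :: "complex \<Rightarrow> complex" and l :: "complex \<Rightarrow> complex"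
  assumes b: "b > 0" and E: "E \<in> fock_ball b C" "E 0 \<noteq> 0" and F: "finite F" and inj: "inj_on l F"
    and s: "s \<ge> 4" and zero: "\<And>x. x \<in> F \<Longrightarrow> E (l x) = 0"
    and near: "\<And>x. x \<in> F \<Longrightarrow> cmod (x - l x) \<le> s"
    and sep: "\<And>x y. x \<in> F \<Longrightarrow> y \<in> F \<Longrightarrow> l x \<noteq> l y \<Longrightarrow> cmod (l x - l y) \<ge> s"
    and q: "0 < q" "q \<le> 1" "\<And>x. x \<in> F \<Longrightarrow> cmod x \<ge> q"
    and N: "real (card F) \<le> N0" and K: "K > 0"
    and cnt: "\<And>z. card {x\<in>F. cmod (z - l x) < K} \<le> n" "card {x\<in>F. cmod x < K} \<le> n"
  defines "P \<equiv> (1 + s / q) ^ n * exp (N0 * (s / K))"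
  shows "\<exists>g. g \<in> fock_ball b (exp (2 * b) * C * P * P / cmod (E 0)) \<and> g 0 = 1 \<and> (\<forall>x\<in>F. g x = 0)"
proof -
  have s0: "s > 0" using s by simp
  have E_hol: "E holomorphic_on UNIV" using fock_ballD[OF E(1)] by simp
  have C: "C \<ge> 0" using fock_ballD(3)[OF E(1)] .
  have "\<exists>h. h holomorphic_on UNIV \<and> (\<forall>z. E z = (\<Prod>\<zeta>\<in>l ` F. z - \<zeta>) * h z)"
    by (rule entire_factor_zeros) (use F E_hol zero in auto)
  then obtain h where h: "h holomorphic_on UNIV" "\<And>z. E z = (\<Prod>\<zeta>\<in>l ` F. z - \<zeta>) * h z" by auto
  have Eh: "E z = (\<Prod>x\<in>F. z - l x) * h z" for z
    unfolding h(2) using inj by (subst prod.reindex) (auto simp: o_def)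
  define g where "g z = (\<Prod>x\<in>F. z - x) * h z" for z
  have g_hol: "g holomorphic_on UNIV" unfolding g_def using h(1) by (intro holomorphic_intros)
  have exp_le: "(1 + s / q') ^ k * exp (real (card F) * (s / K)) \<le> P" if "q \<le> q'" "k \<le> n" for q' k
  proof -
    have "(1 + s / q') ^ k \<le> (1 + s / q) ^ k" using that q s by (intro power_mono add_left_mono frac_le) auto
    also have "\<dots> \<le> (1 + s / q) ^ n" using that q s by (intro power_increasing) auto
    finally have "(1 + s / q') ^ k \<le> (1 + s / q) ^ n" .
    moreover have "0 \<le> (1 + s / q) ^ n" using s q by (intro zero_le_power add_nonneg_nonneg) auto
    ultimately show ?thesis unfolding P_def using N s K
      by (intro mult_mono) (auto intro!: mult_right_mono divide_right_mono)
  qed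
  have P: "P > 0" using q s by (auto simp: P_def intro!: mult_pos_pos zero_less_power add_pos_pos)
  have far: "cmod (weighted b g z) \<le> C * P" if z: "\<And>x. x \<in> F \<Longrightarrow> cmod (z - l x) \<ge> 1" for z
  proof -
    have nz: "z \<noteq> l x" if "x \<in> F" for x using z[OF that] by auto
    have "cmod (g z) = cmod (E z) * (\<Prod>x\<in>F. cmod (z - x) / cmod (z - l x))"
      using nz F by (simp add: g_def Eh norm_mult prod_norm[symmetric] prod_dividef prod_zero_iff)
    also have "\<dots> \<le> cmod (E z) * P"
    proof (intro mult_left_mono)
      have "(\<Prod>x\<in>F. cmod (z - x) / cmod (z - l x)) \<le> (\<Prod>x\<in>F. 1 + s / cmod (z - l x))"
        using near nz by (intro prod_mono) (auto intro: norm_ratio_le)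
      also have "\<dots> \<le> (1 + s / 1) ^ card {x\<in>F. cmod (z - l x) < K} * exp (real (card F) * (s / K))"
        using z s0 K by (intro prod_one_plus_inverse_le F) auto
      also have "\<dots> \<le> P" using q cnt by (intro exp_le) auto
      finally show "(\<Prod>x\<in>F. cmod (z - x) / cmod (z - l x)) \<le> P" .
    qed auto
    finally have "cmod (weighted b g z) \<le> cmod (weighted b E z) * P"
      unfolding cmod_weighted mult.assoc by (intro mult_left_mono) auto
    also have "\<dots> \<le> C * P" using fock_ballD(2)[OF E(1), of z] P by (intro mult_right_mono) auto
    finally show ?thesis .
  qed
  have all: "cmod (weighted b g z) \<le> exp (2 * b) * (C * P)" for z
  proof (cases "\<forall>x\<in>F. cmod (z - l x) \<ge> 1")
    case True
    then have "cmod (weighted b g z) \<le> 1 * (C * P)" using far by simp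
    also have "\<dots> \<le> exp (2 * b) * (C * P)" using b C P by (intro mult_right_mono) auto
    finally show ?thesis .
  next
    case False
    then obtain y where y: "y \<in> F" "cmod (z - l y) < 1" by auto
    have "cmod (weighted b g z) * (\<Prod>\<zeta>\<in>{}. 2 / cmod (\<zeta> - z)) \<le> (C * P) * exp (b * 2\<^sup>2 / 2)"
    proof (rule weighted_blaschke_bound[OF _ g_hol])
      fix \<zeta> assume \<zeta>: "cmod (\<zeta> - z) = 2"
      show "cmod (weighted b g \<zeta>) \<le> C * P"
      proof (rule far)
        fix x assume x: "x \<in> F"
        show "1 \<le> cmod (\<zeta> - l x)"
        proof (cases "l x = l y")
          case True
          have "cmod (\<zeta> - z) \<le> cmod (\<zeta> - l y) + cmod (z - l y)"
            using norm_triangle_ineq4[of "\<zeta> - l y" "z - l y"] by simp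
          then show ?thesis using \<zeta> y True by simp
        next
          case False
          have "cmod (l x - l y) \<ge> 4" using sep[OF x y(1) False] s by simp
          moreover have "cmod (l x - l y) \<le> cmod (z - l y) + cmod (\<zeta> - z) + cmod (\<zeta> - l x)"
          proof -
            have "l x - l y = (z - l y) + (\<zeta> - z) - (\<zeta> - l x)" by simp
            then show ?thesis
              using norm_triangle_ineq4[of "(z - l y) + (\<zeta> - z)" "\<zeta> - l x"] norm_triangle_ineq[of "z - l y" "\<zeta> - z"] by simp
          qed
          ultimately show ?thesis using \<zeta> y by simp
        qed
      qed
    qed auto
    then show ?thesis by (simp add: mult.commute mult.left_commute)
  qed
  have low: "cmod (E 0) \<le> cmod (g 0) * P"
  proof -
    have nz: "x \<noteq> 0" if "x \<in> F" for x using q(3)[OF that] q(1) by auto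
    have "cmod (E 0) = cmod (g 0) * (\<Prod>x\<in>F. cmod (0 - l x) / cmod (0 - x))"
      using nz F by (simp add: g_def Eh norm_mult prod_norm[symmetric] prod_dividef prod_zero_iff)
    also have "\<dots> \<le> cmod (g 0) * P"
    proof (intro mult_left_mono)
      have "(\<Prod>x\<in>F. cmod (0 - l x) / cmod (0 - x)) \<le> (\<Prod>x\<in>F. 1 + s / cmod (0 - x))"
        using near nz by (intro prod_mono conjI norm_ratio_le) (auto simp: norm_minus_commute)
      also have "\<dots> \<le> (1 + s / q) ^ card {x\<in>F. cmod (0 - x) < K} * exp (real (card F) * (s / K))"
        using q s0 K by (intro prod_one_plus_inverse_le F) auto
      also have "\<dots> \<le> P" using q cnt(2) by (intro exp_le) auto
      finally show "(\<Prod>x\<in>F. cmod (0 - l x) / cmod (0 - x)) \<le> P" .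
    qed auto
    finally show ?thesis .
  qed
  have g0: "g 0 \<noteq> 0" using low E(2) by auto
  define G where "G z = inverse (g 0) * g z" for z
  have "g \<in> fock_ball b (exp (2 * b) * (C * P))" using g_hol all by (rule fock_ballI)
  then have "G \<in> fock_ball b (cmod (inverse (g 0)) * (exp (2 * b) * (C * P)))"
    unfolding G_def by (rule fock_ball_scale)
  moreover have "cmod (inverse (g 0)) \<le> P / cmod (E 0)"
  proof -
    have "cmod (g 0) > 0" "cmod (E 0) > 0" using g0 E(2) by auto
    then show ?thesis unfolding norm_inverse using low by (simp add: divide_simps mult.commute)
  qed
  then have "cmod (inverse (g 0)) * (exp (2 * b) * (C * P)) \<le> P / cmod (E 0) * (exp (2 * b) * (C * P))"
    using C P by (intro mult_right_mono) auto
  then have "cmod (inverse (g 0)) * (exp (2 * b) * (C * P)) \<le> exp (2 * b) * C * P * P / cmod (E 0)"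
    by (simp add: mult_ac)
  ultimately have "G \<in> fock_ball b (exp (2 * b) * C * P * P / cmod (E 0))" by (rule fock_ball_mono)
  moreover have "G x = 0" if "x \<in> F" for x using that F by (auto simp: G_def g_def)
  moreover have "G 0 = 1" using g0 by (simp add: G_def)
  ultimately show ?thesis by (intro exI[of _ G] conjI ballI)
qed

lemma fock_ball_prod:
  assumes "finite A" "\<And>i. i \<in> A \<Longrightarrow> g i \<in> fock_ball b D"
  shows "(\<lambda>z. \<Prod>i\<in>A. g i z) \<in> fock_ball (real (card A) * b) (D ^ card A)"
proof (rule fock_ballI)
  show "(\<lambda>z. \<Prod>i\<in>A. g i z) holomorphic_on UNIV"
    using assms(2) by (intro holomorphic_intros) (auto dest: fock_ballD)
  fix z
  have "cmod (weighted (real (card A) * b) (\<lambda>z. \<Prod>i\<in>A. g i z) z) = (\<Prod>i\<in>A. cmod (weighted b (g i) z))"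
  proof -
    have "- (real (card A) * b) * (cmod z)\<^sup>2 / 2 = real (card A) * (- b * (cmod z)\<^sup>2 / 2)" by simp
    then have "exp (- (real (card A) * b) * (cmod z)\<^sup>2 / 2) = exp (- b * (cmod z)\<^sup>2 / 2) ^ card A"
      by (simp only: exp_of_nat_mult)
    then show ?thesis by (simp add: cmod_weighted prod_norm[symmetric] prod.distrib)
  qed
  also have "\<dots> \<le> (\<Prod>i\<in>A. D)" using assms(2) by (intro prod_mono) (auto dest: fock_ballD)
  finally show "cmod (weighted (real (card A) * b) (\<lambda>z. \<Prod>i\<in>A. g i z) z) \<le> D ^ card A" by simp
qed

lemma fock_ball_dilate:
  assumes f: "f \<in> fock_ball c C" and s: "s > 0"
  shows "(\<lambda>z. f (z / of_real s)) \<in> fock_ball (c / s\<^sup>2) C"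
proof (rule fock_ballI)
  have "(f \<circ> (\<lambda>z. z / of_real s)) holomorphic_on UNIV"
    using s by (intro holomorphic_on_compose holomorphic_intros holomorphic_on_subset[OF fock_ballD(1)[OF f]]) auto
  then show "(\<lambda>z. f (z / of_real s)) holomorphic_on UNIV" by (simp add: o_def)
  fix z
  have "cmod (weighted (c / s\<^sup>2) (\<lambda>z. f (z / of_real s)) z) = cmod (weighted c f (z / of_real s))"
    using s by (simp add: cmod_weighted norm_divide power_divide)
  then show "cmod (weighted (c / s\<^sup>2) (\<lambda>z. f (z / of_real s)) z) \<le> C" using fock_ballD(2)[OF f] by simp
qed

definition cell_index :: "real \<Rightarrow> complex \<Rightarrow> int \<times> int" where
  "cell_index s z = (\<lfloor>Re z / s\<rfloor>, \<lfloor>Im z / s\<rfloor>)"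

text \<open>The grid is placed so that \<open>0\<close> is a corner of cells and not a centre: the zeros of \<open>E\<close> are at the centres,
  and \<open>E\<close> must not vanish at the point where the interpolating function is normalized.\<close>

definition cell_centre :: "real \<Rightarrow> int \<times> int \<Rightarrow> complex" where
  "cell_centre s c = Complex (s * (of_int (fst c) + 1/2)) (s * (of_int (snd c) + 1/2))"

lemma cell_centre_near:
  assumes "s > 0" shows "cmod (z - cell_centre s (cell_index s z)) \<le> s"
proof -
  have *: "\<bar>x - s * (of_int \<lfloor>x / s\<rfloor> + 1/2)\<bar> \<le> s / 2" for x
  proof -
    have "of_int \<lfloor>x / s\<rfloor> \<le> x / s" "x / s \<le> of_int \<lfloor>x / s\<rfloor> + 1" by linarith+
    then have "of_int \<lfloor>x / s\<rfloor> * s \<le> x" "x \<le> (of_int \<lfloor>x / s\<rfloor> + 1) * s"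
      using assms by (simp_all only: pos_le_divide_eq pos_divide_le_eq)
    then have "of_int \<lfloor>x / s\<rfloor> * s \<le> x" "x \<le> of_int \<lfloor>x / s\<rfloor> * s + s" by (simp_all add: algebra_simps)
    moreover have "s * (of_int \<lfloor>x / s\<rfloor> + 1/2) = of_int \<lfloor>x / s\<rfloor> * s + s / 2" by (simp add: algebra_simps)
    ultimately show ?thesis by linarith
  qed
  have "cmod (z - cell_centre s (cell_index s z)) \<le> \<bar>Re (z - cell_centre s (cell_index s z))\<bar> + \<bar>Im (z - cell_centre s (cell_index s z))\<bar>"
    by (rule cmod_le)
  then show ?thesis using *[of "Re z"] *[of "Im z"] by (simp add: cell_centre_def cell_index_def)
qed

lemma cell_centre_sep:
  assumes "s > 0" "c \<noteq> d" shows "cmod (cell_centre s c - cell_centre s d) \<ge> s"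
proof -
  have *: "\<bar>s * (of_int i + 1/2) - s * (of_int j + 1/2)\<bar> \<ge> s" if "i \<noteq> j" for i j :: int
  proof -
    have "\<bar>i - j\<bar> \<ge> 1" using that by linarith
    then have "\<bar>of_int i - of_int j\<bar> \<ge> (1::real)" by (metis of_int_1_le_iff of_int_abs of_int_diff)
    then have "s * \<bar>of_int i - of_int j\<bar> \<ge> s * 1" using assms by (intro mult_left_mono) auto
    moreover have "s * (of_int i + 1/2) - s * (of_int j + 1/2) = s * (of_int i - of_int j)" by (simp add: algebra_simps)
    ultimately show ?thesis using assms by (simp add: abs_mult)
  qed
  have "fst c \<noteq> fst d \<or> snd c \<noteq> snd d" using assms by (auto simp: prod_eq_iff)
  then show ?thesis
  proof
    assume "fst c \<noteq> fst d"
    then have "s \<le> \<bar>Re (cell_centre s c - cell_centre s d)\<bar>" using * by (simp add: cell_centre_def)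
    then show ?thesis using abs_Re_le_cmod order_trans by blast
  next
    assume "snd c \<noteq> snd d"
    then have "s \<le> \<bar>Im (cell_centre s c - cell_centre s d)\<bar>" using * by (simp add: cell_centre_def)
    then show ?thesis using abs_Im_le_cmod order_trans by blast
  qed
qed

lemma cell_centre_zero: "s > 0 \<Longrightarrow> sigma_like (cell_centre s c / of_real s) = 0"
proof -
  assume "s > 0"
  then have "cell_centre s c / of_real s = Complex (of_int (fst c) + 1/2) (of_int (snd c) + 1/2)"
    by (simp add: cell_centre_def complex_eq_iff)
  then show ?thesis by (simp add: sigma_like_zero)
qed

text \<open>Number the at most \<open>N\<close> elements of each fibre of \<open>\<kappa>\<close>; a layer consists of the elements with the same number.\<close>

lemma split_into_layers:
  fixes \<kappa> :: "'a \<Rightarrow> 'b"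
  assumes X: "finite X" and N: "\<And>c. card {x\<in>X. \<kappa> x = c} \<le> N"
  obtains \<iota> :: "'a \<Rightarrow> nat" where "\<And>x. x \<in> X \<Longrightarrow> \<iota> x < N" "\<And>k. inj_on \<kappa> {x\<in>X. \<iota> x = k}"
proof -
  have "\<exists>f. inj_on f {x\<in>X. \<kappa> x = c} \<and> f ` {x\<in>X. \<kappa> x = c} \<subseteq> {..<N}" for c
    using card_le_inj[of "{x\<in>X. \<kappa> x = c}" "{..<N}"] X N[of c] by auto
  then obtain f where f: "\<And>c. inj_on (f c) {x\<in>X. \<kappa> x = c}" "\<And>c. f c ` {x\<in>X. \<kappa> x = c} \<subseteq> {..<N}"
    by metis
  show ?thesis
  proof
    show "f (\<kappa> x) x < N" if "x \<in> X" for x using f(2)[of "\<kappa> x"] that by auto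
    show "inj_on \<kappa> {x\<in>X. f (\<kappa> x) x = k}" for k
    proof (rule inj_onI)
      fix x y assume xy: "x \<in> {x\<in>X. f (\<kappa> x) x = k}" "y \<in> {x\<in>X. f (\<kappa> x) x = k}" "\<kappa> x = \<kappa> y"
      then have "f (\<kappa> x) x = f (\<kappa> x) y" by simp
      then show "x = y" by (rule inj_onD[OF f(1)[of "\<kappa> x"]]) (use xy in simp_all)
    qed
  qed
qed

text \<open>The product over \<open>N\<close> layers of the functions from \<open>relocate_zeros\<close>, applied to the dilated
  \<open>sigma_like\<close>. What matters is that \<open>A\<close> is independent of \<open>\<rho>\<close> and \<open>X\<close> and that the coefficient of \<open>\<rho>\<^sup>2\<close> in the
  exponent is \<open>O(1 / K)\<close>.\<close>

lemma local_interpolant: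
  assumes q: "0 < q" "q \<le> 1" and s: "s \<ge> 4" and K: "K > 0"
  shows "\<exists>A>0. \<forall>\<rho>\<ge>1. \<forall>X. finite X \<longrightarrow> X \<subseteq> cball 0 \<rho> \<longrightarrow> (\<forall>x\<in>X. cmod x \<ge> q) \<longrightarrow>
    (\<forall>x\<in>X. \<forall>y\<in>X. dist x y < q \<longrightarrow> x = y) \<longrightarrow> (\<forall>c. card {x\<in>X. cell_index s x = c} \<le> N) \<longrightarrow>
    (\<exists>g\<in>fock_ball (real N * (pi / s\<^sup>2)) (A * exp (2 * real N * (9 / q\<^sup>2 * s) * \<rho>\<^sup>2 / K)). g 0 = 1 \<and> (\<forall>x\<in>X. g x = 0))"
proof -
  obtain C where C: "sigma_like \<in> fock_ball pi C" using sigma_like_bounded by blast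
  define E where "E z = sigma_like (z / of_real s)" for z
  define b where "b = pi / s\<^sup>2"
  have s0: "s > 0" using s by simp
  have b: "b > 0" using s0 by (simp add: b_def)
  have E: "E \<in> fock_ball b C" unfolding E_def b_def by (rule fock_ball_dilate[OF C s0])
  have E0: "E 0 \<noteq> 0" by (simp add: E_def sigma_like_0_nonzero)
  define n where "n = nat \<lceil>(1 + 2 * (K + s) / q)\<^sup>2\<rceil>"
  define A1 where "A1 = exp (2 * b) * C * (1 + s / q) ^ n * (1 + s / q) ^ n / cmod (E 0)"
  define A where "A = A1 ^ N + 1"
  have A1: "A1 \<ge> 0" using fock_ballD(3)[OF C] s0 q by (simp add: A1_def)
  have "\<exists>g\<in>fock_ball (real N * (pi / s\<^sup>2)) (A * exp (2 * real N * (9 / q\<^sup>2 * s) * \<rho>\<^sup>2 / K)). g 0 = 1 \<and> (\<forall>x\<in>X. g x = 0)"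
    if \<rho>: "\<rho> \<ge> 1" and X: "finite X" "X \<subseteq> cball 0 \<rho>" and Xq: "\<forall>x\<in>X. cmod x \<ge> q"
      and sep: "\<forall>x\<in>X. \<forall>y\<in>X. dist x y < q \<longrightarrow> x = y" and N: "\<forall>c. card {x\<in>X. cell_index s x = c} \<le> N" for \<rho> X
  proof -
    obtain \<iota> :: "complex \<Rightarrow> nat" where \<iota>: "\<forall>x\<in>X. \<iota> x < N" "\<forall>k. inj_on (cell_index s) {x\<in>X. \<iota> x = k}"
      using split_into_layers[OF X(1), of "cell_index s" N] N by metis
    define D where "D = A1 * exp (2 * (9 / q\<^sup>2 * s) * \<rho>\<^sup>2 / K)"
    \<comment> \<open>A bound for the number of points in the disc of radius \<open>\<rho>\<close>; \<open>n\<close> bounds the number in discs of radius \<open>K + s\<close>.\<close>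
    define N0 where "N0 = 9 / q\<^sup>2 * \<rho>\<^sup>2"
    have cnt: "card Y \<le> n" if Y: "Y \<subseteq> X" "Y \<subseteq> cball z (K + s)" for Y z
    proof -
      have "real (card Y) \<le> (1 + 2 * (K + s) / q)\<^sup>2"
        using Y sep K s0 q finite_subset[OF Y(1) X(1)] by (intro card_disc_le[where w = z]) auto
      then show ?thesis unfolding n_def by linarith
    qed
    have "\<exists>g. g \<in> fock_ball b D \<and> g 0 = 1 \<and> (\<forall>x\<in>{x\<in>X. \<iota> x = k}. g x = 0)" for k
    proof -
      let ?F = "{x\<in>X. \<iota> x = k}" and ?l = "\<lambda>x. cell_centre s (cell_index s x)"
      have F: "finite ?F" using X by simp
      have "real (card ?F) \<le> (1 + 2 * \<rho> / q)\<^sup>2"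
        using X sep \<rho> q F by (intro card_disc_le[where w = 0]) auto
      also have "\<dots> \<le> (3 * \<rho> / q)\<^sup>2"
      proof (intro power_mono)
        show "1 + 2 * \<rho> / q \<le> 3 * \<rho> / q" using \<rho> q by (simp add: divide_simps)
      qed (use \<rho> q in auto)
      also have "\<dots> = N0" by (simp add: N0_def power_mult_distrib power_divide)
      finally have cardF: "real (card ?F) \<le> N0" .
      have inj: "inj_on ?l ?F"
      proof (rule inj_onI)
        fix x y assume xy: "x \<in> ?F" "y \<in> ?F" and eq: "?l x = ?l y"
        have "cell_index s x = cell_index s y" using eq cell_centre_sep[OF s0, of "cell_index s x" "cell_index s y"] s0 by auto
        then show "x = y" by (rule inj_onD[OF spec[OF \<iota>(2)] _ xy])
      qed
      have "\<exists>g. g \<in> fock_ball b (exp (2 * b) * C * ((1 + s / q) ^ n * exp (N0 * (s / K))) * ((1 + s / q) ^ n * exp (N0 * (s / K))) / cmod (E 0))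
          \<and> g 0 = 1 \<and> (\<forall>x\<in>?F. g x = 0)"
      proof (rule relocate_zeros[OF b E E0 F inj s])
        show "E (?l x) = 0" for x unfolding E_def by (rule cell_centre_zero[OF s0])
        show "cmod (x - ?l x) \<le> s" for x by (rule cell_centre_near[OF s0])
        show "s \<le> cmod (?l x - ?l y)" if "?l x \<noteq> ?l y" for x y
          by (rule cell_centre_sep[OF s0]) (use that in auto)
        show "card {x\<in>?F. cmod (z - ?l x) < K} \<le> n" for z
        proof (rule cnt[of _ z])
          show "{x\<in>?F. cmod (z - ?l x) < K} \<subseteq> cball z (K + s)"
          proof
            fix x assume "x \<in> {x\<in>?F. cmod (z - ?l x) < K}"
            then have "cmod (z - ?l x) < K" by simp
            moreover have "cmod (z - x) \<le> cmod (z - ?l x) + cmod (x - ?l x)"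
              using norm_triangle_ineq4[of "z - ?l x" "x - ?l x"] by simp
            ultimately show "x \<in> cball z (K + s)" using cell_centre_near[OF s0, of x] by (simp add: dist_norm)
          qed
        qed auto
        show "card {x\<in>?F. cmod x < K} \<le> n" using s0 by (intro cnt[of _ 0]) auto
      qed (use q Xq cardF K in auto)
      moreover have "exp (2 * b) * C * ((1 + s / q) ^ n * exp (N0 * (s / K))) * ((1 + s / q) ^ n * exp (N0 * (s / K))) / cmod (E 0)
        = A1 * (exp (N0 * (s / K)) * exp (N0 * (s / K)))" by (simp add: A1_def)
      also have "exp (N0 * (s / K)) * exp (N0 * (s / K)) = exp (2 * (9 / q\<^sup>2 * s) * \<rho>\<^sup>2 / K)"
        unfolding exp_add[symmetric] by (simp add: N0_def field_simps)
      finally show ?thesis unfolding D_def by simp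
    qed
    then obtain g where g: "\<And>k. g k \<in> fock_ball b D \<and> g k 0 = 1 \<and> (\<forall>x\<in>{x\<in>X. \<iota> x = k}. g k x = 0)" by metis
    define G where "G z = (\<Prod>k\<in>{..<N}. g k z)" for z
    have "G \<in> fock_ball (real (card {..<N}) * b) (D ^ card {..<N})"
      unfolding G_def by (rule fock_ball_prod) (use g in auto)
    moreover have "D ^ N = A1 ^ N * exp (2 * real N * (9 / q\<^sup>2 * s) * \<rho>\<^sup>2 / K)"
      unfolding D_def power_mult_distrib exp_of_nat_mult[symmetric] by (simp add: mult_ac)
    then have "D ^ N \<le> A * exp (2 * real N * (9 / q\<^sup>2 * s) * \<rho>\<^sup>2 / K)"
      by (simp add: A_def)
    ultimately have "G \<in> fock_ball (real N * (pi / s\<^sup>2)) (A * exp (2 * real N * (9 / q\<^sup>2 * s) * \<rho>\<^sup>2 / K))"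
      unfolding b_def by (auto intro: fock_ball_mono)
    moreover have "G 0 = 1" using g by (simp add: G_def)
    moreover have "G x = 0" if "x \<in> X" for x
      unfolding G_def using that \<iota>(1) g[of "\<iota> x"] by (intro prod_zero bexI[of _ "\<iota> x"]) auto
    ultimately show ?thesis by (intro bexI[of _ G] conjI ballI)
  qed
  moreover have "A > 0" using A1 by (simp add: A_def add_nonneg_pos)
  ultimately show ?thesis by (intro exI[of _ A] conjI allI impI) simp_all
qed

section \<open>Sufficiency of the density condition\<close>

text \<open>In a separated set \<open>O(k\<^sup>2)\<close> points have distance about \<open>k\<close> from \<open>z\<close>, so fourth-order decay makes a sum
  over the set converge like \<open>\<Sum> 1 / k\<^sup>2\<close>, uniformly in \<open>z\<close>.\<close>

lemma quartic_gaussian_bound: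
  fixes \<kappa> t :: real
  assumes "\<kappa> > 0" "t \<ge> 0"
  shows "exp (- \<kappa> * t\<^sup>2) \<le> 8 * (1 + 2 / \<kappa>\<^sup>2) / (1 + t) ^ 4"
proof -
  have e: "1 + \<kappa> * t\<^sup>2 + (\<kappa> * t\<^sup>2)\<^sup>2 / 2 \<le> exp (\<kappa> * t\<^sup>2)"
    using exp_lower_Taylor_quadratic[of "\<kappa> * t\<^sup>2"] assms by simp
  have "(1 + t)\<^sup>2 \<le> 2 * (1 + t\<^sup>2)" using zero_le_power2[of "1 - t"] by (simp add: power2_eq_square algebra_simps)
  then have "((1 + t)\<^sup>2)\<^sup>2 \<le> (2 * (1 + t\<^sup>2))\<^sup>2" by (intro power_mono) auto
  also have "\<dots> \<le> 8 * (1 + t ^ 4)" using zero_le_power2[of "1 - t\<^sup>2"] by (simp add: power2_eq_square power4_eq_xxxx algebra_simps)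
  finally have "(1 + t) ^ 4 \<le> 8 * (1 + t ^ 4)" by simp
  also have "1 + t ^ 4 \<le> (1 + 2 / \<kappa>\<^sup>2) * (1 + (\<kappa> * t\<^sup>2)\<^sup>2 / 2)"
  proof -
    have "(1 + 2 / \<kappa>\<^sup>2) * (1 + (\<kappa> * t\<^sup>2)\<^sup>2 / 2) = 1 + t ^ 4 + 2 / \<kappa>\<^sup>2 + (\<kappa> * t\<^sup>2)\<^sup>2 / 2"
      using assms by (simp add: field_simps)
    then show ?thesis by simp
  qed
  also have "\<dots> \<le> (1 + 2 / \<kappa>\<^sup>2) * exp (\<kappa> * t\<^sup>2)"
  proof (rule mult_left_mono)
    have "\<kappa> * t\<^sup>2 \<ge> 0" using assms by simp
    then show "1 + (\<kappa> * t\<^sup>2)\<^sup>2 / 2 \<le> exp (\<kappa> * t\<^sup>2)" using e by linarith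
  qed simp
  finally have "(1 + t) ^ 4 \<le> 8 * ((1 + 2 / \<kappa>\<^sup>2) * exp (\<kappa> * t\<^sup>2))" by simp
  then have "(1 + t) ^ 4 * exp (- \<kappa> * t\<^sup>2) \<le> 8 * ((1 + 2 / \<kappa>\<^sup>2) * exp (\<kappa> * t\<^sup>2)) * exp (- \<kappa> * t\<^sup>2)"
    by (rule mult_right_mono) simp
  also have "\<dots> = 8 * (1 + 2 / \<kappa>\<^sup>2) * (exp (\<kappa> * t\<^sup>2) * exp (- \<kappa> * t\<^sup>2))" by (simp only: mult.assoc)
  also have "exp (\<kappa> * t\<^sup>2) * exp (- \<kappa> * t\<^sup>2) = 1" by (simp add: exp_add[symmetric])
  finally show ?thesis using assms by (subst pos_le_divide_eq) (auto simp: mult.commute)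
qed

lemma gaussian_sum_bounded:
  fixes X :: "complex set"
  assumes q: "q > 0" and sep: "\<And>x y. x \<in> X \<Longrightarrow> y \<in> X \<Longrightarrow> dist x y < q \<Longrightarrow> x = y" and \<kappa>: "\<kappa> > 0"
  shows "\<exists>S>0. \<forall>z F. finite F \<longrightarrow> F \<subseteq> X \<longrightarrow> (\<Sum>x\<in>F. exp (- \<kappa> * (cmod (z - x))\<^sup>2)) \<le> S"
proof -
  define c where "c = 1 + 2 / q"
  define B where "B = 8 * (1 + 2 / \<kappa>\<^sup>2)"
  have c: "c > 0" "c \<ge> 1" "c \<ge> 2 / q" using q by (auto simp: c_def add_pos_pos)
  have B: "B > 0" using \<kappa> by (simp add: B_def add_pos_nonneg)
  have sm: "summable (\<lambda>k. 1 / (real (Suc k))\<^sup>2)"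
    using inverse_power_summable[of 2, where 'a = real] by (subst summable_Suc_iff) (simp add: inverse_eq_divide)
  define S where "S = c\<^sup>2 * B * (\<Sum>k. 1 / (real (Suc k))\<^sup>2)"
  have le: "(\<Sum>x\<in>F. exp (- \<kappa> * (cmod (z - x))\<^sup>2)) \<le> S" if F: "finite F" "F \<subseteq> X" for z F
  proof -
    define g where "g x = nat \<lfloor>cmod (z - x)\<rfloor>" for x
    have g: "real (g x) \<le> cmod (z - x)" "cmod (z - x) \<le> real (g x) + 1" for x
    proof -
      have "real (g x) = of_int \<lfloor>cmod (z - x)\<rfloor>" by (simp add: g_def)
      then show "real (g x) \<le> cmod (z - x)" "cmod (z - x) \<le> real (g x) + 1" by linarith+
    qed
    have "(\<Sum>x\<in>F. exp (- \<kappa> * (cmod (z - x))\<^sup>2)) = (\<Sum>k\<in>g ` F. \<Sum>x\<in>{x\<in>F. g x = k}. exp (- \<kappa> * (cmod (z - x))\<^sup>2))"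
      by (rule sum.group[symmetric]) (use F in auto)
    also have "\<dots> \<le> (\<Sum>k\<in>g ` F. c\<^sup>2 * B * (1 / (real (Suc k))\<^sup>2))"
    proof (rule sum_mono)
      fix k
      let ?Y = "{x\<in>F. g x = k}"
      have fin: "finite ?Y" using F by simp
      have "?Y \<subseteq> cball z (real k + 1)" using g by (auto simp: dist_norm)
      then have "real (card ?Y) \<le> (1 + 2 * (real k + 1) / q)\<^sup>2"
      proof (rule card_disc_le[OF fin])
        show "x = y" if "x \<in> ?Y" "y \<in> ?Y" "dist x y < q" for x y
          using sep[of x y] that F(2) by blast
      qed (use q in auto)
      also have "\<dots> \<le> (c * (real k + 1))\<^sup>2"
        using q by (intro power_mono) (auto simp: c_def field_simps)
      finally have cardY: "real (card ?Y) \<le> (c * (real k + 1))\<^sup>2" .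
      have "(\<Sum>x\<in>?Y. exp (- \<kappa> * (cmod (z - x))\<^sup>2)) \<le> (\<Sum>x\<in>?Y. B / (real k + 1) ^ 4)"
      proof (rule sum_mono)
        fix x assume "x \<in> ?Y"
        then have gx: "g x = k" by simp
        have "exp (- \<kappa> * (cmod (z - x))\<^sup>2) \<le> B / (1 + cmod (z - x)) ^ 4"
          unfolding B_def by (rule quartic_gaussian_bound[OF \<kappa>]) simp
        also have "\<dots> \<le> B / (real k + 1) ^ 4"
        proof (rule divide_left_mono)
          show "(real k + 1) ^ 4 \<le> (1 + cmod (z - x)) ^ 4" using g(1)[of x] gx by (intro power_mono) auto
          show "0 < (1 + cmod (z - x)) ^ 4 * (real k + 1) ^ 4"
            by (intro mult_pos_pos zero_less_power add_pos_nonneg add_nonneg_pos) auto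
        qed (use B in simp)
        finally show "exp (- \<kappa> * (cmod (z - x))\<^sup>2) \<le> B / (real k + 1) ^ 4" .
      qed
      also have "\<dots> = real (card ?Y) * (B / (real k + 1) ^ 4)" by simp
      also have "\<dots> \<le> (c * (real k + 1))\<^sup>2 * (B / (real k + 1) ^ 4)"
        using cardY B by (intro mult_right_mono) auto
      also have "\<dots> = c\<^sup>2 * B * ((real k + 1)\<^sup>2 / (real k + 1) ^ 4)" by (simp add: power_mult_distrib)
      also have "(real k + 1)\<^sup>2 / (real k + 1) ^ 4 = 1 / (real (Suc k))\<^sup>2"
      proof -
        have "u\<^sup>2 / u ^ 4 = 1 / u\<^sup>2" if "u > 0" for u :: real
          using that by (simp add: power2_eq_square power4_eq_xxxx)
        from this[of "real k + 1"] show ?thesis by (simp add: add.commute)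
      qed
      finally show "(\<Sum>x\<in>?Y. exp (- \<kappa> * (cmod (z - x))\<^sup>2)) \<le> c\<^sup>2 * B * (1 / (real (Suc k))\<^sup>2)" .
    qed
    also have "\<dots> = c\<^sup>2 * B * (\<Sum>k\<in>g ` F. 1 / (real (Suc k))\<^sup>2)" by (simp only: sum_distrib_left)
    also have "\<dots> \<le> S" unfolding S_def
      using F B by (intro mult_left_mono sum_le_suminf sm) auto
    finally show ?thesis .
  qed
  have "S + 1 > 0" using le[of "{}" 0] by simp
  moreover have "(\<Sum>x\<in>F. exp (- \<kappa> * (cmod (z - x))\<^sup>2)) \<le> S + 1" if "finite F" "F \<subseteq> X" for z F
    using le[OF that, of z] by linarith
  ultimately show ?thesis by (intro exI[of _ "S + 1"]) auto
qed

lemma dominated_infsum: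
  fixes u :: "'i \<Rightarrow> complex" and e :: "'i \<Rightarrow> real"
  assumes e: "\<And>F. finite F \<Longrightarrow> F \<subseteq> A \<Longrightarrow> sum e F \<le> S" "\<And>i. i \<in> A \<Longrightarrow> e i \<ge> 0"
    and u: "\<And>i. i \<in> A \<Longrightarrow> cmod (u i) \<le> c * e i" and c: "c \<ge> 0"
  shows "e summable_on A" "u summable_on A" "cmod (\<Sum>\<^sub>\<infinity>i\<in>A. u i) \<le> c * S"
proof -
  show es: "e summable_on A"
    by (rule nonneg_bdd_above_summable_on) (use e in \<open>auto intro!: bdd_aboveI2[where M = S]\<close>)
  have ce: "(\<lambda>i. c * e i) summable_on A" by (rule summable_on_cmult_right[OF es])
  show us: "u summable_on A"
    by (rule abs_summable_summable, rule summable_on_comparison_test[OF ce]) (use u in auto)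
  have "cmod (\<Sum>\<^sub>\<infinity>i\<in>A. u i) \<le> (\<Sum>\<^sub>\<infinity>i\<in>A. c * e i)"
    by (rule norm_infsum_le[OF has_sum_infsum[OF us] has_sum_infsum[OF ce]]) (use u in auto)
  also have "\<dots> = c * infsum e A" by (rule infsum_cmult_right')
  also have "\<dots> \<le> c * S" using c by (intro mult_left_mono infsum_le_finite_sums[OF es] e) auto
  finally show "cmod (\<Sum>\<^sub>\<infinity>i\<in>A. u i) \<le> c * S" .
qed

lemma phase_centre: "phase a (- x) x = 1"
proof -
  have "Im (cnj (- x) * x) = 0" by simp
  then show ?thesis unfolding phase_def by simp
qed

text \<open>The function \<open>f x\<close>, the translate of \<open>g x\<close> to \<open>x\<close>, decays in the weighted sense like
  \<open>e\<^bsup>-2k|z-x|\<^sup>2\<^esup>\<close> with \<open>k = (a - a') / 4\<close>. In \<open>F = \<Sum> v x f x\<close>, half of this decay makes the sum converge; at a point of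
  \<open>X\<close> only terms with \<open>|x - y| > \<rho>\<close> contribute to the error, and there the other half gives
  the factor \<open>e\<^bsup>-k\<rho>\<^sup>2\<^esup>\<close>.\<close>

lemma interpolates_of_local_interpolants:
  fixes X :: "complex set"
  assumes a: "a > 0" and a': "a' < a" and D: "D \<ge> 0"
    and g: "\<And>x. x \<in> X \<Longrightarrow> g x \<in> fock_ball a' D \<and> g x 0 = 1 \<and> (\<forall>y\<in>X - {x}. cmod (y - x) \<le> \<rho> \<longrightarrow> g x (y - x) = 0)"
    and S: "\<And>z F. finite F \<Longrightarrow> F \<subseteq> X \<Longrightarrow> (\<Sum>x\<in>F. exp (- ((a - a') / 4) * (cmod (z - x))\<^sup>2)) \<le> S"
    and small: "D * exp (- (a - a') * \<rho>\<^sup>2 / 4) * S \<le> 1 / 2" and \<rho>: "\<rho> \<ge> 0"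
  shows "interpolates a (2 * (D * S)) X"
proof -
  define k where "k = (a - a') / 4"
  have k: "k > 0" using a' by (simp add: k_def)
  define e where "e z x = exp (- k * (cmod (z - x))\<^sup>2)" for z x
  have eS: "sum (e z) F \<le> S" if "finite F" "F \<subseteq> X" for z F
    using S[OF that] by (simp add: e_def k_def)
  have S0: "S \<ge> 0" using S[of "{}"] by simp
  define f where "f x = fock_shift a (- x) (g x)" for x
  have f_hol: "f x holomorphic_on UNIV" if "x \<in> X" for x
    unfolding f_def using g[OF that] by (intro holomorphic_intros) (auto dest: fock_ballD)
  have f_val: "cmod (weighted a (f x) z) \<le> D * exp (- (2 * k) * (cmod (z - x))\<^sup>2)" if x: "x \<in> X" for x z
  proof -
    have "cmod (weighted a (f x) z) = cmod (weighted a (g x) (z - x))"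
      by (simp add: f_def weighted_fock_shift norm_mult)
    also have "\<dots> = exp (- a * (cmod (z - x))\<^sup>2 / 2) * cmod (g x (z - x))" by (rule cmod_weighted)
    also have "\<dots> \<le> exp (- a * (cmod (z - x))\<^sup>2 / 2) * (D * exp (a' * (cmod (z - x))\<^sup>2 / 2))"
      using g[OF x] by (intro mult_left_mono cmod_le_of_weighted_le) (auto dest: fock_ballD)
    also have "\<dots> = D * exp (- a * (cmod (z - x))\<^sup>2 / 2 + a' * (cmod (z - x))\<^sup>2 / 2)"
      by (simp only: exp_add mult_ac)
    also have "- a * (cmod (z - x))\<^sup>2 / 2 + a' * (cmod (z - x))\<^sup>2 / 2 = - (2 * k) * (cmod (z - x))\<^sup>2"
      by (simp add: k_def field_simps)
    finally show ?thesis .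
  qed
  have f_le: "cmod (weighted a (f x) z) \<le> D * e z x" if x: "x \<in> X" for x z
  proof -
    have "exp (- (2 * k) * (cmod (z - x))\<^sup>2) \<le> e z x" unfolding e_def using k by (simp add: mult_right_mono)
    then have "D * exp (- (2 * k) * (cmod (z - x))\<^sup>2) \<le> D * e z x" using D by (rule mult_left_mono)
    then show ?thesis using f_val[OF x, of z] by linarith
  qed
  show ?thesis
  proof (rule approximate_interpolation_suffices[OF a])
    show "D * S \<ge> 0" using D S0 by simp
    fix v :: "complex \<Rightarrow> complex" assume v: "\<And>x. x \<in> X \<Longrightarrow> cmod (v x) \<le> 1"
    define w where "w z x = v x * weighted a (f x) z" for z x
    have w_le: "cmod (w z x) \<le> D * e z x" if "x \<in> X" for z x
    proof -
      have "cmod (w z x) \<le> 1 * cmod (weighted a (f x) z)"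
        unfolding w_def norm_mult using v[OF that] by (intro mult_right_mono) auto
      then show ?thesis using f_le[OF that, of z] by linarith
    qed
    have e0: "e z x \<ge> 0" for z x by (simp add: e_def)
    define F where "F z = (\<Sum>\<^sub>\<infinity>x\<in>X. v x * f x z)" for z
    have F_hol: "F holomorphic_on UNIV"
      unfolding F_def
    proof (rule entire_infsum)
      show "(\<lambda>z. v x * f x z) holomorphic_on UNIV" if "x \<in> X" for x
        using f_hol[OF that] by (intro holomorphic_intros)
      fix R :: real
      have bd: "cmod (v x * f x z) \<le> D * exp (a * R\<^sup>2 / 2) * exp (2 * k * R\<^sup>2) * e 0 x" if x: "x \<in> X" and z: "cmod z \<le> R" for x z
      proof -
        have R2: "(cmod z)\<^sup>2 \<le> R\<^sup>2" using z by (intro power_mono) auto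
        have "cmod x \<le> cmod (z - x) + cmod z" using norm_triangle_ineq4[of z "z - x"] by simp
        then have "(cmod x)\<^sup>2 \<le> (cmod (z - x) + cmod z)\<^sup>2" by (intro power_mono) auto
        also have "\<dots> \<le> 2 * (cmod (z - x))\<^sup>2 + 2 * (cmod z)\<^sup>2"
          using zero_le_power2[of "cmod (z - x) - cmod z"] by (simp add: power2_eq_square algebra_simps)
        finally have "(cmod x)\<^sup>2 \<le> 2 * (cmod (z - x))\<^sup>2 + 2 * R\<^sup>2" using R2 by linarith
        then have "k * (cmod x)\<^sup>2 \<le> k * (2 * (cmod (z - x))\<^sup>2 + 2 * R\<^sup>2)" using k by (intro mult_left_mono) auto
        then have "exp (- (2 * k) * (cmod (z - x))\<^sup>2) \<le> exp (2 * k * R\<^sup>2 + (- k * (cmod (0 - x))\<^sup>2))"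
          by (simp add: algebra_simps)
        then have 1: "D * exp (- (2 * k) * (cmod (z - x))\<^sup>2) \<le> D * (exp (2 * k * R\<^sup>2) * e 0 x)"
          unfolding e_def exp_add using D by (intro mult_left_mono) auto
        have "cmod (f x z) \<le> D * (exp (2 * k * R\<^sup>2) * e 0 x) * exp (a * (cmod z)\<^sup>2 / 2)"
          using f_val[OF x, of z] 1 by (intro cmod_le_of_weighted_le) linarith
        also have "\<dots> \<le> D * (exp (2 * k * R\<^sup>2) * e 0 x) * exp (a * R\<^sup>2 / 2)"
          using R2 a D e0 by (intro mult_left_mono) (auto intro!: mult_nonneg_nonneg)
        finally have "1 * cmod (f x z) \<le> D * exp (a * R\<^sup>2 / 2) * exp (2 * k * R\<^sup>2) * e 0 x" by (simp add: mult_ac)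
        moreover have "cmod (v x * f x z) \<le> 1 * cmod (f x z)"
          unfolding norm_mult using v[OF x] by (intro mult_right_mono) auto
        ultimately show ?thesis by linarith
      qed
      have "e 0 summable_on X"
        by (rule dominated_infsum(1)[of X "e 0" S "\<lambda>_. 0" 0]) (use eS e0 in auto)
      then have "(\<lambda>x. D * exp (a * R\<^sup>2 / 2) * exp (2 * k * R\<^sup>2) * e 0 x) summable_on X"
        by (rule summable_on_cmult_right)
      then show "\<exists>b. b summable_on X \<and> (\<forall>i\<in>X. \<forall>z. cmod z \<le> R \<longrightarrow> cmod (v i * f i z) \<le> b i)"
        using bd by (intro exI[of _ "\<lambda>x. D * exp (a * R\<^sup>2 / 2) * exp (2 * k * R\<^sup>2) * e 0 x"] conjI ballI allI impI)
    qed
    have F_w: "weighted a F z = (\<Sum>\<^sub>\<infinity>x\<in>X. w z x)" for z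
      unfolding weighted_def F_def infsum_cmult_right'[symmetric] w_def
      by (intro infsum_cong) (simp add: mult_ac)
    have "F \<in> fock_ball a (D * S)"
    proof (rule fock_ballI[OF F_hol])
      show "cmod (weighted a F z) \<le> D * S" for z
        unfolding F_w by (rule dominated_infsum(3)[of X "e z"]) (use eS e0 w_le D in auto)
    qed
    moreover have "cmod (v x - weighted a F x) \<le> 1/2" if x: "x \<in> X" for x
    proof -
      have fx: "w x x = v x"
      proof -
        have "weighted a (f x) x = 1"
          unfolding f_def weighted_fock_shift phase_centre using g[OF x] by (simp add: weighted_def)
        then show ?thesis by (simp add: w_def)
      qed
      have wsum: "w x summable_on X"
        by (rule dominated_infsum(2)[of X "e x" S _ D]) (use eS e0 w_le D in auto)
      have "(\<Sum>\<^sub>\<infinity>y\<in>X. w x y) = (\<Sum>\<^sub>\<infinity>y\<in>{x} \<union> (X - {x}). w x y)" using x by (simp add: insert_absorb)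
      also have "\<dots> = (\<Sum>\<^sub>\<infinity>y\<in>{x}. w x y) + (\<Sum>\<^sub>\<infinity>y\<in>X - {x}. w x y)"
        by (rule infsum_Un_disjoint) (use summable_on_subset_banach[OF wsum, of "X - {x}"] in auto)
      finally have eq: "weighted a F x = v x + (\<Sum>\<^sub>\<infinity>y\<in>X - {x}. w x y)" by (simp add: F_w fx)
      have "cmod (\<Sum>\<^sub>\<infinity>y\<in>X - {x}. w x y) \<le> (D * exp (- (a - a') * \<rho>\<^sup>2 / 4)) * S"
      proof (rule dominated_infsum(3)[of "X - {x}" "e x"])
        show "sum (e x) F \<le> S" if "finite F" "F \<subseteq> X - {x}" for F
          using that by (intro eS) auto
        fix y assume y: "y \<in> X - {x}"
        show "cmod (w x y) \<le> D * exp (- (a - a') * \<rho>\<^sup>2 / 4) * e x y"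
        proof (cases "cmod (x - y) \<le> \<rho>")
          case True
          then have "g y (x - y) = 0" using g[of y] y x by auto
          then have "w x y = 0" by (simp add: w_def f_def weighted_def fock_shift_def)
          then show ?thesis using D e0[of x y] by simp
        next
          case False
          then have "\<rho>\<^sup>2 \<le> (cmod (x - y))\<^sup>2" using \<rho> by (intro power_mono) auto
          then have "k * \<rho>\<^sup>2 \<le> k * (cmod (x - y))\<^sup>2" using k by (intro mult_left_mono) auto
          then have "exp (- (2 * k) * (cmod (x - y))\<^sup>2) \<le> exp (- k * \<rho>\<^sup>2 + (- k * (cmod (x - y))\<^sup>2))" by simp
          also have "- k * \<rho>\<^sup>2 = - (a - a') * \<rho>\<^sup>2 / 4" by (simp add: k_def field_simps)
          also have "exp (- (a - a') * \<rho>\<^sup>2 / 4 + (- k * (cmod (x - y))\<^sup>2)) = exp (- (a - a') * \<rho>\<^sup>2 / 4) * e x y"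
            by (simp only: exp_add e_def)
          finally have "D * exp (- (2 * k) * (cmod (x - y))\<^sup>2) \<le> D * (exp (- (a - a') * \<rho>\<^sup>2 / 4) * e x y)"
            using D by (rule mult_left_mono)
          moreover have "cmod (w x y) \<le> 1 * cmod (weighted a (f y) x)"
            unfolding w_def norm_mult using v y by (intro mult_right_mono) auto
          ultimately show ?thesis using f_val[of y x] y by simp
        qed
      qed (use e0 D in auto)
      then show ?thesis using small by (simp add: eq norm_minus_commute)
    qed
    ultimately show "\<exists>f\<in>fock_ball a (D * S). \<forall>x\<in>X. cmod (v x - weighted a f x) \<le> 1/2"
      by (intro bexI[of _ F] ballI)
  qed
qed

lemma cell_subset_square:
  assumes "s > 0" "cell_index s z = (i, j)"
  shows "z \<in> cbox (Complex (s * of_int i) (s * of_int j)) (Complex (s * of_int i) (s * of_int j) + Complex s s)"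
proof -
  have *: "s * of_int \<lfloor>x / s\<rfloor> \<le> x" "x \<le> s * of_int \<lfloor>x / s\<rfloor> + s" for x
  proof -
    have "of_int \<lfloor>x / s\<rfloor> \<le> x / s" "x / s \<le> of_int \<lfloor>x / s\<rfloor> + 1" by linarith+
    then have "of_int \<lfloor>x / s\<rfloor> * s \<le> x" "x \<le> (of_int \<lfloor>x / s\<rfloor> + 1) * s"
      using assms by (simp_all only: pos_le_divide_eq pos_divide_le_eq)
    then show "s * of_int \<lfloor>x / s\<rfloor> \<le> x" "x \<le> s * of_int \<lfloor>x / s\<rfloor> + s" by (simp_all add: algebra_simps)
  qed
  have ij: "i = \<lfloor>Re z / s\<rfloor>" "j = \<lfloor>Im z / s\<rfloor>" using assms(2) by (auto simp: cell_index_def)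
  show ?thesis using *[of "Re z"] *[of "Im z"] by (simp add: in_cbox_complex_iff ij)
qed

theorem interpolation_set_sufficient:
  assumes a: "a > 0" and I: "compact I" "emeasure lebesgue I = 1" and ud: "uniform_discrete X"
    and dens: "upper_uniform_density I X < ereal (a / pi)"
  shows "interpolation_set a X"
proof -
  obtain s N where s: "s \<ge> 4" and a'a: "real N * (pi / s\<^sup>2) < a" and cells: "\<forall>w. card (X \<inter> cbox w (w + Complex s s)) \<le> N"
    by (rule subcritical_squares[OF a I ud dens])
  obtain q0 where q0: "q0 > 0" "\<forall>x\<in>X. \<forall>y\<in>X. dist x y < q0 \<longrightarrow> x = y"
    using ud unfolding uniform_discrete_def by auto
  define q where "q = min q0 1"
  have q: "0 < q" "q \<le> 1" and sep: "\<And>x y. x \<in> X \<Longrightarrow> y \<in> X \<Longrightarrow> dist x y < q \<Longrightarrow> x = y"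
    using q0 by (auto simp: q_def)
  define a' where "a' = real N * (pi / s\<^sup>2)"
  define k where "k = (a - a') / 4"
  have k: "k > 0" using a'a by (simp add: k_def a'_def)
  define c1 where "c1 = 2 * real N * (9 / q\<^sup>2 * s)"
  have c1: "c1 \<ge> 0" using s q by (simp add: c1_def)
  \<comment> \<open>Makes the loss \<open>c1 \<rho>\<^sup>2 / K\<close> at most half of the gain \<open>k \<rho>\<^sup>2\<close>.\<close>
  define K where "K = 2 * (c1 + 1) / k"
  have K: "K > 0" using c1 k by (simp add: K_def)
  have cK: "c1 / K \<le> k / 2"
  proof -
    have "c1 / K = (c1 / (c1 + 1)) * (k / 2)" using k c1 by (simp add: K_def)
    also have "\<dots> \<le> 1 * (k / 2)" using c1 k by (intro mult_right_mono) auto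
    finally show ?thesis by simp
  qed
  obtain A where A: "A > 0" and loc: "\<forall>\<rho>\<ge>1. \<forall>X. finite X \<longrightarrow> X \<subseteq> cball 0 \<rho> \<longrightarrow> (\<forall>x\<in>X. cmod x \<ge> q) \<longrightarrow>
    (\<forall>x\<in>X. \<forall>y\<in>X. dist x y < q \<longrightarrow> x = y) \<longrightarrow> (\<forall>c. card {x\<in>X. cell_index s x = c} \<le> N) \<longrightarrow>
    (\<exists>g\<in>fock_ball a' (A * exp (c1 * \<rho>\<^sup>2 / K)). g 0 = 1 \<and> (\<forall>x\<in>X. g x = 0))"
    using local_interpolant[OF q s K, of N] unfolding a'_def c1_def by auto
  have "\<exists>S>0. \<forall>z F. finite F \<longrightarrow> F \<subseteq> X \<longrightarrow> (\<Sum>x\<in>F. exp (- k * (cmod (z - x))\<^sup>2)) \<le> S"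
    by (rule gaussian_sum_bounded[OF q(1) _ k]) (rule sep)
  then obtain S where S: "S > 0" and gauss: "\<forall>z F. finite F \<longrightarrow> F \<subseteq> X \<longrightarrow> (\<Sum>x\<in>F. exp (- k * (cmod (z - x))\<^sup>2)) \<le> S"
    by auto
  obtain \<rho> where \<rho>: "\<rho> \<ge> 1" and small: "A * exp (c1 * \<rho>\<^sup>2 / K) * exp (- (a - a') * \<rho>\<^sup>2 / 4) * S \<le> 1/2"
  proof -
    define \<rho> where "\<rho> = 1 + 4 * A * S / k"
    have \<rho>1: "\<rho> \<ge> 1" using A S k by (simp add: \<rho>_def)
    have "\<rho> \<le> \<rho>\<^sup>2" using \<rho>1 by (simp add: power2_eq_square)
    have "exp (c1 * \<rho>\<^sup>2 / K) * exp (- (a - a') * \<rho>\<^sup>2 / 4) = exp (c1 / K * \<rho>\<^sup>2 - k * \<rho>\<^sup>2)"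
      by (simp add: exp_add[symmetric] k_def field_simps)
    also have "\<dots> \<le> exp (- (k / 2) * \<rho>)"
    proof -
      have "c1 / K * \<rho>\<^sup>2 \<le> k / 2 * \<rho>\<^sup>2" using cK by (intro mult_right_mono) auto
      moreover have "k / 2 * \<rho> \<le> k / 2 * \<rho>\<^sup>2" using \<open>\<rho> \<le> \<rho>\<^sup>2\<close> k by (intro mult_left_mono) auto
      ultimately show ?thesis unfolding exp_le_cancel_iff by linarith
    qed
    finally have "A * S * (exp (c1 * \<rho>\<^sup>2 / K) * exp (- (a - a') * \<rho>\<^sup>2 / 4)) \<le> A * S * exp (- (k / 2) * \<rho>)"
      using A S by (intro mult_left_mono) auto
    also have "\<dots> \<le> 1 / 2"
    proof -
      have "2 * A * S \<le> k / 2 * \<rho>" using k by (simp add: \<rho>_def field_simps)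
      also have "\<dots> \<le> exp (k / 2 * \<rho>)" using exp_ge_add_one_self[of "k / 2 * \<rho>"] by linarith
      finally have "2 * A * S * exp (- (k / 2) * \<rho>) \<le> exp (k / 2 * \<rho>) * exp (- (k / 2) * \<rho>)"
        by (rule mult_right_mono) simp
      also have "\<dots> = 1" by (simp add: exp_add[symmetric])
      finally show ?thesis by simp
    qed
    finally have "A * exp (c1 * \<rho>\<^sup>2 / K) * exp (- (a - a') * \<rho>\<^sup>2 / 4) * S \<le> 1/2" by (simp add: mult_ac)
    then show ?thesis using that \<rho>1 by blast
  qed
  define D where "D = A * exp (c1 * \<rho>\<^sup>2 / K)"
  have "\<exists>g. g \<in> fock_ball a' D \<and> g 0 = 1 \<and> (\<forall>y\<in>X - {x}. cmod (y - x) \<le> \<rho> \<longrightarrow> g (y - x) = 0)" if x: "x \<in> X" for x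
  proof -
    define Y where "Y = (\<lambda>y. y - x) ` ((X - {x}) \<inter> cball x \<rho>)"
    have "finite (X \<inter> cball x \<rho>)" by (rule finite_Int_bounded_of_sep[OF ud]) simp
    then have "finite ((X - {x}) \<inter> cball x \<rho>)" by (rule finite_subset[rotated]) auto
    then have 1: "finite Y" unfolding Y_def by simp
    have 2: "Y \<subseteq> cball 0 \<rho>" by (auto simp: Y_def dist_norm norm_minus_commute)
    have 3: "\<forall>y\<in>Y. cmod y \<ge> q" using sep x by (force simp: Y_def dist_norm)
    have 4: "\<forall>y\<in>Y. \<forall>z\<in>Y. dist y z < q \<longrightarrow> y = z" using sep by (auto simp: Y_def dist_norm)
    have 5: "\<forall>c. card {y\<in>Y. cell_index s y = c} \<le> N"
    proof
      fix c :: "int \<times> int"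
      obtain i j where c: "c = (i, j)" by (cases c)
      define w where "w = Complex (s * of_int i) (s * of_int j)"
      have "(\<lambda>y. y + x) ` {y\<in>Y. cell_index s y = c} \<subseteq> X \<inter> cbox (w + x) (w + x + Complex s s)"
      proof
        fix u assume "u \<in> (\<lambda>y. y + x) ` {y\<in>Y. cell_index s y = c}"
        then obtain y where y: "y \<in> Y" "cell_index s y = c" "u = y + x" by auto
        have "y \<in> cbox w (w + Complex s s)"
          unfolding w_def by (rule cell_subset_square) (use s y c in auto)
        then have "u \<in> cbox (w + x) (w + x + Complex s s)" using y(3) by (simp add: in_cbox_complex_iff)
        moreover have "u \<in> X" using y by (auto simp: Y_def)
        ultimately show "u \<in> X \<inter> cbox (w + x) (w + x + Complex s s)" by simp
      qed
      moreover have "finite (X \<inter> cbox (w + x) (w + x + Complex s s))" by (rule finite_Int_bounded_of_sep[OF ud]) simp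
      ultimately have "card ((\<lambda>y. y + x) ` {y\<in>Y. cell_index s y = c}) \<le> card (X \<inter> cbox (w + x) (w + x + Complex s s))"
        by (intro card_mono)
      also have "\<dots> \<le> N" using cells by simp
      also have "card ((\<lambda>y. y + x) ` {y\<in>Y. cell_index s y = c}) = card {y\<in>Y. cell_index s y = c}"
        by (intro card_image inj_onI) simp
      finally show "card {y\<in>Y. cell_index s y = c} \<le> N" .
    qed
    obtain g where g: "g \<in> fock_ball a' D" "g 0 = 1" "\<forall>y\<in>Y. g y = 0"
      using loc[rule_format, OF \<rho> 1 2 bspec[OF 3] _ spec[OF 5]] 4 unfolding D_def by blast
    have "g (y - x) = 0" if "y \<in> X - {x}" "cmod (y - x) \<le> \<rho>" for y
    proof -
      have "y - x \<in> Y" unfolding Y_def using that by (intro imageI) (auto simp: dist_norm norm_minus_commute)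
      then show ?thesis using g(3) by simp
    qed
    then show ?thesis using g by auto
  qed
  then obtain g where g: "\<And>x. x \<in> X \<Longrightarrow> g x \<in> fock_ball a' D \<and> g x 0 = 1 \<and> (\<forall>y\<in>X - {x}. cmod (y - x) \<le> \<rho> \<longrightarrow> g x (y - x) = 0)"
    by metis
  have "interpolates a (2 * (D * S)) X"
  proof (rule interpolates_of_local_interpolants[OF a _ _ g])
    show "a' < a" using a'a by (simp add: a'_def)
    show "D \<ge> 0" using A by (simp add: D_def)
    show "(\<Sum>x\<in>F. exp (- ((a - a') / 4) * (cmod (z - x))\<^sup>2)) \<le> S" if "finite F" "F \<subseteq> X" for z F
      using gauss that by (simp add: k_def)
    show "D * exp (- (a - a') * \<rho>\<^sup>2 / 4) * S \<le> 1/2" using small by (simp add: D_def)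
    show "\<rho> \<ge> 0" using \<rho> by simp
  qed
  then show ?thesis by (rule interpolation_set_of_interpolates)
qed

theorem theorem1p4:
  fixes \<alpha> :: real and I \<Gamma> :: "complex set"
  assumes "\<alpha> > 0"
    and "compact I" and "emeasure lebesgue I = 1" and "emeasure lebesgue (frontier I) = 0"
    and "discrete \<Gamma>"
  shows "interpolation_set \<alpha> \<Gamma> \<longleftrightarrow>
    uniform_discrete \<Gamma> \<and> upper_uniform_density I \<Gamma> < ereal (\<alpha> / pi)"
  using interpolation_set_necessary[OF assms(1-3)] interpolation_set_sufficient[OF assms(1-3)] by auto

end
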